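(* Let $m\ge 0$, $n\ge1$, $D\ge1$ be integers. The following holds both for $\mathbb X=C^m(\mathbb R^n,\mathbb R^D)$ and for $\mathbb X=\dot C^m(\mathbb R^n,\mathbb R^D)$. Let $S\subset\mathbb R^n$ be a finite set of diameter at most $1$. For each $x\in S$, let $\vec G(x)\subset\vec{\mathcal P}$ be convex. Suppose that for every subset $S'\subset S$ with $|S'|\le 2^{\dim\vec{\mathcal P}}$ there exists $\vec F^{S'}\in\mathbb X$ such that $\|\vec F^{S'}\|_{\mathbb X}\le 1$ and $\mathscr J_x\vec F^{S'}\in\vec G(x)$ for all $x\in S'$. Then there exists $\vec F\in\mathbb X$ such that $\|\vec F\|_{\mathbb X}\le\gamma$ and $\mathscr J_x\vec F\in\vec G(x)$ for all $x\in S$. Here $\gamma$ depends only on $m,n,D$ and $|S|$.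
   Context: $\mathcal P$ is the vector space of real polynomials on $\mathbb R^n$ of degree at most $m-1$ (with $\mathcal P=\{0\}$ if $m=0$), and $\vec{\mathcal P}=\bigoplus_{j=1}^D\mathcal P$, so $\dim\vec{\mathcal P}=D\binom{n+m-1}{m-1}$. $|S|$ is the cardinality of a finite set $S$. For $F$ that is $(m-1)$-times differentiable at $x$, $\mathscr J_xF\in\mathcal P$ is its $(m-1)$-st degree Taylor polynomial at $x$: $\mathscr J_xF(y)=\sum_{|\alpha|\le m-1}\frac{\partial^\alpha F(x)}{\alpha!}(y-x)^\alpha$. For $\vec F=(F_1,\dots,F_D)$, $\mathscr J_x\vec F=(\mathscr J_xF_1,\dots,\mathscr J_xF_D)\in\vec{\mathcal P}$. $C^m(\mathbb R^n,\mathbb R^D)$ is the space of $\vec F:\mathbb R^n\to\mathbb R^D$ whose derivatives up to order $m$ are continuous and bounded, with norm $\max_{|\alpha|\le m,\,1\le j\le D}\sup_{x\in\mathbb R^n}|\partial^\alpha F_j(x)|$. $\dot C^m(\mathbb R^n,\mathbb R^D)$ is the vector space of $m$-times continuously differentiable $\vec F:\mathbb R^n\to\mathbb R^D$ whose $m$-th order derivatives are bounded, with seminorm $\max_{|\alpha|=m,\,1\le j\le D}\sup_{x\in\mathbb R^n}|\partial^\alpha F_j(x)|$. *)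

theory Defs
  imports "HOL-Analysis.Analysis" "HOL-Library.Function_Algebras"
begin

text \<open>
  Pointwise scalar multiplication makes real-valued functions a real vector space, so that the
  library notions \<^term>\<open>span\<close>, \<^term>\<open>dim\<close> and \<^term>\<open>convex\<close> apply to spaces of polynomial functions.
\<close>

instantiation "fun" :: (type, real_vector) real_vector
begin

definition scaleR_fun_def: "scaleR c f = (\<lambda>x. c *\<^sub>R f x)"

instance
  by standard (auto simp: scaleR_fun_def fun_eq_iff plus_fun_def algebra_simps)

end

text \<open>Multi-indices on $n$ variables are functions from the index type to the naturals.\<close>

type_synonym 'n mindex = "'n \<Rightarrow> nat"

definition mi_order :: "'n::finite mindex \<Rightarrow> nat" where
  "mi_order \<alpha> = (\<Sum>i\<in>UNIV. \<alpha> i)"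

definition mi_fact :: "'n::finite mindex \<Rightarrow> real" where
  "mi_fact \<alpha> = (\<Prod>i\<in>UNIV. fact (\<alpha> i))"

definition monomial :: "'n::finite mindex \<Rightarrow> real^'n \<Rightarrow> real" where
  "monomial \<alpha> y = (\<Prod>i\<in>UNIV. (y $ i) ^ \<alpha> i)"

definition partial_deriv :: "'n::finite \<Rightarrow> (real^'n \<Rightarrow> real) \<Rightarrow> real^'n \<Rightarrow> real" where
  "partial_deriv i f x = deriv (\<lambda>t. f (x + t *\<^sub>R axis i 1)) 0"

text \<open>
  The derivative $\partial^\alpha f$ differentiates $\alpha_i$ times in direction $i$.  The index
  type carries no order, so the order in which the derivatives are taken is an arbitrary (but fixed)
  one; for the functions of class $C^{|\alpha|}$ to which it is applied, it does not matter.
\<close>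

definition mi_deriv :: "'n::finite mindex \<Rightarrow> (real^'n \<Rightarrow> real) \<Rightarrow> real^'n \<Rightarrow> real" where
  "mi_deriv \<alpha> f = foldr partial_deriv (SOME is. count_list is = \<alpha>) f"

primrec cont_diff :: "nat \<Rightarrow> (real^'n::finite \<Rightarrow> real) \<Rightarrow> bool" where
  "cont_diff 0 f \<longleftrightarrow> continuous_on UNIV f"
| "cont_diff (Suc k) f \<longleftrightarrow>
     (\<forall>x. f differentiable (at x)) \<and> (\<forall>i. cont_diff k (partial_deriv i f))"

definition Cm :: "nat \<Rightarrow> (real^'n::finite \<Rightarrow> real^'d::finite) set" where
  "Cm m = {F. \<forall>j. cont_diff m (\<lambda>x. F x $ j) \<and>
                  (\<forall>\<alpha>. mi_order \<alpha> \<le> m \<longrightarrow> bounded (range (mi_deriv \<alpha> (\<lambda>x. F x $ j))))}"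

definition Cm_norm :: "nat \<Rightarrow> (real^'n::finite \<Rightarrow> real^'d::finite) \<Rightarrow> real" where
  "Cm_norm m F =
     (MAX (\<alpha>, j) \<in> {\<alpha>. mi_order \<alpha> \<le> m} \<times> UNIV. SUP x. \<bar>mi_deriv \<alpha> (\<lambda>x. F x $ j) x\<bar>)"

definition Cm_dot :: "nat \<Rightarrow> (real^'n::finite \<Rightarrow> real^'d::finite) set" where
  "Cm_dot m = {F. \<forall>j. cont_diff m (\<lambda>x. F x $ j) \<and>
                      (\<forall>\<alpha>. mi_order \<alpha> = m \<longrightarrow> bounded (range (mi_deriv \<alpha> (\<lambda>x. F x $ j))))}"

definition Cm_dot_norm :: "nat \<Rightarrow> (real^'n::finite \<Rightarrow> real^'d::finite) \<Rightarrow> real" where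
  "Cm_dot_norm m F =
     (MAX (\<alpha>, j) \<in> {\<alpha>. mi_order \<alpha> = m} \<times> UNIV. SUP x. \<bar>mi_deriv \<alpha> (\<lambda>x. F x $ j) x\<bar>)"

text \<open>
  Polynomials are identified with the functions they define.  The bound $|\alpha| \le m-1$ is written
  as $|\alpha| < m$, so that $m = 0$ gives the zero space.
\<close>

definition polys :: "nat \<Rightarrow> (real^'n::finite \<Rightarrow> real) set" where
  "polys m = span {monomial \<alpha> | \<alpha>. mi_order \<alpha> < m}"

definition vec_polys :: "nat \<Rightarrow> ((real^'n::finite \<Rightarrow> real)^'d::finite) set" where
  "vec_polys m = {p. \<forall>j. p $ j \<in> polys m}"

definition jet :: "nat \<Rightarrow> real^'n::finite \<Rightarrow> (real^'n \<Rightarrow> real) \<Rightarrow> real^'n \<Rightarrow> real" where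
  "jet m x f =
     (\<lambda>y. \<Sum>\<alpha> | mi_order \<alpha> < m. mi_deriv \<alpha> f x / mi_fact \<alpha> * monomial \<alpha> (y - x))"

definition vec_jet ::
  "nat \<Rightarrow> real^'n::finite \<Rightarrow> (real^'n \<Rightarrow> real^'d::finite) \<Rightarrow> (real^'n \<Rightarrow> real)^'d" where
  "vec_jet m x F = (\<chi> j. jet m x (\<lambda>z. F z $ j))"

end

theory Submission
  imports Defs
begin

text \<open>
  Suppose that no function of norm at most \<open>\<gamma>\<close> has its jets in the sets \<open>G x\<close>.  By Hahn--Banach there
  are linear functionals \<open>\<xi> x\<close> on vector polynomials such that \<open>\<Sum>x\<in>S. \<xi> x (p x)\<close> is at most \<open>1\<close> on the
  jets \<open>p\<close> of functions of norm \<open>1\<close>, while the infima of \<open>\<xi> x\<close> over \<open>G x\<close> add up to at least \<open>\<gamma>\<close>.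
  It therefore suffices to write \<open>\<xi>\<close> as a sum of boundedly many families \<open>c x * \<xi> x\<close> with \<open>c \<ge> 0\<close>, of
  controlled dual norm, each supported on at most \<open>2 ^ dim\<close> points: for these the hypothesis applies.
  If the support has more points, one looks for weights \<open>e\<close> that are not nearly constant and for which
  \<open>e x * \<xi> x\<close> has controlled dual norm; moving from the constant weight \<open>1\<close> in the directions \<open>e\<close> and
  \<open>-e\<close> until a coordinate vanishes splits the family into two with smaller support.

  The weights come from a tree of clusters.  By Taylor's formula and a cutoff function for each cluster,
  the dual norm is comparable to the largest of the norms, at the scale of the parent, of the total
  functionals \<open>\<Sum>x\<in>A. e x * \<xi> x\<close> of the clusters \<open>A\<close>.  For each cluster one keeps \<open>d\<close> admissible weights
  forming an identity matrix on \<open>d\<close> of its points, and an \<open>r\<close>-dimensional space of total functionals that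
  are realised by admissible weights vanishing at those points, with \<open>card A \<le> d * 2 ^ r\<close>.  Merging
  siblings adds the numbers \<open>d\<close> and keeps the larger \<open>r\<close>; passing to the scale of the parent replaces
  \<open>d, r\<close> by \<open>d - s, r + s\<close> through elimination with pivots.  Since the constant weight always survives,
  \<open>d\<close> stays positive, so the inequality is preserved.  As \<open>r \<le> dim\<close>, more than \<open>2 ^ dim\<close> points force
  \<open>d \<ge> 2\<close> at the root.
\<close>

subsection \<open>Elimination with pivots\<close>

text \<open>The points may lie arbitrarily close together while all constants may depend on m, n, D
  and the number of points only. Mere linear dependence among the functionals is therefore of no
  use, and every elimination picks its pivot by size. The product \<open>d * 2 ^ r\<close> works as
  a potential: a pivot trades one point for one dimension, and d is at most 2 (d - 1) once d is at
  least 2. The exponential is forced by the tree: two clusters with d = 1 merge to d = 2, and a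
  single pivot at the next scale brings them back to d = 1 with one dimension more, so the number of
  points can double for each dimension. Going up in scale can only shrink the set of admissible
  total functionals, because the dual norm grows with the scale. The constant weight survives since
  the cutoff of a cluster, applied to the original bounded family, controls the total functional of
  that cluster. In the homogeneous space polynomials cost nothing, so the totals at the root have to
  vanish exactly; this takes one more elimination there.\<close>

lemma sum_fun_apply: "(\<Sum>i\<in>I. f i) x = (\<Sum>i\<in>I. f i x)"
  for f :: "'i \<Rightarrow> 'a \<Rightarrow> 'b::comm_monoid_add"
  by (induction I rule: infinite_finite_induct) auto

text \<open>
  Invariant of the elimination (last assumption): whatever in the span of \<open>B\<close> remains of a bounded
  combination of the \<open>\<Phi> (E i)\<close> modulo \<open>L\<close> can be cancelled by a bounded vector vanishing on \<open>I\<close>.  The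
  pivot is an index maximising a seminorm that vanishes on the span and is at most \<open>1\<close> on \<open>L\<close>, which
  bounds its coefficient; a last remaining index is never a pivot, since there \<open>E i\<close> may be
  replaced by the constant \<open>1\<close>.
\<close>

lemma pivot_elimination:
  fixes K :: "real \<Rightarrow> ('a \<Rightarrow> real) \<Rightarrow> bool" and \<Phi> :: "('a \<Rightarrow> real) \<Rightarrow> 'u::real_vector"
    and E :: "'a \<Rightarrow> 'a \<Rightarrow> real" and L :: "'u set"
  assumes lin: "linear \<Phi>"
    and Kadd: "\<And>a b e f. K a e \<Longrightarrow> K b f \<Longrightarrow> K (a + b) (e + f)"
    and Kscale: "\<And>a t e. K a e \<Longrightarrow> K (\<bar>t\<bar> * a) (t *\<^sub>R e)"
    and Kmono: "\<And>a b e. K a e \<Longrightarrow> a \<le> b \<Longrightarrow> K b e"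
    and star: "\<And>l t. l \<in> L \<Longrightarrow> \<bar>t\<bar> \<le> 1 \<Longrightarrow> t *\<^sub>R l \<in> L"
    and sep: "\<And>B x. finite B \<Longrightarrow> B \<subseteq> U \<Longrightarrow> independent B \<Longrightarrow> x \<in> U \<Longrightarrow> \<forall>w\<in>span B. x - w \<notin> L \<Longrightarrow>
        \<exists>D. (\<forall>x y. D (x + y) \<le> D x + D y) \<and> (\<forall>t x. D (t *\<^sub>R x) = \<bar>t\<bar> * D x) \<and>
            (\<forall>w\<in>span B. D w = 0) \<and> (\<forall>l\<in>L. D l \<le> 1) \<and> (D x \<ge> (1::real))"
    and one: "K C (\<lambda>_. 1)" "\<Phi> (\<lambda>_. 1) \<in> L"
    and I: "finite I" "I \<noteq> {}" "card I \<le> N"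
    and E: "\<And>i. i \<in> I \<Longrightarrow> K C (E i) \<and> \<Phi> (E i) \<in> U \<and> (\<forall>j\<in>I. E i j = of_bool (j = i))"
    and B: "finite B" "B \<subseteq> U" "independent B"
    and C: "C \<ge> 0"
    and adj: "\<And>t w. \<forall>i\<in>I. \<bar>t i\<bar> \<le> 1 \<Longrightarrow> w \<in> span B \<Longrightarrow> (\<Sum>i\<in>I. t i *\<^sub>R \<Phi> (E i)) - w \<in> L \<Longrightarrow>
        \<exists>a. K C a \<and> (\<forall>j\<in>I. a j = 0) \<and> \<Phi> a = w"
  shows "\<exists>I' B'. I' \<subseteq> I \<and> I' \<noteq> {} \<and> finite B' \<and> B' \<subseteq> U \<and> independent B' \<and>
           card I * 2 ^ card B \<le> card I' * 2 ^ card B' \<and>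
           (\<forall>i\<in>I'. \<exists>e. K (2 * (2 * (real N + 1)) ^ card I * C) e \<and> (\<forall>j\<in>I'. e j = of_bool (j = i)) \<and> \<Phi> e \<in> L) \<and>
           (\<forall>w\<in>span B' \<inter> L. \<exists>a. K (2 * (2 * (real N + 1)) ^ card I * C) a \<and> (\<forall>j\<in>I'. a j = 0) \<and> \<Phi> a = w)"
  using one(1) I E B C adj
proof (induction "card I" arbitrary: I B C)
  case 0
  then show ?case by simp
next
  case (Suc n I B C)
  let ?q = "2 * (real N + 1)"
  have q1: "?q ^ card I \<ge> 1" by simp
  have CC: "2 * C \<le> 2 * ?q ^ card I * C" "C \<le> 2 * ?q ^ card I * C"
    using mult_right_mono[OF q1 \<open>C \<ge> 0\<close>] \<open>C \<ge> 0\<close> by auto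
  \<comment> \<open>The invariant with all \<open>t i = 0\<close> reads \<open>- w \<in> L\<close>.
    It settles the realisation part in the two cases that end the recursion.\<close>
  have adj0: "\<exists>a. K (2 * ?q ^ card I * C) a \<and> (\<forall>j\<in>I. a j = 0) \<and> \<Phi> a = w" if w: "w \<in> span B \<inter> L" for w
  proof -
    have "- w \<in> L" using star[of w "-1"] w by simp
    then obtain a where "K C a" "\<forall>j\<in>I. a j = 0" "\<Phi> a = w"
      using Suc.prems(10)[of "\<lambda>_. 0" w] w by auto
    then show ?thesis using Kmono CC by blast
  qed
  \<comment> \<open>Either the given \<open>I\<close> and \<open>B\<close> already work, or some
    \<open>E i\<close> cannot be brought into \<open>L\<close> modulo \<open>span B\<close>. A pivot
    is made only while at least two indices are left.\<close>
  consider (one) "card I = 1" | (all) "\<forall>i\<in>I. \<exists>w\<in>span B. \<Phi> (E i) - w \<in> L"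
    | (pivot) i where "card I \<ge> 2" "i \<in> I" "\<forall>w\<in>span B. \<Phi> (E i) - w \<notin> L"
    using Suc.hyps(2) by fastforce
  then show ?case
  proof cases
    case one
    then obtain i where i: "I = {i}" by (auto simp: card_1_singleton_iff)
    have "\<forall>k\<in>I. \<exists>e. K (2 * ?q ^ card I * C) e \<and> (\<forall>j\<in>I. e j = of_bool (j = k)) \<and> \<Phi> e \<in> L"
      using i Kmono[OF Suc.prems(1) CC(2)] assms(8) by (intro ballI exI[of _ "\<lambda>_. 1"]) auto
    then show ?thesis using adj0 Suc.prems(3,6-8) by (intro exI[of _ I] exI[of _ B]) auto
  next
    case all
    have "\<exists>e. K (2 * ?q ^ card I * C) e \<and> (\<forall>j\<in>I. e j = of_bool (j = i)) \<and> \<Phi> e \<in> L" if i: "i \<in> I" for i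
    proof -
      obtain w where w: "w \<in> span B" "\<Phi> (E i) - w \<in> L" using all i by blast
      have "(\<Sum>k\<in>I. of_bool (k = i) *\<^sub>R \<Phi> (E k)) = \<Phi> (E i)"
        using i Suc.prems(2) by (subst sum.remove[of _ i]) auto
      then obtain a where a: "K C a" "\<forall>j\<in>I. a j = 0" "\<Phi> a = w"
        using Suc.prems(10)[of "\<lambda>k. of_bool (k = i)" w] w by auto
      \<comment> \<open>Subtracting \<open>a\<close> removes \<open>w\<close> from the total and
        leaves the values on \<open>I\<close> untouched; this is the factor 2 in the final
        bound.\<close>
      have "K (C + C) (E i + (-1) *\<^sub>R a)"
        using Kadd[of C "E i" C "(-1) *\<^sub>R a"] Kscale[of C a "-1"] a(1) Suc.prems(5)[OF i] by auto
      then have "K (2 * ?q ^ card I * C) (E i + (-1) *\<^sub>R a)" using Kmono CC(1) by auto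
      moreover have "\<Phi> (E i + (-1) *\<^sub>R a) \<in> L"
        using w(2) a(3) by (simp add: linear_add[OF lin] linear_neg[OF lin] linear_diff[OF lin])
      moreover have "\<forall>j\<in>I. (E i + (-1) *\<^sub>R a) j = of_bool (j = i)"
        using Suc.prems(5)[OF i] a(2) by (simp add: plus_fun_def scaleR_fun_def)
      ultimately show ?thesis by blast
    qed
    then show ?thesis using adj0 Suc.prems(3,6-8) by (intro exI[of _ I] exI[of _ B]) auto
  next
    case pivot
    have iU: "\<Phi> (E i) \<in> U" using Suc.prems(5) pivot(2) by blast
    obtain D where D0: "\<forall>x y. D (x + y) \<le> D x + D y" "\<forall>t x. D (t *\<^sub>R x) = \<bar>t\<bar> * D x"
      "\<forall>w\<in>span B. D w = 0" "\<forall>l\<in>L. D l \<le> 1" "D (\<Phi> (E i)) \<ge> (1::real)"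
      using sep[OF Suc.prems(6-8) iU pivot(3)] by (elim exE conjE)
    have D: "\<And>x y. D (x + y) \<le> D x + D y" "\<And>t x. D (t *\<^sub>R x) = \<bar>t\<bar> * D x"
      "\<And>w. w \<in> span B \<Longrightarrow> D w = 0" "\<And>l. l \<in> L \<Longrightarrow> D l \<le> 1" "D (\<Phi> (E i)) \<ge> 1"
      using D0 by auto
    have Dsum: "D (\<Sum>k\<in>J. f k) \<le> (\<Sum>k\<in>J. D (f k))" if "finite J" for J :: "'a set" and f
      using that
    proof (induction J)
      case empty
      then show ?case using D(3)[of 0] by (simp add: span_zero)
    next
      case (insert x F)
      then show ?case using D(1)[of "f x" "sum f F"] by simp
    qed
    obtain j where j: "j \<in> I" "\<And>k. k \<in> I \<Longrightarrow> D (\<Phi> (E k)) \<le> D (\<Phi> (E j))"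
    proof -
      have "Max ((\<lambda>k. D (\<Phi> (E k))) ` I) \<in> (\<lambda>k. D (\<Phi> (E k))) ` I"
        using Suc.prems(2,3) by (intro Max_in) auto
      then obtain j where j: "j \<in> I" "Max ((\<lambda>k. D (\<Phi> (E k))) ` I) = D (\<Phi> (E j))" by blast
      then have "D (\<Phi> (E k)) \<le> D (\<Phi> (E j))" if "k \<in> I" for k
        using Suc.prems(2) that unfolding j(2)[symmetric] by (intro Max_ge) auto
      then show ?thesis using j(1) by (rule that[rotated])
    qed
    define R where "R = D (\<Phi> (E j))"
    have R1: "R \<ge> 1" using D(5) j(2)[OF pivot(2)] by (simp add: R_def)
    \<comment> \<open>\<open>D\<close> vanishes on \<open>span B\<close> and is at least 1 at the
      pivot vector, so adjoining that vector keeps the family independent.\<close>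
    have jB: "\<Phi> (E j) \<notin> span B" using D(3) R1 by (force simp: R_def)
    define I1 where "I1 = I - {j}"
    define B1 where "B1 = insert (\<Phi> (E j)) B"
    have cI1: "n = card I1" "finite I1" "card I1 \<le> N"
      using Suc.hyps(2) j(1) Suc.prems(2,4) by (auto simp: I1_def)
    then have I1ne: "I1 \<noteq> {}" using pivot(1) Suc.hyps(2) by auto
    have B1: "finite B1" "B1 \<subseteq> U" "independent B1"
      using Suc.prems(5)[OF j(1)] Suc.prems(6-8) jB by (auto simp: B1_def independent_insertI)
    have cB1: "card B1 = Suc (card B)"
      using jB Suc.prems(6) span_base unfolding B1_def by (metis card_insert_disjoint)
    have C1: "?q * C \<ge> 0" "C \<le> ?q * C" using \<open>C \<ge> 0\<close> mult_right_mono[of 1 ?q C] by auto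
    have E1: "K (?q * C) (E k) \<and> \<Phi> (E k) \<in> U \<and> (\<forall>l\<in>I1. E k l = of_bool (l = k))" if "k \<in> I1" for k
      using Suc.prems(5)[of k] that Kmono[OF _ C1(2)] by (auto simp: I1_def)
    have adj1: "\<exists>a. K (?q * C) a \<and> (\<forall>j\<in>I1. a j = 0) \<and> \<Phi> a = w1"
      if t: "\<forall>i\<in>I1. \<bar>t i\<bar> \<le> 1" and w1: "w1 \<in> span B1" and l: "(\<Sum>i\<in>I1. t i *\<^sub>R \<Phi> (E i)) - w1 \<in> L" for t w1
    proof -
      obtain s where s: "w1 - s *\<^sub>R \<Phi> (E j) \<in> span B"
        using w1 by (auto simp: B1_def span_insert)
      define w where "w = w1 - s *\<^sub>R \<Phi> (E j)"
      define l where "l = (\<Sum>i\<in>I1. t i *\<^sub>R \<Phi> (E i)) - w1"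
      \<comment> \<open>Applying \<open>D\<close> bounds the pivot coefficient: \<open>w\<close>
        contributes 0, \<open>l\<close> at most 1, and each of the at most \<open>N\<close> other
        terms at most \<open>R\<close> by maximality. As \<open>R \<ge> 1\<close>, division gives
        \<open>\<bar>s\<bar> \<le> N + 1\<close>.\<close>
      have eq: "s *\<^sub>R \<Phi> (E j) = (\<Sum>i\<in>I1. t i *\<^sub>R \<Phi> (E i)) + ((-1) *\<^sub>R w + (-1) *\<^sub>R l)"
        by (simp add: w_def l_def)
      have "\<bar>s\<bar> * R = D (s *\<^sub>R \<Phi> (E j))" by (simp add: D(2) R_def)
      also have "\<dots> \<le> D (\<Sum>i\<in>I1. t i *\<^sub>R \<Phi> (E i)) + (D ((-1) *\<^sub>R w) + D ((-1) *\<^sub>R l))"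
        unfolding eq using D(1)[of "\<Sum>i\<in>I1. t i *\<^sub>R \<Phi> (E i)" "(-1) *\<^sub>R w + (-1) *\<^sub>R l"]
          D(1)[of "(-1) *\<^sub>R w" "(-1) *\<^sub>R l"] by linarith
      also have "\<dots> \<le> (\<Sum>i\<in>I1. R) + 1"
      proof -
        have "D (\<Sum>i\<in>I1. t i *\<^sub>R \<Phi> (E i)) \<le> (\<Sum>i\<in>I1. D (t i *\<^sub>R \<Phi> (E i)))"
          by (rule Dsum[OF cI1(2)])
        also have "\<dots> \<le> (\<Sum>i\<in>I1. R)"
        proof (rule sum_mono)
          fix k assume k: "k \<in> I1"
          have "\<bar>t k\<bar> * D (\<Phi> (E k)) \<le> \<bar>t k\<bar> * R"
            using j(2)[of k] k by (intro mult_left_mono) (auto simp: R_def I1_def)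
          also have "\<dots> \<le> 1 * R" using t k R1 by (intro mult_right_mono) auto
          finally show "D (t k *\<^sub>R \<Phi> (E k)) \<le> R" by (simp add: D(2))
        qed
        moreover have "D ((-1) *\<^sub>R w) = 0" unfolding D(2) using D(3)[of w] s by (simp add: w_def)
        moreover have "D ((-1) *\<^sub>R l) \<le> 1" unfolding D(2) using D(4)[of l] l by (simp add: l_def)
        ultimately show ?thesis by linarith
      qed
      also have "\<dots> = real (card I1) * R + 1" by simp
      also have "\<dots> \<le> real N * R + R"
        using R1 cI1(3) by (intro add_mono mult_right_mono) auto
      finally have "\<bar>s\<bar> * R \<le> (real N + 1) * R" by (simp add: algebra_simps)
      then have sM: "\<bar>s\<bar> \<le> real N + 1" using R1 by simp
      define M where "M = real N + 1"
      have M: "M \<ge> 1" "M > 0" by (auto simp: M_def)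
      \<comment> \<open>Division by \<open>M\<close> makes all coefficients at most 1, so the old
        invariant applies with coefficient \<open>- s / M\<close> at the pivot; the result is
        multiplied by \<open>M\<close> afterwards.\<close>
      define t' where "t' k = (if k = j then - s / M else t k / M)" for k
      have "\<forall>k\<in>I. \<bar>t' k\<bar> \<le> 1"
      proof
        fix k assume k: "k \<in> I"
        show "\<bar>t' k\<bar> \<le> 1"
        proof (cases "k = j")
          case True
          then show ?thesis using sM M by (simp add: t'_def M_def)
        next
          case False
          then have "\<bar>t k\<bar> \<le> M" using t k M by (force simp: I1_def)
          then show ?thesis using False M by (simp add: t'_def)
        qed
      qed
      moreover have "(1 / M) *\<^sub>R w \<in> span B" using s span_scale unfolding w_def by blast
      moreover have "(\<Sum>k\<in>I. t' k *\<^sub>R \<Phi> (E k)) - (1 / M) *\<^sub>R w = (1 / M) *\<^sub>R l"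
      proof -
        have "(\<Sum>k\<in>I1. t' k *\<^sub>R \<Phi> (E k)) = (1 / M) *\<^sub>R (\<Sum>k\<in>I1. t k *\<^sub>R \<Phi> (E k))"
          unfolding scaleR_sum_right by (rule sum.cong) (auto simp: t'_def I1_def)
        then show ?thesis
          using j(1) Suc.prems(2) unfolding I1_def l_def w_def
          by (subst sum.remove[of I j]) (auto simp: t'_def scaleR_diff_right)
      qed
      moreover have "(1 / M) *\<^sub>R l \<in> L" using star[OF l, of "1 / M"] M by (simp add: l_def)
      ultimately obtain a where a: "K C a" "\<forall>j\<in>I. a j = 0" "\<Phi> a = (1 / M) *\<^sub>R w"
        using Suc.prems(10)[of t' "(1 / M) *\<^sub>R w"] by auto
      \<comment> \<open>Adding \<open>s *\<^sub>R E j\<close> restores the part of \<open>w1\<close>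
        along the pivot and keeps the zeros on \<open>I1\<close>. The two summands cost
        \<open>M * C\<close> each, hence the factor \<open>2 * (N + 1)\<close> per pivot.\<close>
      have "K (M * C + M * C) (M *\<^sub>R a + s *\<^sub>R E j)"
      proof (rule Kadd)
        show "K (M * C) (M *\<^sub>R a)" using Kscale[OF a(1), of M] M by simp
        have "K (\<bar>s\<bar> * C) (s *\<^sub>R E j)" using Kscale Suc.prems(5)[OF j(1)] by blast
        moreover have "\<bar>s\<bar> * C \<le> M * C" using sM \<open>C \<ge> 0\<close> by (intro mult_right_mono) (auto simp: M_def)
        ultimately show "K (M * C) (s *\<^sub>R E j)" using Kmono by blast
      qed
      moreover have "M * C + M * C = ?q * C" by (simp add: M_def algebra_simps)
      moreover have "\<forall>k\<in>I1. (M *\<^sub>R a + s *\<^sub>R E j) k = 0"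
        using a(2) Suc.prems(5)[OF j(1)] by (auto simp: I1_def plus_fun_def scaleR_fun_def)
      moreover have "\<Phi> (M *\<^sub>R a + s *\<^sub>R E j) = w1"
        using a(3) M by (simp add: linear_add[OF lin] linear_scale[OF lin] w_def)
      ultimately show ?thesis by auto
    qed
    have K1: "K (?q * C) (\<lambda>_. 1)" using Suc.prems(1) Kmono C1(2) by blast
    have pw: "2 * ?q ^ card I1 * (?q * C) = 2 * ?q ^ card I * C"
      using cI1(1) Suc.hyps(2)[symmetric] by simp
    note IH = Suc.hyps(1)[OF cI1(1), of "?q * C" B1, unfolded pw]
    obtain I' B' where I': "I' \<subseteq> I1" "I' \<noteq> {}" "finite B'" "B' \<subseteq> U" "independent B'"
      "card I1 * 2 ^ card B1 \<le> card I' * 2 ^ card B'"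
      "\<forall>i\<in>I'. \<exists>e. K (2 * ?q ^ card I * C) e \<and> (\<forall>j\<in>I'. e j = of_bool (j = i)) \<and> \<Phi> e \<in> L"
      "\<forall>w\<in>span B' \<inter> L. \<exists>a. K (2 * ?q ^ card I * C) a \<and> (\<forall>j\<in>I'. a j = 0) \<and> \<Phi> a = w"
      by (atomize_elim, rule IH)
        (fact K1 | fact cI1 | fact I1ne | fact B1 | fact C1 | erule E1 | (rule adj1; assumption))+
    \<comment> \<open>With at least two indices, \<open>card I \<le> 2 * card I1\<close>: the
      additional dimension pays for the lost point.\<close>
    have "card I * 2 ^ card B \<le> (2 * card I1) * 2 ^ card B"
      using pivot(1) cI1(1) Suc.hyps(2) by (intro mult_right_mono) auto
    also have "\<dots> = card I1 * 2 ^ card B1" by (simp add: cB1)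
    finally have "card I * 2 ^ card B \<le> card I' * 2 ^ card B'" using I'(6) by linarith
    moreover have "I' \<subseteq> I" using I'(1) by (auto simp: I1_def)
    ultimately show ?thesis using I' by (intro exI[of _ I'] exI[of _ B']) auto
  qed
qed

subsection \<open>Clusters and dual weights\<close>

text \<open>Hypothesis \<open>sep\<close> of the elimination as a property of \<open>L\<close>. It
  is applied to balls of a seminorm inside the dual space while climbing the tree, and to
  \<open>{0}\<close> at the root of the homogeneous problem.\<close>

definition separable_from :: "'u::real_vector set \<Rightarrow> 'u set \<Rightarrow> bool" where
  "separable_from U L \<longleftrightarrow> (\<forall>B x. finite B \<longrightarrow> B \<subseteq> U \<longrightarrow> independent B \<longrightarrow> x \<in> U \<longrightarrow> (\<forall>w\<in>span B. x - w \<notin> L) \<longrightarrow>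
     (\<exists>D. (\<forall>x y. D (x + y) \<le> D x + D y) \<and> (\<forall>t x. D (t *\<^sub>R x) = \<bar>t\<bar> * D x) \<and>
          (\<forall>w\<in>span B. D w = 0) \<and> (\<forall>l\<in>L. D l \<le> 1) \<and> D x \<ge> (1::real)))"

lemma separable_fromD:
  assumes "separable_from U L" "finite B" "B \<subseteq> U" "independent B" "x \<in> U" "\<forall>w\<in>span B. x - w \<notin> L"
  shows "\<exists>D. (\<forall>x y. D (x + y) \<le> D x + D y) \<and> (\<forall>t x. D (t *\<^sub>R x) = \<bar>t\<bar> * D x) \<and>
          (\<forall>w\<in>span B. D w = 0) \<and> (\<forall>l\<in>L. D l \<le> 1) \<and> D x \<ge> (1::real)"
  using assms(1)[unfolded separable_from_def, THEN spec, THEN spec, THEN mp, THEN mp, THEN mp, THEN mp, THEN mp,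
      OF assms(2-6)] .

text \<open>\<open>D\<close> is the absolute value of a linear functional that is 0 on
  \<open>B\<close> and 1 at \<open>x\<close>, extended from the independent set
  \<open>insert x B\<close>.\<close>

lemma separable_from_zero: "separable_from U {0}"
  unfolding separable_from_def
proof (intro allI impI)
  fix B and x :: 'a
  assume B: "finite B" "independent B" and "\<forall>w\<in>span B. x - w \<notin> {0}"
  then have x: "x \<notin> span B" by force
  then have "independent (insert x B)" using B(2) by (simp add: independent_insertI)
  from linear_independent_extend[OF this, of "\<lambda>y. if y = x then 1 else 0 :: real"]
  obtain f where f: "linear f" "\<forall>y\<in>insert x B. f y = (if y = x then 1 else 0 :: real)"
    by blast
  have "x \<notin> B" using x span_base by blast
  then have "f y = 0" if "y \<in> B" for y using f(2) that by auto
  then have fw: "f w = 0" if "w \<in> span B" for w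
    using linear_eq_0_on_span[OF f(1) _ that] by blast
  show "\<exists>D. (\<forall>x y. D (x + y) \<le> D x + D y) \<and> (\<forall>t x. D (t *\<^sub>R x) = \<bar>t\<bar> * D x) \<and>
      (\<forall>w\<in>span B. D w = 0) \<and> (\<forall>l\<in>{0}. D l \<le> 1) \<and> D x \<ge> (1::real)"
    using f fw by (intro exI[of _ "\<lambda>y. \<bar>f y\<bar>"])
      (auto simp: linear_add linear_scale linear_0 abs_mult abs_triangle_ineq)
qed

text \<open>\<open>D\<close> is the quotient seminorm modulo \<open>span B\<close>, divided by
  \<open>c\<close>: when every translate of the point by the span misses the ball, its quotient
  seminorm is at least \<open>c\<close>.\<close>

lemma separable_from_seminorm_ball:
  fixes \<nu> :: "'u::real_vector \<Rightarrow> real"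
  assumes add: "\<And>x y. \<nu> (x + y) \<le> \<nu> x + \<nu> y" and scale: "\<And>t x. \<nu> (t *\<^sub>R x) = \<bar>t\<bar> * \<nu> x"
    and c: "c > 0"
  shows "separable_from U {x. \<nu> x \<le> c}"
  unfolding separable_from_def
proof (intro allI impI)
  fix B and x0 :: 'u
  assume B: "\<forall>w\<in>span B. x0 - w \<notin> {x. \<nu> x \<le> c}"
  have nonneg: "\<nu> x \<ge> 0" for x
    using add[of x "(-1) *\<^sub>R x"] scale[of "-1" x] scale[of 0 0] by simp
  define q where "q x = (INF w\<in>span B. \<nu> (x - w))" for x
  have le: "q x \<le> \<nu> (x - w)" if "w \<in> span B" for x w
    unfolding q_def by (rule cINF_lower) (use nonneg that in \<open>auto intro!: bdd_belowI[of _ 0]\<close>)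
  have ge: "a \<le> q x" if "\<And>w. w \<in> span B \<Longrightarrow> a \<le> \<nu> (x - w)" for x a
    unfolding q_def by (rule cINF_greatest) (use that span_zero in auto)
  have q0: "q x \<ge> 0" for x by (rule ge) (rule nonneg)
  have qadd: "q (x + y) \<le> q x + q y" for x y
  proof -
    have "q (x + y) - \<nu> (x - w) \<le> q y" if "w \<in> span B" for w
    proof (rule ge)
      fix w' assume "w' \<in> span B"
      with that have "q (x + y) \<le> \<nu> ((x + y) - (w + w'))" by (intro le span_add)
      also have "\<dots> \<le> \<nu> (x - w) + \<nu> (y - w')" using add[of "x - w" "y - w'"] by (simp add: algebra_simps)
      finally show "q (x + y) - \<nu> (x - w) \<le> \<nu> (y - w')" by simp
    qed
    then have "q (x + y) - q y \<le> q x" by (intro ge) (simp add: algebra_simps)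
    then show ?thesis by simp
  qed
  have qw: "q w = 0" if "w \<in> span B" for w
    using le[OF that, of w] q0[of w] scale[of 0 0] by simp
  have qscale': "q (t *\<^sub>R x) \<le> \<bar>t\<bar> * q x" if "t \<noteq> 0" for t x
  proof -
    have "q (t *\<^sub>R x) / \<bar>t\<bar> \<le> q x"
    proof (rule ge)
      fix w assume "w \<in> span B"
      then have "q (t *\<^sub>R x) \<le> \<nu> (t *\<^sub>R x - t *\<^sub>R w)" by (intro le span_scale)
      then show "q (t *\<^sub>R x) / \<bar>t\<bar> \<le> \<nu> (x - w)"
        using that scale[of t "x - w"] by (simp add: scaleR_diff_right field_simps)
    qed
    then show ?thesis using that by (simp add: field_simps)
  qed
  have qscale: "q (t *\<^sub>R x) = \<bar>t\<bar> * q x" for t x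
  proof (cases "t = 0")
    case True
    then show ?thesis using qw[OF span_zero] by simp
  next
    case False
    then have "q x \<le> \<bar>1 / t\<bar> * q (t *\<^sub>R x)" using qscale'[of "1 / t" "t *\<^sub>R x"] by simp
    then have "\<bar>t\<bar> * q x \<le> q (t *\<^sub>R x)" using False by (simp add: field_simps)
    then show ?thesis using qscale'[OF False, of x] by linarith
  qed
  have "q x0 \<ge> c" by (rule ge) (use B in force)
  moreover have "q l \<le> c" if "\<nu> l \<le> c" for l using le[OF span_zero, of l] that by simp
  ultimately show "\<exists>D. (\<forall>x y. D (x + y) \<le> D x + D y) \<and> (\<forall>t x. D (t *\<^sub>R x) = \<bar>t\<bar> * D x) \<and>
      (\<forall>w\<in>span B. D w = 0) \<and> (\<forall>l\<in>{x. \<nu> x \<le> c}. D l \<le> 1) \<and> D x0 \<ge> (1::real)"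
    using c qadd qscale qw
    by (intro exI[of _ "\<lambda>y. q y / c"]) (auto simp: field_simps add_divide_distrib[symmetric] intro!: divide_right_mono)
qed

section \<open>Splitting a finite metric space at a gap\<close>

text \<open>Pigeonhole on the distances from \<open>a\<close>, where \<open>a\<close> and
  \<open>b\<close> realise the diameter: the other points meet at most \<open>card A - 1\<close> of
  \<open>card A\<close> bins of equal width, and the cut is made at an empty bin. By the triangle
  inequality the two sides are a bin width apart.\<close>

lemma finite_metric_split:
  fixes A :: "'a::metric_space set"
  assumes "finite A" "card A \<ge> 2"
  obtains B B' a b where "A = B \<union> B'" "B \<inter> B' = {}" "B \<noteq> {}" "B' \<noteq> {}" "a \<in> A" "b \<in> A" "a \<noteq> b"
    "\<And>x y. x \<in> A \<Longrightarrow> y \<in> A \<Longrightarrow> dist x y \<le> dist a b"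
    "\<And>x y. x \<in> B \<Longrightarrow> y \<in> B' \<Longrightarrow> dist a b / real (card A) \<le> dist x y"
proof -
  have "A \<noteq> {}" using assms by auto
  obtain a b where ab: "a \<in> A" "b \<in> A" "\<And>x y. x \<in> A \<Longrightarrow> y \<in> A \<Longrightarrow> dist x y \<le> dist a b"
  proof -
    have "Max ((\<lambda>(x, y). dist x y) ` (A \<times> A)) \<in> (\<lambda>(x, y). dist x y) ` (A \<times> A)"
      using assms(1) \<open>A \<noteq> {}\<close> by (intro Max_in) auto
    then obtain a b where ab: "a \<in> A" "b \<in> A" "Max ((\<lambda>(x, y). dist x y) ` (A \<times> A)) = dist a b" by auto
    have "dist x y \<le> dist a b" if "x \<in> A" "y \<in> A" for x y
      unfolding ab(3)[symmetric] using assms(1) that by (intro Max_ge) auto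
    then show ?thesis using that ab by blast
  qed
  define n where "n = card A"
  have n: "n \<ge> 2" using assms by (simp add: n_def)
  define D where "D = dist a b"
  obtain u v where uv: "u \<in> A" "v \<in> A" "u \<noteq> v"
    using assms(2) by (metis card_le_Suc0_iff_eq assms(1) not_less_eq_eq numeral_2_eq_2)
  have D: "D > 0" using ab(3)[OF uv(1,2)] uv(3) unfolding D_def by (meson less_le_trans zero_less_dist_iff)
  then have "a \<noteq> b" by (auto simp: D_def)
  \<comment> \<open>Number of the half-open bin \<open>(k * D / n, (k + 1) * D / n]\<close> that
    contains the distance; only \<open>a\<close> itself, at distance 0, lies in no bin.\<close>
  define idx where "idx x = nat \<lceil>dist a x * n / D\<rceil> - 1" for x
  have "idx ` (A - {a}) \<subset> {..<n}"
  proof (rule psubsetI)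
    show "idx ` (A - {a}) \<subseteq> {..<n}"
    proof (rule image_subsetI)
      fix x assume "x \<in> A - {a}"
      then have x: "x \<in> A" "x \<noteq> a" by auto
      have "dist a x * n \<le> D * n" using ab(3)[OF ab(1) x(1)] by (intro mult_right_mono) (auto simp: D_def)
      then have "dist a x * n / D \<le> n" using D by (simp add: field_simps)
      then have "nat \<lceil>dist a x * n / D\<rceil> \<le> n" by linarith
      then show "idx x \<in> {..<n}" unfolding idx_def lessThan_iff using n by linarith
    qed
    have "card (idx ` (A - {a})) < n"
      using card_image_le[of "A - {a}" idx] assms(1) ab(1) n by (simp add: n_def)
    then show "idx ` (A - {a}) \<noteq> {..<n}" by (metis card_lessThan less_irrefl)
  qed
  then obtain k where k: "k < n" "k \<notin> idx ` (A - {a})" by blast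
  have gap: "dist a x \<le> real k * D / n \<or> dist a x > real (Suc k) * D / n" if x: "x \<in> A" for x
  proof (rule ccontr)
    assume "\<not> ?thesis"
    then have *: "real k * D / n < dist a x" "dist a x \<le> real (Suc k) * D / n" by auto
    then have "real k < dist a x * n / D" "dist a x * n / D \<le> real (Suc k)"
      using D n by (auto simp: field_simps)
    then have "\<lceil>dist a x * n / D\<rceil> = int (Suc k)" by linarith
    then have "idx x = k" by (simp add: idx_def)
    moreover have "x \<noteq> a" using *(1) D n by (auto simp: divide_less_0_iff mult_less_0_iff)
    ultimately show False using k(2) x by blast
  qed
  define B where "B = {x \<in> A. dist a x \<le> real k * D / n}"
  define B' where "B' = {x \<in> A. dist a x > real (Suc k) * D / n}"
  show ?thesis
  proof (rule that[of B B' a b])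
    have "real k * D / n \<le> real (Suc k) * D / n" using D by (intro divide_right_mono mult_right_mono) auto
    then show "A = B \<union> B'" "B \<inter> B' = {}" using gap by (auto simp: B_def B'_def)
    show "B \<noteq> {}" using ab(1) D by (auto simp: B_def)
    \<comment> \<open>\<open>b\<close> lies in the last bin, so the empty bin is not the last one
      and \<open>b\<close> falls beyond the cut.\<close>
    have "idx b = n - 1" using D n by (simp add: idx_def D_def)
    moreover have "idx b \<noteq> k" using k(2) ab(2) \<open>a \<noteq> b\<close> by auto
    ultimately have "Suc k < n" using k(1) by linarith
    then have "real (Suc k) * D < n * D" using D by (intro mult_strict_right_mono) auto
    then have "real (Suc k) * D / n < D" using n by (simp add: field_simps)
    then show "B' \<noteq> {}" using ab(2) by (auto simp: B'_def D_def)
    show "dist a b / real (card A) \<le> dist x y" if "x \<in> B" "y \<in> B'" for x y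
    proof -
      have "dist a y \<le> dist a x + dist x y" by (rule dist_triangle)
      moreover have "real (Suc k) * D / n = real k * D / n + D / n"
        by (simp add: add_divide_distrib[symmetric] algebra_simps)
      ultimately have "D / n \<le> dist x y" using that by (auto simp: B_def B'_def)
      then show ?thesis by (simp add: D_def n_def)
    qed
  qed (use ab \<open>a \<noteq> b\<close> in auto)
qed

text \<open>
  \<open>V\<close> is the space of vector polynomials; \<open>fld M p\<close> says that \<open>p\<close> is the field of jets of a function of
  norm at most \<open>M\<close>; the vectors \<open>gen x d k\<close> are the monomials centred at \<open>x\<close>, scaled so that they span
  the possible differences of the jets at points of distance \<open>d\<close>.  The two alternatives of \<open>root\<close> are
  the inhomogeneous and the homogeneous space.
\<close>

locale selection_system =
  fixes V :: "'v::real_vector set" and Idx :: "'k set"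
    and gen :: "'a::metric_space \<Rightarrow> real \<Rightarrow> 'k \<Rightarrow> 'v"
    and fld :: "real \<Rightarrow> ('a \<Rightarrow> 'v) \<Rightarrow> bool" and N :: nat and C0 :: real
  assumes V_fin: "\<exists>Bv. finite Bv \<and> V = span Bv"
    and Idx: "finite Idx" and C0: "C0 \<ge> 1" and N: "N \<ge> 1"
    and gen_in: "k \<in> Idx \<Longrightarrow> gen x d k \<in> V"
    and gen_span: "d > 0 \<Longrightarrow> V \<subseteq> span (gen x d ` Idx)"
    and fld_in: "fld M p \<Longrightarrow> p x \<in> V"
    and fld_add: "fld M p \<Longrightarrow> fld M' q \<Longrightarrow> fld (M + M') (\<lambda>x. p x + q x)"
    and fld_scale: "fld M p \<Longrightarrow> fld (\<bar>t\<bar> * M) (\<lambda>x. t *\<^sub>R p x)"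
    and fld_mono: "fld M p \<Longrightarrow> M \<le> M' \<Longrightarrow> fld M' p"
    and increment: "fld 1 p \<Longrightarrow> 0 < d \<Longrightarrow> dist x y \<le> d \<Longrightarrow>
      \<exists>t. (\<forall>k\<in>Idx. \<bar>t k\<bar> \<le> C0) \<and> p x - p y = (\<Sum>k\<in>Idx. t k *\<^sub>R gen x d k)"
    and rebase: "0 < d \<Longrightarrow> dist x y \<le> d \<Longrightarrow> k \<in> Idx \<Longrightarrow>
      \<exists>t. (\<forall>l\<in>Idx. \<bar>t l\<bar> \<le> C0) \<and> gen y d k = (\<Sum>l\<in>Idx. t l *\<^sub>R gen x d l)"
    and refine: "0 < d \<Longrightarrow> d \<le> d' \<Longrightarrow> k \<in> Idx \<Longrightarrow> \<exists>t. \<bar>t\<bar> \<le> 1 \<and> gen x d k = t *\<^sub>R gen x d' k"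
    and bump: "finite T \<Longrightarrow> A \<subseteq> T \<Longrightarrow> card A \<le> N \<Longrightarrow> x0 \<in> A \<Longrightarrow> 0 < d \<Longrightarrow> d \<le> 1 \<Longrightarrow>
      \<forall>x\<in>A. dist x x0 \<le> d \<Longrightarrow> \<forall>x\<in>A. \<forall>y\<in>T - A. d / real N \<le> dist x y \<Longrightarrow> k \<in> Idx \<Longrightarrow>
      \<exists>p. fld C0 p \<and> (\<forall>y\<in>A. p y = gen x0 d k) \<and> (\<forall>y\<in>T - A. p y = 0)"
    and root: "(\<forall>p x. fld 1 p \<longrightarrow> (\<exists>t. (\<forall>k\<in>Idx. \<bar>t k\<bar> \<le> C0) \<and> p x = (\<Sum>k\<in>Idx. t k *\<^sub>R gen x 1 k)))
      \<or> (\<forall>P\<in>V. fld 1 (\<lambda>_. P))"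
begin

lemma V_subspace: "subspace V"
  using V_fin subspace_span by blast

section \<open>Functionals on the space of polynomials and their norms at a scale\<close>

text \<open>Functionals on \<open>V\<close> are encoded as functions that are 0 off
  \<open>V\<close>. Each then has exactly one representative, so that equality, span and
  independence in the function space are those of the dual space of \<open>V\<close>.\<close>

definition dual :: "('v \<Rightarrow> real) set" where
  "dual = {\<eta>. (\<forall>P\<in>V. \<forall>Q\<in>V. \<eta> (P + Q) = \<eta> P + \<eta> Q) \<and> (\<forall>c. \<forall>P\<in>V. \<eta> (c *\<^sub>R P) = c * \<eta> P) \<and>
     (\<forall>P. P \<notin> V \<longrightarrow> \<eta> P = 0)}"

lemma dual_add: "\<eta> \<in> dual \<Longrightarrow> P \<in> V \<Longrightarrow> Q \<in> V \<Longrightarrow> \<eta> (P + Q) = \<eta> P + \<eta> Q"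
  and dual_scale: "\<eta> \<in> dual \<Longrightarrow> P \<in> V \<Longrightarrow> \<eta> (c *\<^sub>R P) = c * \<eta> P"
  and dual_outside: "\<eta> \<in> dual \<Longrightarrow> P \<notin> V \<Longrightarrow> \<eta> P = 0"
  by (auto simp: dual_def)

lemma dual_zero: "\<eta> \<in> dual \<Longrightarrow> \<eta> 0 = 0"
  using dual_scale[of \<eta> 0 0] V_subspace by (simp add: subspace_0)

lemma dual_diff: "\<eta> \<in> dual \<Longrightarrow> P \<in> V \<Longrightarrow> Q \<in> V \<Longrightarrow> \<eta> (P - Q) = \<eta> P - \<eta> Q"
  using dual_add[of \<eta> P "(-1) *\<^sub>R Q"] dual_scale[of \<eta> Q "-1"] V_subspace by (simp add: subspace_neg)

lemma dual_sum:
  assumes "\<eta> \<in> dual" "\<And>i. i \<in> I \<Longrightarrow> f i \<in> V"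
  shows "\<eta> (\<Sum>i\<in>I. t i *\<^sub>R f i) = (\<Sum>i\<in>I. t i * \<eta> (f i))"
  using assms(2)
proof (induction I rule: infinite_finite_induct)
  case (insert i I)
  then have "t i *\<^sub>R f i \<in> V" "(\<Sum>i\<in>I. t i *\<^sub>R f i) \<in> V"
    using V_subspace by (auto intro!: subspace_sum subspace_scale)
  then show ?case using insert by (simp add: dual_add[OF assms(1)] dual_scale[OF assms(1)])
qed (use dual_zero[OF assms(1)] in auto)

lemma dual_comb: "(\<And>x. x \<in> A \<Longrightarrow> \<xi> x \<in> dual) \<Longrightarrow> (\<lambda>P. \<Sum>x\<in>A. e x * \<xi> x P) \<in> dual"
  unfolding dual_def by (auto simp: algebra_simps sum.distrib sum_distrib_left intro!: sum.cong)

text \<open>The coordinate functionals of a basis of \<open>V\<close> span all of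
  \<open>dual\<close>. This caps the exponent in the potential by \<open>dim V\<close>.\<close>

lemma card_independent_dual_le:
  assumes "finite B" "B \<subseteq> dual" "independent B"
  shows "card B \<le> dim V"
proof -
  obtain Bv where Bv: "finite Bv" "V = span Bv" using V_fin by blast
  obtain b where b: "b \<subseteq> V" "independent b" "V \<subseteq> span b" "card b = dim V"
    using basis_exists[of V] by blast
  have sb: "span b = V" using b(1,3) V_subspace by (metis span_minimal subset_antisym)
  have fb: "finite b" using independent_span_bound[OF Bv(1) b(2)] b(1) Bv(2) by blast
  define cf where "cf u P = (if P \<in> V then representation b P u else 0)" for u P
  have "\<eta> \<in> span (cf ` b)" if \<eta>: "\<eta> \<in> dual" for \<eta>
  proof -
    have "\<eta> = (\<Sum>u\<in>b. \<eta> u *\<^sub>R cf u)"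
    proof
      fix P
      show "\<eta> P = (\<Sum>u\<in>b. \<eta> u *\<^sub>R cf u) P"
      proof (cases "P \<in> V")
        case True
        have "P = (\<Sum>u\<in>b. representation b P u *\<^sub>R u)"
          using sum_representation_eq[OF b(2) _ fb] True sb by auto
        then have "\<eta> P = (\<Sum>u\<in>b. representation b P u * \<eta> u)"
          using dual_sum[OF \<eta>, of b "\<lambda>u. u" "representation b P"] b(1) by auto
        then show ?thesis using True by (simp add: sum_fun_apply scaleR_fun_def cf_def mult.commute)
      next
        case False
        then show ?thesis using dual_outside[OF \<eta>] by (simp add: sum_fun_apply scaleR_fun_def cf_def)
      qed
    qed
    also have "\<dots> \<in> span (cf ` b)" by (intro span_sum span_scale span_base) auto
    finally show ?thesis .
  qed
  then have "B \<subseteq> span (cf ` b)" using assms(2) by blast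
  then have "card B \<le> card (cf ` b)"
    using independent_span_bound[of "cf ` b" B] fb assms(3) by blast
  also have "\<dots> \<le> dim V" using card_image_le[OF fb] b(4) by metis
  finally show ?thesis .
qed

text \<open>On \<open>dual\<close> this is the largest value at combinations of the generators with
  coefficients in \<open>[-1, 1]\<close>; on arbitrary functions it is still a seminorm.\<close>

definition dnorm :: "'a \<Rightarrow> real \<Rightarrow> ('v \<Rightarrow> real) \<Rightarrow> real" where
  "dnorm x d \<eta> = (\<Sum>k\<in>Idx. \<bar>\<eta> (gen x d k)\<bar>)"

lemma dnorm_add: "dnorm x d (\<eta> + \<eta>') \<le> dnorm x d \<eta> + dnorm x d \<eta>'"
  unfolding dnorm_def sum.distrib[symmetric] by (intro sum_mono) (simp add: abs_triangle_ineq)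

lemma dnorm_scale: "dnorm x d (t *\<^sub>R \<eta>) = \<bar>t\<bar> * dnorm x d \<eta>"
  by (simp add: dnorm_def scaleR_fun_def abs_mult sum_distrib_left)

lemma dnorm_nonneg: "dnorm x d \<eta> \<ge> 0"
  by (simp add: dnorm_def sum_nonneg)

lemma dnorm_comb:
  assumes "\<eta> \<in> dual" "\<forall>k\<in>Idx. \<bar>t k\<bar> \<le> C"
  shows "\<bar>\<eta> (\<Sum>k\<in>Idx. t k *\<^sub>R gen x d k)\<bar> \<le> C * dnorm x d \<eta>"
proof -
  have "\<bar>\<Sum>k\<in>Idx. t k * \<eta> (gen x d k)\<bar> \<le> (\<Sum>k\<in>Idx. C * \<bar>\<eta> (gen x d k)\<bar>)"
    using assms(2) by (intro order_trans[OF sum_abs] sum_mono) (auto simp: abs_mult intro!: mult_right_mono)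
  then show ?thesis using gen_in by (simp add: dual_sum[OF assms(1)] dnorm_def sum_distrib_left)
qed

lemma dnorm_rebase:
  assumes "\<eta> \<in> dual" "0 < d" "dist x y \<le> d"
  shows "dnorm y d \<eta> \<le> real (card Idx) * C0 * dnorm x d \<eta>"
proof -
  have "\<bar>\<eta> (gen y d k)\<bar> \<le> C0 * dnorm x d \<eta>" if k: "k \<in> Idx" for k
    using rebase[OF assms(2,3) k] dnorm_comb[OF assms(1)] by metis
  then have "dnorm y d \<eta> \<le> (\<Sum>k\<in>Idx. C0 * dnorm x d \<eta>)"
    unfolding dnorm_def[of y] by (rule sum_mono)
  then show ?thesis by simp
qed

text \<open>A larger scale stretches the generators, so the norm grows and its balls shrink. For
  this reason a frame at one scale can be cut down to one at the scale of the parent.\<close>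

lemma dnorm_refine:
  assumes "\<eta> \<in> dual" "0 < d" "d \<le> d'"
  shows "dnorm x d \<eta> \<le> dnorm x d' \<eta>"
  unfolding dnorm_def
proof (rule sum_mono)
  fix k assume k: "k \<in> Idx"
  obtain t where t: "\<bar>t\<bar> \<le> 1" "gen x d k = t *\<^sub>R gen x d' k" using refine[OF assms(2,3) k] by blast
  then show "\<bar>\<eta> (gen x d k)\<bar> \<le> \<bar>\<eta> (gen x d' k)\<bar>"
    using mult_right_mono[OF t(1), of "\<bar>\<eta> (gen x d' k)\<bar>"]
    by (simp add: dual_scale[OF assms(1) gen_in[OF k]] abs_mult)
qed

section \<open>Weights on a cluster and frames\<close>

definition Phi :: "('a \<Rightarrow> 'v \<Rightarrow> real) \<Rightarrow> 'a set \<Rightarrow> ('a \<Rightarrow> real) \<Rightarrow> 'v \<Rightarrow> real" where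
  "Phi \<xi> A e = (\<lambda>P. \<Sum>x\<in>A. e x * \<xi> x P)"

lemma linear_Phi: "linear (Phi \<xi> A)"
  by (rule linearI) (auto simp: Phi_def fun_eq_iff plus_fun_def scaleR_fun_def algebra_simps sum.distrib sum_distrib_left)

lemma Phi_dual: "\<forall>x\<in>A. \<xi> x \<in> dual \<Longrightarrow> Phi \<xi> A e \<in> dual"
  unfolding Phi_def by (rule dual_comb) auto

text \<open>
  For a weight \<open>e\<close> on a cluster \<open>A\<close>, \<open>internal\<close> bounds the part of the dual norm of \<open>e x * \<xi> x\<close> that
  only sees differences of jets inside \<open>A\<close>; the rest is the norm of \<open>Phi \<xi> A e\<close>.
\<close>

definition internal :: "('a \<Rightarrow> 'v \<Rightarrow> real) \<Rightarrow> 'a set \<Rightarrow> 'a \<Rightarrow> real \<Rightarrow> ('a \<Rightarrow> real) \<Rightarrow> bool" where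
  "internal \<xi> A x0 M e \<longleftrightarrow> (\<forall>x\<in>A. \<bar>e x\<bar> \<le> M) \<and>
     (\<forall>p. fld 1 p \<longrightarrow> \<bar>\<Sum>x\<in>A. e x * \<xi> x (p x - p x0)\<bar> \<le> M)"

lemma internal_add:
  assumes "internal \<xi> A x0 a e" "internal \<xi> A x0 b f"
  shows "internal \<xi> A x0 (a + b) (e + f)"
proof -
  have "\<bar>\<Sum>x\<in>A. (e + f) x * \<xi> x (p x - p x0)\<bar> \<le> a + b" if p: "fld 1 p" for p
  proof -
    have "(\<Sum>x\<in>A. (e + f) x * \<xi> x (p x - p x0)) =
        (\<Sum>x\<in>A. e x * \<xi> x (p x - p x0)) + (\<Sum>x\<in>A. f x * \<xi> x (p x - p x0))"
      by (simp add: plus_fun_def algebra_simps sum.distrib)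
    moreover have "\<bar>\<Sum>x\<in>A. e x * \<xi> x (p x - p x0)\<bar> \<le> a" "\<bar>\<Sum>x\<in>A. f x * \<xi> x (p x - p x0)\<bar> \<le> b"
      using assms p by (auto simp: internal_def)
    ultimately show ?thesis by linarith
  qed
  moreover have "\<bar>(e + f) x\<bar> \<le> a + b" if "x \<in> A" for x
  proof -
    have "\<bar>e x\<bar> \<le> a" "\<bar>f x\<bar> \<le> b" using assms that by (auto simp: internal_def)
    then show ?thesis by (simp add: plus_fun_def)
  qed
  ultimately show ?thesis by (simp add: internal_def)
qed

lemma internal_scale:
  assumes "internal \<xi> A x0 a e"
  shows "internal \<xi> A x0 (\<bar>t\<bar> * a) (t *\<^sub>R e)"
proof -
  have "(\<Sum>x\<in>A. (t *\<^sub>R e) x * \<xi> x (p x - p x0)) = t * (\<Sum>x\<in>A. e x * \<xi> x (p x - p x0))" for p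
    by (simp add: scaleR_fun_def sum_distrib_left mult.assoc)
  then show ?thesis using assms by (auto simp: internal_def scaleR_fun_def abs_mult intro!: mult_left_mono)
qed

lemma internal_mono: "internal \<xi> A x0 a e \<Longrightarrow> a \<le> b \<Longrightarrow> internal \<xi> A x0 b e"
  unfolding internal_def by force

text \<open>\<open>I\<close> carries the identity matrix and \<open>B\<close> is a basis of the
  realised totals. \<open>L\<close> restricts the totals of the weights belonging to
  \<open>I\<close>, and \<open>L'\<close> tells which elements of \<open>span B\<close> must be
  realised. The two differ for balls, with radii \<open>C\<close> and 1, and agree right after an
  elimination.\<close>

definition frame :: "('a \<Rightarrow> 'v \<Rightarrow> real) \<Rightarrow> 'a set \<Rightarrow> 'a \<Rightarrow> ('v \<Rightarrow> real) set \<Rightarrow> ('v \<Rightarrow> real) set \<Rightarrow> real \<Rightarrow> bool" where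
  "frame \<xi> A x0 L L' C \<longleftrightarrow> internal \<xi> A x0 C (\<lambda>_. 1) \<and>
     (\<exists>I B. I \<subseteq> A \<and> I \<noteq> {} \<and> finite B \<and> B \<subseteq> dual \<and> independent B \<and> card A \<le> card I * 2 ^ card B \<and>
       (\<forall>i\<in>I. \<exists>e. internal \<xi> A x0 C e \<and> (\<forall>j\<in>I. e j = of_bool (j = i)) \<and> Phi \<xi> A e \<in> L) \<and>
       (\<forall>w\<in>span B \<inter> L'. \<exists>a. internal \<xi> A x0 C a \<and> (\<forall>j\<in>I. a j = 0) \<and> Phi \<xi> A a = w))"

text \<open>Supplies the invariant of the elimination: a combination of at most \<open>N\<close>
  totals minus an element of \<open>L\<close> has norm at most \<open>(N + 1) * C\<close>, and after
  division by this number the given frame realises it at cost \<open>C\<close>. Hence the constant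
  \<open>(N + 1) * C * C\<close>, to which the factor for at most \<open>N\<close> pivots is
  applied.\<close>

lemma frame_tighten:
  assumes fr: "frame \<xi> A x0 {\<eta>. dnorm x0 d \<eta> \<le> C} {\<eta>. dnorm x0 d \<eta> \<le> 1} C"
    and C: "C \<ge> 1" and A: "finite A" "card A \<le> N" and \<xi>: "\<forall>x\<in>A. \<xi> x \<in> dual"
    and L: "\<And>\<eta>. \<eta> \<in> L \<Longrightarrow> dnorm x0 d \<eta> \<le> C" "\<And>l t. l \<in> L \<Longrightarrow> \<bar>t\<bar> \<le> 1 \<Longrightarrow> t *\<^sub>R l \<in> L" "separable_from dual L"
    and one: "Phi \<xi> A (\<lambda>_. 1) \<in> L"
  shows "frame \<xi> A x0 L L (2 * (2 * (real N + 1)) ^ N * ((real N + 1) * C * C))"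
proof -
  obtain I B where I: "I \<subseteq> A" "I \<noteq> {}" and B: "finite B" "B \<subseteq> dual" "independent B"
    and card: "card A \<le> card I * 2 ^ card B"
    and ex: "\<forall>i\<in>I. \<exists>e. internal \<xi> A x0 C e \<and> (\<forall>j\<in>I. e j = of_bool (j = i)) \<and> dnorm x0 d (Phi \<xi> A e) \<le> C"
    and adj: "\<forall>w\<in>span B \<inter> {\<eta>. dnorm x0 d \<eta> \<le> 1}. \<exists>a. internal \<xi> A x0 C a \<and> (\<forall>j\<in>I. a j = 0) \<and> Phi \<xi> A a = w"
    and int1: "internal \<xi> A x0 C (\<lambda>_. 1)"
    using fr unfolding frame_def by auto
  obtain E where E: "\<And>i. i \<in> I \<Longrightarrow> internal \<xi> A x0 C (E i) \<and> (\<forall>j\<in>I. E i j = of_bool (j = i)) \<and> dnorm x0 d (Phi \<xi> A (E i)) \<le> C"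
    using ex by metis
  define M where "M = (real N + 1) * C"
  define C1 where "C1 = (real N + 1) * C * C"
  have M: "M \<ge> 1" "M > 0" using C mult_mono[of 1 "real N + 1" 1 C] by (auto simp: M_def)
  have C1: "C \<le> C1" "C1 \<ge> 0" "M * C = C1" using M C mult_right_mono[of 1 M C] by (auto simp: M_def C1_def)
  have fI: "finite I" "card I \<le> N" using I(1) A card_mono[OF A(1) I(1)] finite_subset by auto
  define C2 where "C2 = 2 * (2 * (real N + 1)) ^ N * C1"
  have C2: "2 * (2 * (real N + 1)) ^ card I * C1 \<le> C2"
    unfolding C2_def using fI(2) C1(2) by (intro mult_right_mono mult_left_mono power_increasing) auto
  have dsum: "dnorm x0 d (\<Sum>i\<in>J. f i) \<le> (\<Sum>i\<in>J. dnorm x0 d (f i))" if "finite J" for J :: "'a set" and f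
    using that
  proof induction
    case empty
    then show ?case by (simp add: dnorm_def)
  next
    case (insert i J)
    then show ?case
      unfolding sum.insert[OF insert.hyps] using dnorm_add[of x0 d "f i" "sum f J"] by linarith
  qed
  have adj': "\<exists>a. internal \<xi> A x0 C1 a \<and> (\<forall>j\<in>I. a j = 0) \<and> Phi \<xi> A a = w"
    if t: "\<forall>i\<in>I. \<bar>t i\<bar> \<le> 1" and w: "w \<in> span B" and l: "(\<Sum>i\<in>I. t i *\<^sub>R Phi \<xi> A (E i)) - w \<in> L" for t w
  proof -
    define l where "l = (\<Sum>i\<in>I. t i *\<^sub>R Phi \<xi> A (E i)) - w"
    have "w = (\<Sum>i\<in>I. t i *\<^sub>R Phi \<xi> A (E i)) + (-1) *\<^sub>R l" by (simp add: l_def)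
    then have "dnorm x0 d w \<le> dnorm x0 d (\<Sum>i\<in>I. t i *\<^sub>R Phi \<xi> A (E i)) + dnorm x0 d ((-1) *\<^sub>R l)"
      using dnorm_add by metis
    also have "dnorm x0 d (\<Sum>i\<in>I. t i *\<^sub>R Phi \<xi> A (E i)) \<le> (\<Sum>i\<in>I. dnorm x0 d (t i *\<^sub>R Phi \<xi> A (E i)))"
      by (rule dsum[OF fI(1)])
    also have "\<dots> \<le> (\<Sum>i\<in>I. C)"
    proof (rule sum_mono)
      fix i assume i: "i \<in> I"
      have "\<bar>t i\<bar> * dnorm x0 d (Phi \<xi> A (E i)) \<le> 1 * C"
        using t E i dnorm_nonneg by (intro mult_mono) auto
      then show "dnorm x0 d (t i *\<^sub>R Phi \<xi> A (E i)) \<le> C" by (simp add: dnorm_scale)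
    qed
    also have "(\<Sum>i\<in>I. C) \<le> real N * C" using fI(2) C by (simp add: mult_right_mono)
    also have "dnorm x0 d ((-1) *\<^sub>R l) \<le> C" unfolding dnorm_scale using L(1) that(3) by (simp add: l_def)
    finally have "dnorm x0 d w \<le> M" by (simp add: M_def algebra_simps)
    then have "dnorm x0 d ((1 / M) *\<^sub>R w) \<le> 1" using M by (simp add: dnorm_scale)
    moreover have "(1 / M) *\<^sub>R w \<in> span B" using w by (rule span_scale)
    ultimately obtain a where a: "internal \<xi> A x0 C a" "\<forall>j\<in>I. a j = 0" "Phi \<xi> A a = (1 / M) *\<^sub>R w"
      using adj by blast
    have "internal \<xi> A x0 C1 (M *\<^sub>R a)" using internal_scale[OF a(1), of M] M C1(3) by simp
    moreover have "\<forall>j\<in>I. (M *\<^sub>R a) j = 0" using a(2) by (simp add: scaleR_fun_def)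
    moreover have "Phi \<xi> A (M *\<^sub>R a) = w" using a(3) M by (simp add: linear_scale[OF linear_Phi])
    ultimately show ?thesis by blast
  qed
  have piv: "\<exists>I' B'. I' \<subseteq> I \<and> I' \<noteq> {} \<and> finite B' \<and> B' \<subseteq> dual \<and> independent B' \<and>
           card I * 2 ^ card B \<le> card I' * 2 ^ card B' \<and>
           (\<forall>i\<in>I'. \<exists>e. internal \<xi> A x0 (2 * (2 * (real N + 1)) ^ card I * C1) e \<and> (\<forall>j\<in>I'. e j = of_bool (j = i)) \<and> Phi \<xi> A e \<in> L) \<and>
           (\<forall>w\<in>span B' \<inter> L. \<exists>a. internal \<xi> A x0 (2 * (2 * (real N + 1)) ^ card I * C1) a \<and> (\<forall>j\<in>I'. a j = 0) \<and> Phi \<xi> A a = w)"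
  proof (rule pivot_elimination[where K = "internal \<xi> A x0" and E = E and N = N])
    fix B :: "('v \<Rightarrow> real) set" and x
    assume "finite B" "B \<subseteq> dual" "independent B" "x \<in> dual" "\<forall>w\<in>span B. x - w \<notin> L"
    then show "\<exists>D. (\<forall>x y. D (x + y) \<le> D x + D y) \<and> (\<forall>t x. D (t *\<^sub>R x) = \<bar>t\<bar> * D x) \<and>
            (\<forall>w\<in>span B. D w = 0) \<and> (\<forall>l\<in>L. D l \<le> 1) \<and> (D x \<ge> (1::real))"
      by (rule separable_fromD[OF L(3)])
  next
    show "internal \<xi> A x0 C1 (E i) \<and> Phi \<xi> A (E i) \<in> dual \<and> (\<forall>j\<in>I. E i j = of_bool (j = i))" if "i \<in> I" for i
      using E[OF that] internal_mono C1(1) Phi_dual[OF \<xi>] by blast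
  next
    show "internal \<xi> A x0 (a + b) (e + f)" if "internal \<xi> A x0 a e" "internal \<xi> A x0 b f" for a b e f
      using that by (rule internal_add)
    show "internal \<xi> A x0 (\<bar>t\<bar> * a) (t *\<^sub>R e)" if "internal \<xi> A x0 a e" for a t e
      using that by (rule internal_scale)
    show "internal \<xi> A x0 b e" if "internal \<xi> A x0 a e" "a \<le> b" for a b e
      using that by (rule internal_mono)
    show "internal \<xi> A x0 C1 (\<lambda>_. 1)" by (rule internal_mono[OF int1 C1(1)])
  qed (use linear_Phi L(2) one fI I B C1(2) adj' in auto)
  then obtain I' B' where I': "I' \<subseteq> I" "I' \<noteq> {}" "finite B'" "B' \<subseteq> dual" "independent B'"
           "card I * 2 ^ card B \<le> card I' * 2 ^ card B'"
           "\<forall>i\<in>I'. \<exists>e. internal \<xi> A x0 (2 * (2 * (real N + 1)) ^ card I * C1) e \<and> (\<forall>j\<in>I'. e j = of_bool (j = i)) \<and> Phi \<xi> A e \<in> L"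
           "\<forall>w\<in>span B' \<inter> L. \<exists>a. internal \<xi> A x0 (2 * (2 * (real N + 1)) ^ card I * C1) a \<and> (\<forall>j\<in>I'. a j = 0) \<and> Phi \<xi> A a = w"
    by (elim exE conjE)
  have "C \<le> C2"
  proof -
    have "1 \<le> (2 * (real N + 1)) ^ card I" by (intro one_le_power) simp
    then have "1 \<le> 2 * (2 * (real N + 1)) ^ card I" by linarith
    from mult_right_mono[OF this C1(2)] have "1 * C1 \<le> 2 * (2 * (real N + 1)) ^ card I * C1" .
    then show ?thesis using C1(1) C2 by linarith
  qed
  have "frame \<xi> A x0 L L C2"
    unfolding frame_def
  proof (intro conjI exI[of _ I'] exI[of _ B'])
    show "internal \<xi> A x0 C2 (\<lambda>_. 1)" using internal_mono[OF int1 \<open>C \<le> C2\<close>] .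
    show "I' \<subseteq> A" using I'(1) I(1) by blast
    show "card A \<le> card I' * 2 ^ card B'" using card I'(6) by linarith
    show "\<forall>i\<in>I'. \<exists>e. internal \<xi> A x0 C2 e \<and> (\<forall>j\<in>I'. e j = of_bool (j = i)) \<and> Phi \<xi> A e \<in> L"
      using I'(7) internal_mono[OF _ C2] by meson
    show "\<forall>w\<in>span B' \<inter> L. \<exists>a. internal \<xi> A x0 C2 a \<and> (\<forall>j\<in>I'. a j = 0) \<and> Phi \<xi> A a = w"
      using I'(8) internal_mono[OF _ C2] by meson
  qed (use I' in auto)
  then show ?thesis by (simp add: C2_def C1_def)
qed


lemma Phi_extend:
  assumes "finite A" "B \<subseteq> A"
  shows "Phi \<xi> A (\<lambda>x. if x \<in> B then e x else 0) = Phi \<xi> B e"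
  unfolding Phi_def
  by (rule ext, rule sum.mono_neutral_cong_right) (use assms in auto)

lemma internal_extend:
  assumes "finite A" "B \<subseteq> A" "internal \<xi> B x0 M e" "M \<ge> 0"
  shows "internal \<xi> A x0 M (\<lambda>x. if x \<in> B then e x else 0)"
proof -
  have "(\<Sum>x\<in>A. (if x \<in> B then e x else 0) * \<xi> x (p x - p x0)) = (\<Sum>x\<in>B. e x * \<xi> x (p x - p x0))" for p
    by (rule sum.mono_neutral_cong_right) (use assms(1,2) in auto)
  then show ?thesis using assms(3,4) by (auto simp: internal_def)
qed

lemma Phi_increment_le:
  assumes "\<forall>x\<in>B. \<xi> x \<in> dual" "fld 1 p" "0 < d" "dist y x0 \<le> d"
  shows "\<bar>Phi \<xi> B e (p y - p x0)\<bar> \<le> C0 * dnorm y d (Phi \<xi> B e)"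
  using increment[OF assms(2-4)] dnorm_comb[OF Phi_dual[OF assms(1)]] by metis

text \<open>A change of base point adds the total functional evaluated at \<open>p y - p x0\<close>.
  This increment is a combination of generators at scale \<open>d\<close> with coefficients at most
  \<open>C0\<close>, whence the added term.\<close>

lemma internal_move:
  assumes \<xi>: "\<forall>x\<in>B. \<xi> x \<in> dual" and e: "internal \<xi> B y M e" "dnorm y d (Phi \<xi> B e) \<le> M'"
    and d: "0 < d" "dist y x0 \<le> d"
  shows "internal \<xi> B x0 (M + C0 * M') e"
proof -
  have M': "M' \<ge> 0" using e(2) dnorm_nonneg order_trans by blast
  have "\<bar>\<Sum>x\<in>B. e x * \<xi> x (p x - p x0)\<bar> \<le> M + C0 * M'" if p: "fld 1 p" for p
  proof -
    have "\<xi> x (p x - p x0) = \<xi> x (p x - p y) + \<xi> x (p y - p x0)" if "x \<in> B" for x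
      using \<xi> that fld_in[OF p] by (simp add: dual_diff)
    then have "(\<Sum>x\<in>B. e x * \<xi> x (p x - p x0)) =
        (\<Sum>x\<in>B. e x * \<xi> x (p x - p y)) + Phi \<xi> B e (p y - p x0)"
      by (simp add: Phi_def algebra_simps sum.distrib[symmetric])
    moreover have "\<bar>\<Sum>x\<in>B. e x * \<xi> x (p x - p y)\<bar> \<le> M" using e(1) p by (simp add: internal_def)
    moreover have "C0 * dnorm y d (Phi \<xi> B e) \<le> C0 * M'" using e(2) C0 by (intro mult_left_mono) auto
    then have "\<bar>Phi \<xi> B e (p y - p x0)\<bar> \<le> C0 * M'" using Phi_increment_le[OF \<xi> p d, of e] by linarith
    ultimately show ?thesis by linarith
  qed
  moreover have "\<bar>e x\<bar> \<le> M + C0 * M'" if "x \<in> B" for x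
    using e(1) that C0 M' by (auto simp: internal_def intro: order_trans)
  ultimately show ?thesis by (simp add: internal_def)
qed

abbreviation "metric_frame \<xi> A x0 d C \<equiv> frame \<xi> A x0 {\<eta>. dnorm x0 d \<eta> \<le> C} {\<eta>. dnorm x0 d \<eta> \<le> 1} C"

definition frame_data where
  "frame_data \<xi> A x0 d C I B E \<longleftrightarrow> internal \<xi> A x0 C (\<lambda>_. 1) \<and> I \<subseteq> A \<and> I \<noteq> {} \<and> finite B \<and> B \<subseteq> dual \<and>
    independent B \<and> card A \<le> card I * 2 ^ card B \<and>
    (\<forall>i\<in>I. internal \<xi> A x0 C (E i) \<and> (\<forall>j\<in>I. E i j = of_bool (j = i)) \<and> dnorm x0 d (Phi \<xi> A (E i)) \<le> C) \<and>
    (\<forall>w\<in>span B. dnorm x0 d w \<le> 1 \<longrightarrow> (\<exists>a. internal \<xi> A x0 C a \<and> (\<forall>j\<in>I. a j = 0) \<and> Phi \<xi> A a = w))"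

lemma frame_dataD:
  assumes "frame_data \<xi> A x0 d C I B E"
  shows "internal \<xi> A x0 C (\<lambda>_. 1)" "I \<subseteq> A" "I \<noteq> {}" "finite B" "B \<subseteq> dual" "independent B"
    "card A \<le> card I * 2 ^ card B"
    "\<And>i. i \<in> I \<Longrightarrow> internal \<xi> A x0 C (E i)" "\<And>i j. i \<in> I \<Longrightarrow> j \<in> I \<Longrightarrow> E i j = of_bool (j = i)"
    "\<And>i. i \<in> I \<Longrightarrow> dnorm x0 d (Phi \<xi> A (E i)) \<le> C"
    "\<And>w. w \<in> span B \<Longrightarrow> dnorm x0 d w \<le> 1 \<Longrightarrow> \<exists>a. internal \<xi> A x0 C a \<and> (\<forall>j\<in>I. a j = 0) \<and> Phi \<xi> A a = w"
  using assms unfolding frame_data_def by blast+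

lemma metric_frame_iff: "metric_frame \<xi> A x0 d C \<longleftrightarrow> (\<exists>I B E. frame_data \<xi> A x0 d C I B E)"
proof
  assume "metric_frame \<xi> A x0 d C"
  then obtain I B where *: "internal \<xi> A x0 C (\<lambda>_. 1)" "I \<subseteq> A" "I \<noteq> {}" "finite B" "B \<subseteq> dual" "independent B"
    "card A \<le> card I * 2 ^ card B"
    "\<forall>i\<in>I. \<exists>e. internal \<xi> A x0 C e \<and> (\<forall>j\<in>I. e j = of_bool (j = i)) \<and> Phi \<xi> A e \<in> {\<eta>. dnorm x0 d \<eta> \<le> C}"
    "\<forall>w\<in>span B \<inter> {\<eta>. dnorm x0 d \<eta> \<le> 1}. \<exists>a. internal \<xi> A x0 C a \<and> (\<forall>j\<in>I. a j = 0) \<and> Phi \<xi> A a = w"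
    unfolding frame_def by (elim exE conjE)
  from bchoice[OF *(8)] obtain E where
    "\<forall>i\<in>I. internal \<xi> A x0 C (E i) \<and> (\<forall>j\<in>I. E i j = of_bool (j = i)) \<and> Phi \<xi> A (E i) \<in> {\<eta>. dnorm x0 d \<eta> \<le> C}" ..
  with * have "frame_data \<xi> A x0 d C I B E" by (simp add: frame_data_def)
  then show "\<exists>I B E. frame_data \<xi> A x0 d C I B E" by blast
next
  assume "\<exists>I B E. frame_data \<xi> A x0 d C I B E"
  then obtain I B E where "frame_data \<xi> A x0 d C I B E" by blast
  note * = frame_dataD[OF this]
  show "metric_frame \<xi> A x0 d C"
    unfolding frame_def
  proof (intro conjI exI[of _ I] exI[of _ B] ballI)
    show "\<exists>e. internal \<xi> A x0 C e \<and> (\<forall>j\<in>I. e j = of_bool (j = i)) \<and> Phi \<xi> A e \<in> {\<eta>. dnorm x0 d \<eta> \<le> C}"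
      if "i \<in> I" for i using *(8-10) that by (intro exI[of _ "E i"]) simp
    show "\<exists>a. internal \<xi> A x0 C a \<and> (\<forall>j\<in>I. a j = 0) \<and> Phi \<xi> A a = w"
      if "w \<in> span B \<inter> {\<eta>. dnorm x0 d \<eta> \<le> 1}" for w using *(11)[of w] that by simp
  qed (use *(1-7) in auto)
qed

lemma internal_cong: "(\<And>x. x \<in> A \<Longrightarrow> e x = f x) \<Longrightarrow> internal \<xi> A x0 M e \<longleftrightarrow> internal \<xi> A x0 M f"
  unfolding internal_def by (simp cong: sum.cong)

text \<open>The larger of the two realised spaces serves the union: its weights, extended by zero,
  vanish on the other cluster, and both sets of points keep their identity matrix. The base point is
  taken from the same cluster, so norms on that space need no comparison.\<close>

lemma frame_merge:
  assumes 1: "metric_frame \<xi> A1 x1 d C" and 2: "metric_frame \<xi> A2 x2 d C"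
    and fin: "finite A1" "finite A2" and disj: "A1 \<inter> A2 = {}" and C: "C \<ge> 1"
    and \<xi>: "\<forall>x\<in>A1 \<union> A2. \<xi> x \<in> dual" and d: "0 < d" and x: "x1 \<in> A1" "x2 \<in> A2"
    and dist: "\<forall>x\<in>A1 \<union> A2. \<forall>y\<in>A1 \<union> A2. dist x y \<le> d"
    and one: "dnorm x1 d (Phi \<xi> A1 (\<lambda>_. 1)) \<le> C" "dnorm x2 d (Phi \<xi> A2 (\<lambda>_. 1)) \<le> C"
  shows "\<exists>x0\<in>A1 \<union> A2. metric_frame \<xi> (A1 \<union> A2) x0 d ((2 + C0 + C0 * real (card Idx)) * C)"
proof -
  have main: "metric_frame \<xi> (A1 \<union> A2) x1 d ((2 + C0 + C0 * real (card Idx)) * C)"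
    if f1: "frame_data \<xi> A1 x1 d C I1 B1 E1" and f2: "frame_data \<xi> A2 x2 d C I2 B2 E2"
    and le: "card B2 \<le> card B1"
    and fin: "finite A1" "finite A2" and disj: "A1 \<inter> A2 = {}"
    and \<xi>: "\<forall>x\<in>A1. \<xi> x \<in> dual" "\<forall>x\<in>A2. \<xi> x \<in> dual"
    and dist: "dist x1 x2 \<le> d"
    and one: "dnorm x2 d (Phi \<xi> A2 (\<lambda>_. 1)) \<le> C"
  for A1 A2 x1 x2 I1 I2 B1 B2 E1 E2
  proof -
    note 1 = frame_dataD[OF f1] and 2 = frame_dataD[OF f2]
    let ?A = "A1 \<union> A2"
    \<comment> \<open>The parts of \<open>2 + C0 + C0 * card Idx\<close> pay for the two pieces of
      the constant weight, for moving a base point, and for comparing norms at the two base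
      points.\<close>
    define K where "K = (2 + C0 + C0 * real (card Idx)) * C"
    have K: "C \<le> K" "C + (C + C0 * C) \<le> K" "C + C0 * C \<le> K" "real (card Idx) * C0 * C \<le> K"
      using C C0 by (auto simp: K_def algebra_simps)
    have dist': "dist x2 x1 \<le> d" using dist by (simp add: dist_commute)
    have finA: "finite ?A" using fin by simp
    have moved: "internal \<xi> ?A x1 (C + C0 * C) (\<lambda>x. if x \<in> A2 then e x else 0)"
      if "internal \<xi> A2 x2 C e" "dnorm x2 d (Phi \<xi> A2 e) \<le> C" for e
      using internal_move[OF \<xi>(2) that d dist'] C C0 by (intro internal_extend finA) auto
    have ext1: "internal \<xi> ?A x1 C (\<lambda>x. if x \<in> A1 then e x else 0)" if "internal \<xi> A1 x1 C e" for e
      using that C by (intro internal_extend finA) auto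
    have "internal \<xi> ?A x1 (C + (C + C0 * C)) ((\<lambda>x. if x \<in> A1 then 1 else 0) + (\<lambda>x. if x \<in> A2 then 1 else 0))"
      by (intro internal_add ext1 moved 1 2 one)
    then have "internal \<xi> ?A x1 K ((\<lambda>x. if x \<in> A1 then 1 else 0) + (\<lambda>x. if x \<in> A2 then 1 else 0))"
      using K(2) by (rule internal_mono)
    moreover have "((\<lambda>x. if x \<in> A1 then 1 else 0) + (\<lambda>x. if x \<in> A2 then 1 else 0)) x = (1::real)"
      if "x \<in> ?A" for x using that disj by (auto simp: plus_fun_def)
    ultimately have int1: "internal \<xi> ?A x1 K (\<lambda>_. 1)" by (subst internal_cong[symmetric]) auto
    have a1: "\<exists>e. internal \<xi> ?A x1 K e \<and> (\<forall>j\<in>I1 \<union> I2. e j = of_bool (j = i)) \<and> Phi \<xi> ?A e \<in> {\<eta>. dnorm x1 d \<eta> \<le> K}"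
      if i: "i \<in> I1" for i
    proof (intro exI conjI)
      show "internal \<xi> ?A x1 K (\<lambda>x. if x \<in> A1 then E1 i x else 0)"
        using ext1[OF 1(8)[OF i]] K(1) by (rule internal_mono)
      show "\<forall>j\<in>I1 \<union> I2. (if j \<in> A1 then E1 i j else 0) = of_bool (j = i)"
        using 1(2,9) 2(2) disj i by auto
      show "Phi \<xi> ?A (\<lambda>x. if x \<in> A1 then E1 i x else 0) \<in> {\<eta>. dnorm x1 d \<eta> \<le> K}"
        using 1(10)[OF i] K(1) by (simp add: Phi_extend[OF finA])
    qed
    have a2: "\<exists>e. internal \<xi> ?A x1 K e \<and> (\<forall>j\<in>I1 \<union> I2. e j = of_bool (j = i)) \<and> Phi \<xi> ?A e \<in> {\<eta>. dnorm x1 d \<eta> \<le> K}"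
      if i: "i \<in> I2" for i
    proof (intro exI conjI)
      show "internal \<xi> ?A x1 K (\<lambda>x. if x \<in> A2 then E2 i x else 0)"
        using moved[OF 2(8,10)] i K(3) by (blast intro: internal_mono)
      show "\<forall>j\<in>I1 \<union> I2. (if j \<in> A2 then E2 i j else 0) = of_bool (j = i)"
        using 1(2) 2(2,9) disj i by auto
      have "dnorm x1 d (Phi \<xi> A2 (E2 i)) \<le> real (card Idx) * C0 * dnorm x2 d (Phi \<xi> A2 (E2 i))"
        by (rule dnorm_rebase[OF Phi_dual[OF \<xi>(2)] d dist'])
      also have "\<dots> \<le> real (card Idx) * C0 * C" using 2(10)[OF i] C0 by (intro mult_left_mono) auto
      also note K(4)
      finally show "Phi \<xi> ?A (\<lambda>x. if x \<in> A2 then E2 i x else 0) \<in> {\<eta>. dnorm x1 d \<eta> \<le> K}"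
        by (simp add: Phi_extend[OF finA])
    qed
    have b: "\<exists>a. internal \<xi> ?A x1 K a \<and> (\<forall>j\<in>I1 \<union> I2. a j = 0) \<and> Phi \<xi> ?A a = w"
      if "w \<in> span B1 \<inter> {\<eta>. dnorm x1 d \<eta> \<le> 1}" for w
    proof -
      have "w \<in> span B1" "dnorm x1 d w \<le> 1" using that by auto
      from 1(11)[OF this] obtain a where a: "internal \<xi> A1 x1 C a" "\<forall>j\<in>I1. a j = 0" "Phi \<xi> A1 a = w" by blast
      have "internal \<xi> ?A x1 K (\<lambda>x. if x \<in> A1 then a x else 0)"
        using ext1[OF a(1)] K(1) by (rule internal_mono)
      moreover have "\<forall>j\<in>I1 \<union> I2. (if j \<in> A1 then a j else 0) = 0" using a(2) 2(2) disj by auto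
      moreover have "Phi \<xi> ?A (\<lambda>x. if x \<in> A1 then a x else 0) = w" using a(3) by (simp add: Phi_extend[OF finA])
      ultimately show ?thesis by blast
    qed
    have "card ?A = card A1 + card A2" using fin disj by (rule card_Un_disjoint)
    \<comment> \<open>\<open>le\<close> raises the exponent of the second term, so that both bounds
      share the factor \<open>2 ^ card B1\<close> and the numbers of points add up.\<close>
    also have "\<dots> \<le> card I1 * 2 ^ card B1 + card I2 * 2 ^ card B1"
      using 1(7) 2(7) le by (intro add_mono) (auto elim!: order_trans intro!: mult_left_mono power_increasing)
    also have "\<dots> = card (I1 \<union> I2) * 2 ^ card B1"
    proof -
      have "finite I1" "finite I2" "I1 \<inter> I2 = {}" using 1(2) 2(2) fin disj by (auto dest: finite_subset)
      then show ?thesis by (simp add: card_Un_disjoint distrib_right)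
    qed
    finally have card: "card ?A \<le> card (I1 \<union> I2) * 2 ^ card B1" .
    show ?thesis
      unfolding frame_def K_def[symmetric]
    proof (intro conjI exI[of _ "I1 \<union> I2"] exI[of _ B1])
      show "\<forall>i\<in>I1 \<union> I2. \<exists>e. internal \<xi> ?A x1 K e \<and> (\<forall>j\<in>I1 \<union> I2. e j = of_bool (j = i)) \<and>
          Phi \<xi> ?A e \<in> {\<eta>. dnorm x1 d \<eta> \<le> K}" using a1 a2 by blast
      show "\<forall>w\<in>span B1 \<inter> {\<eta>. dnorm x1 d \<eta> \<le> 1}.
          \<exists>a. internal \<xi> ?A x1 K a \<and> (\<forall>j\<in>I1 \<union> I2. a j = 0) \<and> Phi \<xi> ?A a = w" using b by blast
    qed (use int1 1 2 card in auto)
  qed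
  obtain I1 B1 E1 where 11: "frame_data \<xi> A1 x1 d C I1 B1 E1" using 1 by (auto simp: metric_frame_iff)
  obtain I2 B2 E2 where 22: "frame_data \<xi> A2 x2 d C I2 B2 E2" using 2 by (auto simp: metric_frame_iff)
  show ?thesis
  proof (cases "card B2 \<le> card B1")
    case True
    have "metric_frame \<xi> (A1 \<union> A2) x1 d ((2 + C0 + C0 * real (card Idx)) * C)"
      by (rule main[OF 11 22 True fin disj]) (use \<xi> dist x one in auto)
    then show ?thesis using x(1) by blast
  next
    case False
    then have le: "card B1 \<le> card B2" by simp
    have "metric_frame \<xi> (A2 \<union> A1) x2 d ((2 + C0 + C0 * real (card Idx)) * C)"
      by (rule main[OF 22 11 le fin(2,1)]) (use \<xi> dist x one disj in auto)
    then show ?thesis using x(2) by (auto simp: Un_commute)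
  qed
qed

section \<open>Recursion over the cluster tree\<close>

text \<open>\<open>d\<close> is the scale of the parent rather than the diameter of
  \<open>A\<close>: distances inside \<open>A\<close> are at most \<open>d\<close>, those to the
  rest of \<open>T\<close> at least \<open>d / N\<close>. The bound on \<open>\<xi>\<close> concerns
  the whole of \<open>T\<close>.\<close>

definition cluster :: "'a set \<Rightarrow> ('a \<Rightarrow> 'v \<Rightarrow> real) \<Rightarrow> 'a set \<Rightarrow> real \<Rightarrow> bool" where
  "cluster T \<xi> A d \<longleftrightarrow> finite T \<and> A \<subseteq> T \<and> A \<noteq> {} \<and> card A \<le> N \<and> (\<forall>x\<in>T. \<xi> x \<in> dual) \<and>
     (\<forall>p. fld 1 p \<longrightarrow> \<bar>\<Sum>x\<in>T. \<xi> x (p x)\<bar> \<le> 1) \<and> 0 < d \<and> d \<le> 1 \<and>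
     (\<forall>x\<in>A. \<forall>y\<in>A. dist x y \<le> d) \<and> (\<forall>x\<in>A. \<forall>y\<in>T - A. d / real N \<le> dist x y)"

text \<open>Testing \<open>\<xi>\<close> on a field that equals a generator on \<open>A\<close> and
  0 on the rest of \<open>T\<close> isolates the total functional of \<open>A\<close>. The
  separation \<open>d / N\<close> provides such a field with norm \<open>C0\<close>.\<close>

lemma cluster_norm:
  assumes "cluster T \<xi> A d" "x0 \<in> A"
  shows "dnorm x0 d (Phi \<xi> A (\<lambda>_. 1)) \<le> real (card Idx) * C0"
proof -
  note c = assms(1)[unfolded cluster_def]
  have "\<bar>Phi \<xi> A (\<lambda>_. 1) (gen x0 d k)\<bar> \<le> C0" if k: "k \<in> Idx" for k
  proof -
    obtain p where p: "fld C0 p" "\<forall>y\<in>A. p y = gen x0 d k" "\<forall>y\<in>T - A. p y = 0"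
      using bump[of T A x0 d k] c assms(2) k by blast
    have "fld 1 (\<lambda>x. (1 / C0) *\<^sub>R p x)" using fld_scale[OF p(1), of "1 / C0"] C0 by simp
    then have "\<bar>\<Sum>x\<in>T. \<xi> x ((1 / C0) *\<^sub>R p x)\<bar> \<le> 1" using c by blast
    also have "(\<Sum>x\<in>T. \<xi> x ((1 / C0) *\<^sub>R p x)) = (\<Sum>x\<in>A. \<xi> x ((1 / C0) *\<^sub>R gen x0 d k))"
      by (rule sum.mono_neutral_cong_right) (use c p dual_zero in auto)
    also have "\<dots> = (1 / C0) * Phi \<xi> A (\<lambda>_. 1) (gen x0 d k)"
      unfolding Phi_def sum_distrib_left
    proof (rule sum.cong[OF refl])
      fix x assume "x \<in> A"
      then have "\<xi> x \<in> dual" using c by blast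
      from dual_scale[OF this gen_in[OF k]]
      show "\<xi> x ((1 / C0) *\<^sub>R gen x0 d k) = 1 / C0 * (1 * \<xi> x (gen x0 d k))" by simp
    qed
    finally show ?thesis using C0 by (simp add: abs_mult field_simps)
  qed
  then have "dnorm x0 d (Phi \<xi> A (\<lambda>_. 1)) \<le> (\<Sum>k\<in>Idx. C0)" unfolding dnorm_def by (rule sum_mono)
  then show ?thesis by simp
qed

lemma frame_mono:
  assumes "metric_frame \<xi> A x0 d C" "C \<le> C'"
  shows "metric_frame \<xi> A x0 d C'"
proof -
  obtain I B E where "frame_data \<xi> A x0 d C I B E" using assms(1) by (auto simp: metric_frame_iff)
  note * = frame_dataD[OF this]
  have "frame_data \<xi> A x0 d C' I B E"
    unfolding frame_data_def
  proof (intro conjI ballI impI)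
    show "dnorm x0 d (Phi \<xi> A (E i)) \<le> C'" if "i \<in> I" for i using *(10)[OF that] assms(2) by linarith
    show "\<exists>a. internal \<xi> A x0 C' a \<and> (\<forall>j\<in>I. a j = 0) \<and> Phi \<xi> A a = w"
      if "w \<in> span B" "dnorm x0 d w \<le> 1" for w using *(11)[OF that] internal_mono[OF _ assms(2)] by blast
  qed (use *(1-9) internal_mono[OF _ assms(2)] in auto)
  then show ?thesis by (auto simp: metric_frame_iff)
qed

text \<open>The ball at the larger scale lies inside the ball at the smaller one, so the elimination
  applies with the former as \<open>L\<close>; the constant weight belongs to it because
  \<open>A\<close> is a cluster at scale \<open>d'\<close>.\<close>

lemma frame_enlarge_scale:
  assumes fr: "metric_frame \<xi> A x0 d C" and cl: "cluster T \<xi> A d'" and x0: "x0 \<in> A"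
    and d: "0 < d" "d \<le> d'" and C: "C \<ge> 1" "real (card Idx) * C0 \<le> C"
  shows "metric_frame \<xi> A x0 d' (2 * (2 * (real N + 1)) ^ N * ((real N + 1) * C * C))"
proof -
  note c = cl[unfolded cluster_def]
  define C' where "C' = 2 * (2 * (real N + 1)) ^ N * ((real N + 1) * C * C)"
  \<comment> \<open>Restricted to \<open>dual\<close>, since the comparison of the two scales uses
    linearity.\<close>
  define L where "L = dual \<inter> {\<eta>. dnorm x0 d' \<eta> \<le> C}"
  have \<xi>: "\<forall>x\<in>A. \<xi> x \<in> dual" using c by blast
  have "1 * (1 * C * 1) \<le> (2 * (real N + 1)) ^ N * ((real N + 1) * C * C)"
    using C(1) by (intro mult_mono one_le_power) auto
  then have "C \<le> C'" using C(1) by (simp add: C'_def)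
  have sub: "subspace dual"
    unfolding subspace_def dual_def by (auto simp: plus_fun_def scaleR_fun_def algebra_simps)
  have sep: "separable_from dual L"
    unfolding separable_from_def
  proof (intro allI impI)
    fix B x assume B: "finite B" "B \<subseteq> dual" "independent B" "x \<in> dual" "\<forall>w\<in>span B. x - w \<notin> L"
    have "span B \<subseteq> dual" using B(2) sub by (simp add: span_minimal)
    then have "x - w \<in> dual" if "w \<in> span B" for w using that B(4) sub by (blast intro: subspace_diff)
    \<comment> \<open>All the differences \<open>x - w\<close> lie in \<open>dual\<close>, so
      avoiding \<open>L\<close> is the same as avoiding the whole ball.\<close>
    then have B5: "\<forall>w\<in>span B. x - w \<notin> {\<eta>. dnorm x0 d' \<eta> \<le> C}" using B(5) by (auto simp: L_def)
    have "separable_from dual {\<eta>. dnorm x0 d' \<eta> \<le> C}"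
      by (rule separable_from_seminorm_ball) (use dnorm_add dnorm_scale C(1) in auto)
    from separable_fromD[OF this B(1-4) B5] obtain D :: "('v \<Rightarrow> real) \<Rightarrow> real" where "\<forall>x y. D (x + y) \<le> D x + D y" "\<forall>t x. D (t *\<^sub>R x) = \<bar>t\<bar> * D x"
      "\<forall>w\<in>span B. D w = 0" "\<forall>l\<in>{\<eta>. dnorm x0 d' \<eta> \<le> C}. D l \<le> 1" "D x \<ge> 1"
      by (elim exE conjE)
    then show "\<exists>D. (\<forall>x y. D (x + y) \<le> D x + D y) \<and> (\<forall>t x. D (t *\<^sub>R x) = \<bar>t\<bar> * D x) \<and>
          (\<forall>w\<in>span B. D w = 0) \<and> (\<forall>l\<in>L. D l \<le> 1) \<and> D x \<ge> (1::real)"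
      by (intro exI[of _ D]) (auto simp: L_def)
  qed
  have "frame \<xi> A x0 L L C'"
    unfolding C'_def
  proof (rule frame_tighten[OF fr C(1)])
    show "finite A" "card A \<le> N" using c finite_subset by auto
    show "dnorm x0 d \<eta> \<le> C" if "\<eta> \<in> L" for \<eta>
      using that dnorm_refine[of \<eta> d d' x0] d by (auto simp: L_def)
    show "t *\<^sub>R l \<in> L" if l: "l \<in> L" "\<bar>t\<bar> \<le> 1" for l t
    proof -
      have "\<bar>t\<bar> * dnorm x0 d' l \<le> 1 * C" using l dnorm_nonneg by (intro mult_mono) (auto simp: L_def)
      then show ?thesis using l subspace_scale[OF sub] by (simp add: L_def dnorm_scale)
    qed
    show "Phi \<xi> A (\<lambda>_. 1) \<in> L"
      using cluster_norm[OF cl x0] C(2) Phi_dual[OF \<xi>] by (auto simp: L_def)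
  qed (use \<xi> sep in auto)
  then obtain I B where *: "internal \<xi> A x0 C' (\<lambda>_. 1)" "I \<subseteq> A" "I \<noteq> {}" "finite B" "B \<subseteq> dual" "independent B"
    "card A \<le> card I * 2 ^ card B"
    "\<forall>i\<in>I. \<exists>e. internal \<xi> A x0 C' e \<and> (\<forall>j\<in>I. e j = of_bool (j = i)) \<and> Phi \<xi> A e \<in> L"
    "\<forall>w\<in>span B \<inter> L. \<exists>a. internal \<xi> A x0 C' a \<and> (\<forall>j\<in>I. a j = 0) \<and> Phi \<xi> A a = w"
    unfolding frame_def by (elim exE conjE)
  have "metric_frame \<xi> A x0 d' C'"
    unfolding frame_def
  proof (intro conjI exI[of _ I] exI[of _ B])
    show "\<forall>i\<in>I. \<exists>e. internal \<xi> A x0 C' e \<and> (\<forall>j\<in>I. e j = of_bool (j = i)) \<and> Phi \<xi> A e \<in> {\<eta>. dnorm x0 d' \<eta> \<le> C'}"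
    proof
      fix i assume "i \<in> I"
      then obtain e where "internal \<xi> A x0 C' e \<and> (\<forall>j\<in>I. e j = of_bool (j = i)) \<and> Phi \<xi> A e \<in> L" using *(8) by blast
      then show "\<exists>e. internal \<xi> A x0 C' e \<and> (\<forall>j\<in>I. e j = of_bool (j = i)) \<and> Phi \<xi> A e \<in> {\<eta>. dnorm x0 d' \<eta> \<le> C'}"
        using \<open>C \<le> C'\<close> by (intro exI[of _ e]) (auto simp: L_def)
    qed
    have "span B \<subseteq> dual" using *(5) sub by (simp add: span_minimal)
    then have "span B \<inter> {\<eta>. dnorm x0 d' \<eta> \<le> 1} \<subseteq> span B \<inter> L" using C(1) by (auto simp: L_def)
    then show "\<forall>w\<in>span B \<inter> {\<eta>. dnorm x0 d' \<eta> \<le> 1}. \<exists>a. internal \<xi> A x0 C' a \<and> (\<forall>j\<in>I. a j = 0) \<and> Phi \<xi> A a = w"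
      using *(9) by (meson subsetD)
  qed (use * in auto)
  then show ?thesis by (simp add: C'_def)
qed

text \<open>Induction on the cardinality takes the place of an explicit tree: \<open>A\<close> is
  split at a gap, the parts are clusters at the scale of the diameter of \<open>A\<close>, and their
  merged frame is carried up to scale \<open>d\<close>. The constant does not depend on the points
  or on \<open>d\<close>.\<close>

lemma cluster_frame:
  "\<exists>C\<ge>1. \<forall>T \<xi> A d. cluster T \<xi> A d \<longrightarrow> card A \<le> k \<longrightarrow> (\<exists>x0\<in>A. metric_frame \<xi> A x0 d C)"
proof (induction k)
  case 0
  have ne: "card A \<noteq> 0" if "cluster T \<xi> A d" for T \<xi> A d
  proof -
    have "finite A" "A \<noteq> {}" using that finite_subset unfolding cluster_def by blast+
    then show ?thesis by simp
  qed
  show ?case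
  proof (intro exI[of _ 1] conjI allI impI)
    fix T \<xi> A d assume "cluster T \<xi> A d" "card A \<le> 0"
    then show "\<exists>x0\<in>A. metric_frame \<xi> A x0 d 1" using ne by blast
  qed simp
next
  case (Suc k)
  then obtain C where C: "C \<ge> 1" and IH: "\<And>T \<xi> A d. cluster T \<xi> A d \<Longrightarrow> card A \<le> k \<Longrightarrow> \<exists>x0\<in>A. metric_frame \<xi> A x0 d C"
    by blast
  define C1 where "C1 = max C (real (card Idx) * C0)"
  define C2 where "C2 = (2 + C0 + C0 * real (card Idx)) * C1"
  define C3 where "C3 = max C1 (2 * (2 * (real N + 1)) ^ N * ((real N + 1) * C2 * C2))"
  have C1: "C1 \<ge> 1" "real (card Idx) * C0 \<le> C1" using C by (auto simp: C1_def)
  have "1 * C1 \<le> C2" unfolding C2_def using C0 C1(1) by (intro mult_right_mono) auto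
  then have C2: "C1 \<le> C2" by simp
  have C3: "C3 \<ge> 1" "C1 \<le> C3" "2 * (2 * (real N + 1)) ^ N * ((real N + 1) * C2 * C2) \<le> C3"
    using C1 by (auto simp: C3_def)
  have "\<exists>x0\<in>A. metric_frame \<xi> A x0 d C3" if cl: "cluster T \<xi> A d" and card: "card A \<le> Suc k" for T \<xi> A d
  proof -
    note c = cl[unfolded cluster_def]
    have fA: "finite A" using c finite_subset by blast
    consider x where "A = {x}" | "card A \<ge> 2"
    proof -
      have "card A \<noteq> 0" using fA c by auto
      then consider "card A = 1" | "card A \<ge> 2" by linarith
      then show ?thesis using that by cases (auto simp: card_1_singleton_iff)
    qed
    then show ?thesis
    proof cases
      case 1
      \<comment> \<open>A leaf: one point with the constant weight and an empty basis,
        \<open>1 \<le> 1 * 2 ^ 0\<close>. All differences \<open>p x - p x\<close> vanish, so only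
        the size of the weight counts.\<close>
      have "\<xi> x 0 = 0" using dual_zero c 1 by blast
      have int: "internal \<xi> A x C3 e" if "\<bar>e x\<bar> \<le> 1" for e
        using that C3(1) 1 \<open>\<xi> x 0 = 0\<close> by (simp add: internal_def)
      have "metric_frame \<xi> A x d C3"
        unfolding frame_def
      proof (intro conjI exI[of _ A] exI[of _ "{}"])
        show "\<forall>i\<in>A. \<exists>e. internal \<xi> A x C3 e \<and> (\<forall>j\<in>A. e j = of_bool (j = i)) \<and> Phi \<xi> A e \<in> {\<eta>. dnorm x d \<eta> \<le> C3}"
          using cluster_norm[OF cl, of x] C1(2) C3(2) 1 int by (auto intro!: exI[of _ "\<lambda>_. 1"])
        show "\<forall>w\<in>span {} \<inter> {\<eta>. dnorm x d \<eta> \<le> 1}. \<exists>a. internal \<xi> A x C3 a \<and> (\<forall>j\<in>A. a j = 0) \<and> Phi \<xi> A a = w"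
          using int[of "\<lambda>_. 0"] by (auto simp: Phi_def zero_fun_def intro!: exI[of _ "\<lambda>_. 0"])
      qed (use int 1 in \<open>auto simp: independent_empty\<close>)
      then show ?thesis using 1 by blast
    next
      case 2
      obtain A1 A2 a b where s: "A = A1 \<union> A2" "A1 \<inter> A2 = {}" "A1 \<noteq> {}" "A2 \<noteq> {}" "a \<in> A" "b \<in> A" "a \<noteq> b"
        "\<And>x y. x \<in> A \<Longrightarrow> y \<in> A \<Longrightarrow> dist x y \<le> dist a b"
        "\<And>x y. x \<in> A1 \<Longrightarrow> y \<in> A2 \<Longrightarrow> dist a b / real (card A) \<le> dist x y"
        using finite_metric_split[OF fA 2] by metis
      define D where "D = dist a b"
      have D: "0 < D" "D \<le> d" "D \<le> 1" using c s(5-7) by (auto simp: D_def) (meson order_trans)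
      \<comment> \<open>The gap of the split is the diameter over \<open>card A\<close>, hence at
        least \<open>D / N\<close>, as required for the two children.\<close>
      have DN: "D / real N \<le> dist a b / real (card A)"
        unfolding D_def using c 2 by (intro divide_left_mono) auto
      have Dd: "D / real N \<le> d / real N" using D(2) by (intro divide_right_mono) auto
      have fin: "finite A1" "finite A2" using fA s(1) by auto
      have cards: "card A = card A1 + card A2" using s(1,2) fin by (simp add: card_Un_disjoint)
      have pos: "card A1 > 0" "card A2 > 0" using s(3,4) fin by (auto simp: card_gt_0_iff)
      have base: "finite T" "\<forall>x\<in>T. \<xi> x \<in> dual" "\<forall>p. fld 1 p \<longrightarrow> \<bar>\<Sum>x\<in>T. \<xi> x (p x)\<bar> \<le> 1"
        "A \<subseteq> T" "card A \<le> N" and sepA: "\<forall>x\<in>A. \<forall>y\<in>T - A. d / real N \<le> dist x y"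
        using c by blast+
      have sub: "A1 \<subseteq> T" "A2 \<subseteq> T" "card A1 \<le> N" "card A2 \<le> N" using base(4,5) s(1) cards by auto
      have dd: "\<forall>x\<in>A1. \<forall>y\<in>A1. dist x y \<le> D" "\<forall>x\<in>A2. \<forall>y\<in>A2. dist x y \<le> D"
        "\<forall>x\<in>A1 \<union> A2. \<forall>y\<in>A1 \<union> A2. dist x y \<le> D"
        using s(8) unfolding D_def s(1) by blast+
      have sep12: "D / real N \<le> dist x y" if "x \<in> A1" "y \<in> A2" for x y
        using s(9)[OF that] DN by linarith
      have sepT: "D / real N \<le> dist x y" if "x \<in> A" "y \<in> T" "y \<notin> A" for x y
        using sepA that Dd by force
      have "\<forall>x\<in>A1. \<forall>y\<in>T - A1. D / real N \<le> dist x y" using sep12 sepT s(1) by blast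
      then have cl1: "cluster T \<xi> A1 D"
        unfolding cluster_def by (intro conjI base sub s(3) D dd(1))
      have "\<forall>x\<in>A2. \<forall>y\<in>T - A2. D / real N \<le> dist x y"
        using sep12 sepT s(1) dist_commute by (metis DiffE UnCI UnE)
      then have cl2: "cluster T \<xi> A2 D"
        unfolding cluster_def by (intro conjI base sub s(4) D dd(2))
      obtain x1 where x1: "x1 \<in> A1" "metric_frame \<xi> A1 x1 D C"
        using IH[OF cl1] card cards pos by auto
      obtain x2 where x2: "x2 \<in> A2" "metric_frame \<xi> A2 x2 D C"
        using IH[OF cl2] card cards pos by auto
      have "C \<le> C1" by (simp add: C1_def)
      have "\<exists>x0\<in>A1 \<union> A2. metric_frame \<xi> (A1 \<union> A2) x0 D C2"
        unfolding C2_def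
      proof (rule frame_merge[OF frame_mono[OF x1(2) \<open>C \<le> C1\<close>] frame_mono[OF x2(2) \<open>C \<le> C1\<close>] fin s(2) C1(1) _ D(1) x1(1) x2(1)])
        show "dnorm x1 D (Phi \<xi> A1 (\<lambda>_. 1)) \<le> C1" using cluster_norm[OF cl1 x1(1)] C1(2) by linarith
        show "dnorm x2 D (Phi \<xi> A2 (\<lambda>_. 1)) \<le> C1" using cluster_norm[OF cl2 x2(1)] C1(2) by linarith
      qed (use base(2) sub dd(3) in blast)+
      then obtain x0 where x0: "x0 \<in> A" "metric_frame \<xi> A x0 D C2" using s(1) by auto
      have "metric_frame \<xi> A x0 d (2 * (2 * (real N + 1)) ^ N * ((real N + 1) * C2 * C2))"
        by (rule frame_enlarge_scale[OF x0(2) cl x0(1) D(1,2)]) (use C1 C2 in auto)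
      then show ?thesis using frame_mono[OF _ C3(3)] x0(1) by blast
    qed
  qed
  then show ?case using C3(1) by blast
qed

end

subsection \<open>Separation and the abstract finiteness principle\<close>

definition sublinear_on :: "'z::real_vector set \<Rightarrow> ('z \<Rightarrow> real) \<Rightarrow> bool" where
  "sublinear_on Z p \<longleftrightarrow> (\<forall>x\<in>Z. \<forall>y\<in>Z. p (x + y) \<le> p x + p y) \<and> (\<forall>c\<ge>0. \<forall>x\<in>Z. p (c *\<^sub>R x) = c * p x)"

text \<open>The infimum of \<open>p (x + t *\<^sub>R a) - t * p a\<close> over
  \<open>t \<ge> 0\<close> stays sublinear and lies below \<open>p\<close>; at \<open>- a\<close>
  the choice \<open>t = 1\<close> bounds it by \<open>- p a\<close>. Together with subadditivity
  this makes it odd at \<open>a\<close>.\<close>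

lemma sublinear_on_flatten:
  fixes p :: "'z::real_vector \<Rightarrow> real"
  assumes Z: "subspace Z" and p: "sublinear_on Z p" and a: "a \<in> Z"
  shows "\<exists>q. sublinear_on Z q \<and> (\<forall>x\<in>Z. q x \<le> p x) \<and> q a + q (- a) = 0"
proof -
  have add: "p (x + y) \<le> p x + p y" if "x \<in> Z" "y \<in> Z" for x y using p that by (auto simp: sublinear_on_def)
  have scale: "p (c *\<^sub>R x) = c * p x" if "x \<in> Z" "c \<ge> 0" for x c using p that by (auto simp: sublinear_on_def)
  have ta: "t *\<^sub>R a \<in> Z" for t using Z a by (rule subspace_scale)
  define q where "q x = (INF t\<in>{0..}. p (x + t *\<^sub>R a) - t * p a)" for x
  \<comment> \<open>Subadditivity gives a lower bound independent of \<open>t\<close>, so the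
    infimum is finite.\<close>
  have low: "- p (- x) \<le> p (x + t *\<^sub>R a) - t * p a" if "x \<in> Z" "t \<ge> 0" for x t
  proof -
    have "p (t *\<^sub>R a) \<le> p (x + t *\<^sub>R a) + p (- x)"
      using add[of "x + t *\<^sub>R a" "- x"] that Z ta by (simp add: subspace_add subspace_neg)
    then show ?thesis using scale[OF a that(2)] by simp
  qed
  have le: "q x \<le> p (x + t *\<^sub>R a) - t * p a" if "x \<in> Z" "t \<ge> 0" for x t
    unfolding q_def by (rule cINF_lower) (use low that in \<open>auto intro!: bdd_belowI[of _ "- p (- x)"]\<close>)
  have ge: "b \<le> q x" if "\<And>t. t \<ge> 0 \<Longrightarrow> b \<le> p (x + t *\<^sub>R a) - t * p a" for x b
    unfolding q_def by (rule cINF_greatest) (use that in auto)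
  have qadd: "q (x + y) \<le> q x + q y" if x: "x \<in> Z" and y: "y \<in> Z" for x y
  proof -
    have "q (x + y) - (p (x + s *\<^sub>R a) - s * p a) \<le> q y" if s: "s \<ge> 0" for s
    proof (rule ge)
      fix t :: real assume t: "t \<ge> 0"
      have "q (x + y) \<le> p ((x + y) + (s + t) *\<^sub>R a) - (s + t) * p a"
        using x y s t Z by (intro le) (auto simp: subspace_add)
      also have "(x + y) + (s + t) *\<^sub>R a = (x + s *\<^sub>R a) + (y + t *\<^sub>R a)" by (simp add: algebra_simps)
      also have "p \<dots> \<le> p (x + s *\<^sub>R a) + p (y + t *\<^sub>R a)"
        using x y Z ta by (intro add) (auto simp: subspace_add)
      finally show "q (x + y) - (p (x + s *\<^sub>R a) - s * p a) \<le> p (y + t *\<^sub>R a) - t * p a"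
        by (simp add: algebra_simps)
    qed
    then have "q (x + y) - q y \<le> q x" by (intro ge) (simp add: algebra_simps)
    then show ?thesis by simp
  qed
  have p0: "p 0 = 0" using scale[of 0 0] Z by (simp add: subspace_0)
  have q0: "q 0 = 0"
  proof (rule antisym)
    show "q 0 \<le> 0" using le[of 0 0] Z p0 by (simp add: subspace_0)
    show "0 \<le> q 0" by (rule ge) (use scale[OF a] in simp)
  qed
  have qscale': "q (c *\<^sub>R x) \<le> c * q x" if x: "x \<in> Z" and c: "c > 0" for x c
  proof -
    have "q (c *\<^sub>R x) / c \<le> q x"
    proof (rule ge)
      fix t :: real assume t: "t \<ge> 0"
      have "q (c *\<^sub>R x) \<le> p (c *\<^sub>R x + (c * t) *\<^sub>R a) - (c * t) * p a"
        using x c t Z by (intro le) (auto simp: subspace_scale)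
      also have "c *\<^sub>R x + (c * t) *\<^sub>R a = c *\<^sub>R (x + t *\<^sub>R a)" by (simp add: algebra_simps)
      also have "p \<dots> = c * p (x + t *\<^sub>R a)" using x Z ta c by (intro scale) (auto simp: subspace_add)
      finally show "q (c *\<^sub>R x) / c \<le> p (x + t *\<^sub>R a) - t * p a" using c by (simp add: field_simps)
    qed
    then show ?thesis using c by (simp add: field_simps)
  qed
  have qscale: "q (c *\<^sub>R x) = c * q x" if x: "x \<in> Z" and c: "c \<ge> 0" for x c
  proof (cases "c = 0")
    case False
    then have c0: "c > 0" using c by simp
    have "q x \<le> (1 / c) * q (c *\<^sub>R x)"
      using qscale'[of "c *\<^sub>R x" "1 / c"] c0 Z x by (simp add: subspace_scale)
    then have "c * q x \<le> q (c *\<^sub>R x)" using c0 by (simp add: field_simps)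
    then show ?thesis using qscale'[OF x c0] by linarith
  qed (use q0 in simp)
  have "q (- a) \<le> - p a" using le[of "- a" 1] Z a p0 by (simp add: subspace_neg)
  moreover have qp: "q x \<le> p x" if "x \<in> Z" for x using le[OF that, of 0] by simp
  moreover have "0 \<le> q a + q (- a)" using qadd[of a "- a"] Z a q0 by (simp add: subspace_neg)
  ultimately have "q a + q (- a) = 0" using a by (smt (verit))
  then show ?thesis using qadd qscale qp by (intro exI[of _ q]) (simp add: sublinear_on_def)
qed

text \<open>The functional is flattened along a finite spanning set; a sublinear functional that is
  odd on a spanning set is odd on the whole space, and hence linear.\<close>

lemma sublinear_on_dominates_linear:
  fixes p :: "'z::real_vector \<Rightarrow> real"
  assumes Z: "subspace Z" and p: "sublinear_on Z p" and B: "finite B" "B \<subseteq> Z" "Z \<subseteq> span B"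
  obtains f where "\<And>x y. x \<in> Z \<Longrightarrow> y \<in> Z \<Longrightarrow> f (x + y) = f x + f y"
    "\<And>c x. x \<in> Z \<Longrightarrow> f (c *\<^sub>R x) = c * f x" "\<And>x. x \<in> Z \<Longrightarrow> f x \<le> p x"
proof -
  have "\<exists>q. sublinear_on Z q \<and> (\<forall>x\<in>Z. q x \<le> p x) \<and> (\<forall>b\<in>B. q b + q (- b) = 0)"
    using B(1,2)
  proof (induction B)
    case empty
    then show ?case using p by auto
  next
    case (insert a B)
    then obtain q where q: "sublinear_on Z q" "\<forall>x\<in>Z. q x \<le> p x" "\<forall>b\<in>B. q b + q (- b) = 0" by auto
    obtain r where r: "sublinear_on Z r" "\<forall>x\<in>Z. r x \<le> q x" "r a + r (- a) = 0"
      using sublinear_on_flatten[OF Z q(1), of a] insert.prems by auto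
    \<comment> \<open>Flattening at \<open>a\<close> keeps oddness at the earlier vectors: the sum
      is at most \<open>q b + q (- b) = 0\<close>, and at least 0 by subadditivity.\<close>
    have "r b + r (- b) = 0" if b: "b \<in> B" for b
    proof -
      have bZ: "b \<in> Z" "- b \<in> Z" using b insert.prems Z by (auto simp: subspace_neg)
      have "r 0 = 0" using r(1) Z subspace_0 unfolding sublinear_on_def by (metis mult_zero_left order_refl scaleR_zero_left)
      moreover have "r (b + - b) \<le> r b + r (- b)" using r(1) bZ unfolding sublinear_on_def by blast
      ultimately have "0 \<le> r b + r (- b)" by simp
      moreover have "r b \<le> q b" "r (- b) \<le> q (- b)" using r(2) bZ by auto
      moreover have "q b + q (- b) = 0" using q(3) b by blast
      ultimately show ?thesis by linarith
    qed
    moreover have "\<forall>x\<in>Z. r x \<le> p x" using r(2) q(2) by force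
    ultimately show ?case using r by auto
  qed
  then obtain q where q: "sublinear_on Z q" "\<forall>x\<in>Z. q x \<le> p x" "\<forall>b\<in>B. q b + q (- b) = 0" by blast
  have add: "q (x + y) \<le> q x + q y" if "x \<in> Z" "y \<in> Z" for x y using q(1) that by (auto simp: sublinear_on_def)
  have scale: "q (c *\<^sub>R x) = c * q x" if "x \<in> Z" "c \<ge> 0" for x c using q(1) that by (auto simp: sublinear_on_def)
  have q0: "q 0 = 0" using scale[of 0 0] Z by (simp add: subspace_0)
  have nonneg: "0 \<le> q x + q (- x)" if "x \<in> Z" for x
    using add[of x "- x"] that Z q0 by (simp add: subspace_neg)
  have "subspace {x \<in> Z. q x + q (- x) = 0}"
    unfolding subspace_def
  proof (intro conjI ballI allI)
    show "0 \<in> {x \<in> Z. q x + q (- x) = 0}" using Z q0 by (simp add: subspace_0)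
    fix x assume x: "x \<in> {x \<in> Z. q x + q (- x) = 0}"
    show "x + y \<in> {x \<in> Z. q x + q (- x) = 0}" if y: "y \<in> {x \<in> Z. q x + q (- x) = 0}" for y
    proof -
      have "q (x + y) \<le> q x + q y" "q (- x + - y) \<le> q (- x) + q (- y)"
        using x y Z add[of x y] add[of "- x" "- y"] by (auto simp: subspace_neg)
      moreover have "0 \<le> q (x + y) + q (- (x + y))" using x y Z by (intro nonneg) (auto simp: subspace_add)
      ultimately show ?thesis using x y Z by (auto simp: subspace_add)
    qed
    show "c *\<^sub>R x \<in> {x \<in> Z. q x + q (- x) = 0}" for c
    proof (cases "c \<ge> 0")
      case True
      then show ?thesis using scale[of x c] scale[of "- x" c] x Z
        by (simp add: subspace_scale subspace_neg distrib_left[symmetric])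
    next
      case False
      have "q (- x) = - q x" using x by simp
      then show ?thesis using scale[of x "- c"] scale[of "- x" "- c"] x Z False
        by (simp add: subspace_scale subspace_neg)
    qed
  qed
  then have "span B \<subseteq> {x \<in> Z. q x + q (- x) = 0}" using q(3) B(2) by (intro span_minimal) auto
  then have neg: "q (- x) = - q x" if "x \<in> Z" for x using B(3) that by force
  show ?thesis
  proof (rule that[of q])
    show "q (x + y) = q x + q y" if "x \<in> Z" "y \<in> Z" for x y
    proof (rule antisym)
      show "q (x + y) \<le> q x + q y" by (rule add[OF that])
      have "q (- x + - y) \<le> q (- x) + q (- y)" using that Z by (intro add) (auto simp: subspace_neg)
      moreover have "q (- x + - y) = - q (x + y)" using neg[of "x + y"] that Z by (simp add: subspace_add)
      ultimately show "q x + q y \<le> q (x + y)" using neg that by simp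
    qed
    show "q (c *\<^sub>R x) = c * q x" if x: "x \<in> Z" for c x
    proof (cases "c \<ge> 0")
      case False
      then have "q ((- c) *\<^sub>R x) = (- c) * q x" using scale[OF x, of "- c"] by simp
      moreover have "q ((- c) *\<^sub>R x) = - q (c *\<^sub>R x)" using neg[of "c *\<^sub>R x"] x Z by (simp add: subspace_scale)
      ultimately show ?thesis by simp
    qed (use scale x in simp)
  qed (use q(2) in auto)
qed

context selection_system begin

section \<open>Reducing the support of a family of functionals\<close>

text \<open>A jump of at least 1 is the normalised form of being far from constant; when the support
  is reduced, the oscillation of \<open>e\<close> becomes a denominator.\<close>

definition oscillating :: "'a set \<Rightarrow> ('a \<Rightarrow> 'v \<Rightarrow> real) \<Rightarrow> real \<Rightarrow> bool" where
  "oscillating T \<xi> C \<longleftrightarrow> (\<exists>e. (\<exists>i\<in>T. \<exists>j\<in>T. e i - e j \<ge> 1) \<and> (\<forall>x\<in>T. \<bar>e x\<bar> \<le> C) \<and>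
     (\<forall>p. fld 1 p \<longrightarrow> \<bar>\<Sum>x\<in>T. e x * \<xi> x (p x)\<bar> \<le> C))"

definition admissible :: "'a set \<Rightarrow> ('a \<Rightarrow> 'v \<Rightarrow> real) \<Rightarrow> real \<Rightarrow> bool" where
  "admissible T \<xi> M \<longleftrightarrow> finite T \<and> card T \<le> N \<and> (\<forall>x\<in>T. \<xi> x \<in> dual) \<and> (\<forall>x\<in>T. \<forall>y\<in>T. dist x y \<le> 1) \<and>
     (\<forall>p. fld 1 p \<longrightarrow> \<bar>\<Sum>x\<in>T. \<xi> x (p x)\<bar> \<le> M)"

text \<open>The frame at the root accounts for at most \<open>2 ^ dim V\<close> points of
  \<open>T\<close> per point of \<open>I\<close>, so \<open>I\<close> has two points, and the weight
  that is 1 at one and 0 at the other has the jump.\<close>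

lemma ex_oscillating: "\<exists>C\<ge>1. \<forall>T \<xi>. admissible T \<xi> 1 \<longrightarrow> 2 ^ dim V < card T \<longrightarrow> oscillating T \<xi> C"
proof -
  obtain C where C: "C \<ge> 1" and fr: "\<And>T \<xi> A d. cluster T \<xi> A d \<Longrightarrow> card A \<le> N \<Longrightarrow> \<exists>x0\<in>A. metric_frame \<xi> A x0 d C"
    using cluster_frame[of N] by blast
  define C1 where "C1 = 2 * (2 * (real N + 1)) ^ N * ((real N + 1) * C * C)"
  define C2 where "C2 = max C1 (C + C0 * C)"
  have C2: "C1 \<le> C2" "C + C0 * C \<le> C2" by (auto simp: C2_def)
  have C21: "C \<le> C2" using C2(2) C C0 mult_nonneg_nonneg[of C0 C] by linarith
  have two: "\<exists>i\<in>I. \<exists>j\<in>I. i \<noteq> j"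
    if "2 ^ dim V < card T" "card T \<le> card I * 2 ^ card B" "finite B" "B \<subseteq> dual" "independent B" "finite I"
    for T I :: "'a set" and B
  proof -
    have "card T \<le> card I * 2 ^ dim V"
      using that(2) card_independent_dual_le[OF that(3-5)]
      by (auto elim!: order_trans intro!: mult_left_mono power_increasing)
    then have "\<not> card I * 2 ^ dim V \<le> 1 * 2 ^ dim V" using that(1) by linarith
    then have "\<not> card I \<le> Suc 0" using mult_right_mono[of "card I" 1 "2 ^ dim V"] by auto
    then show ?thesis using card_le_Suc0_iff_eq[OF that(6)] by blast
  qed
  have "oscillating T \<xi> C2" if adm: "admissible T \<xi> 1" and T2: "2 ^ dim V < card T" for T \<xi>
  proof -
    have T: "finite T" "2 ^ dim V < card T" "card T \<le> N" and \<xi>: "\<forall>x\<in>T. \<xi> x \<in> dual"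
      and diam: "\<forall>x\<in>T. \<forall>y\<in>T. dist x y \<le> 1" and bound: "\<forall>p. fld 1 p \<longrightarrow> \<bar>\<Sum>x\<in>T. \<xi> x (p x)\<bar> \<le> 1"
      using adm T2 unfolding admissible_def by blast+
    have "cluster T \<xi> T 1" using T \<xi> diam bound by (auto simp: cluster_def)
    then obtain x0 where x0: "x0 \<in> T" "metric_frame \<xi> T x0 1 C" using fr T(3) by blast
    \<comment> \<open>The dual norm falls into the internal part and the total functional at
      \<open>p x0\<close>; the alternatives of \<open>root\<close> differ in how the latter is
      controlled.\<close>
    have split: "(\<Sum>x\<in>T. e x * \<xi> x (p x)) = (\<Sum>x\<in>T. e x * \<xi> x (p x - p x0)) + Phi \<xi> T e (p x0)"
      if "fld 1 p" for e p
    proof -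
      have "\<xi> x (p x) = \<xi> x (p x - p x0) + \<xi> x (p x0)" if "x \<in> T" for x
        using \<xi> that fld_in[OF \<open>fld 1 p\<close>] by (simp add: dual_diff)
      then show ?thesis by (simp add: Phi_def algebra_simps sum.distrib[symmetric])
    qed
    from root show ?thesis
    proof
      assume r: "\<forall>p x. fld 1 p \<longrightarrow> (\<exists>t. (\<forall>k\<in>Idx. \<bar>t k\<bar> \<le> C0) \<and> p x = (\<Sum>k\<in>Idx. t k *\<^sub>R gen x 1 k))"
      obtain I B E where "frame_data \<xi> T x0 1 C I B E" using x0(2) by (auto simp: metric_frame_iff)
      note f = frame_dataD[OF this]
      have "finite I" using f(2) T(1) finite_subset by blast
      then obtain i j where ij: "i \<in> I" "j \<in> I" "i \<noteq> j" using two[OF T(2) f(7) f(4-6)] by blast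
      have "\<bar>\<Sum>x\<in>T. E i x * \<xi> x (p x)\<bar> \<le> C2" if p: "fld 1 p" for p
      proof -
        obtain t where t: "\<forall>k\<in>Idx. \<bar>t k\<bar> \<le> C0" "p x0 = (\<Sum>k\<in>Idx. t k *\<^sub>R gen x0 1 k)" using r p by blast
        have "\<bar>Phi \<xi> T (E i) (p x0)\<bar> \<le> C0 * dnorm x0 1 (Phi \<xi> T (E i))"
          unfolding t(2) by (rule dnorm_comb[OF Phi_dual[OF \<xi>] t(1)])
        also have "\<dots> \<le> C0 * C" using f(10)[OF ij(1)] C0 by (intro mult_left_mono) auto
        finally have "\<bar>Phi \<xi> T (E i) (p x0)\<bar> \<le> C0 * C" .
        moreover have "\<bar>\<Sum>x\<in>T. E i x * \<xi> x (p x - p x0)\<bar> \<le> C" using f(8)[OF ij(1)] p by (simp add: internal_def)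
        ultimately show ?thesis unfolding split[OF p] using C2(2) by linarith
      qed
      moreover have "\<forall>x\<in>T. \<bar>E i x\<bar> \<le> C2" using f(8)[OF ij(1)] C21 by (force simp: internal_def)
      moreover have "E i i - E i j \<ge> 1" using f(9) ij by simp
      ultimately show ?thesis using ij f(2) unfolding oscillating_def by blast
    next
      assume r: "\<forall>P\<in>V. fld 1 (\<lambda>_. P)"
      \<comment> \<open>All multiples of a constant field have norm at most 1, so a nonzero value at
        \<open>P\<close> would be unbounded under scaling.\<close>
      have "Phi \<xi> T (\<lambda>_. 1) P = 0" for P
      proof (cases "P \<in> V")
        case True
        define s where "s = Phi \<xi> T (\<lambda>_. 1) P"
        have "\<bar>t * s\<bar> \<le> 1" for t
        proof -
          have "fld 1 (\<lambda>_. t *\<^sub>R P)" using r True V_subspace by (simp add: subspace_scale)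
          then have "\<bar>\<Sum>x\<in>T. \<xi> x (t *\<^sub>R P)\<bar> \<le> 1" using bound by fast
          also have "(\<Sum>x\<in>T. \<xi> x (t *\<^sub>R P)) = (\<Sum>x\<in>T. t * \<xi> x P)"
            by (rule sum.cong) (use \<xi> dual_scale True in auto)
          finally show ?thesis by (simp add: s_def Phi_def sum_distrib_left)
        qed
        from this[of "2 / s"] show ?thesis by (cases "s = 0") (auto simp: s_def)
      next
        case False
        then show ?thesis using \<xi> dual_outside by (auto simp: Phi_def intro!: sum.neutral)
      qed
      then have "Phi \<xi> T (\<lambda>_. 1) = 0" by (simp add: fun_eq_iff)
      \<comment> \<open>The values \<open>p x0\<close> are unbounded here, so the totals are
        eliminated down to 0. This is possible because the constant weight has total 0.\<close>
      then have "frame \<xi> T x0 {0} {0} C1"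
        unfolding C1_def
        by (intro frame_tighten[OF x0(2) C T(1,3) \<xi>])
          (use C separable_from_zero in \<open>auto simp: dnorm_def\<close>)
      then obtain I B where f: "I \<subseteq> T" "finite B" "B \<subseteq> dual" "independent B"
        "card T \<le> card I * 2 ^ card B"
        "\<forall>i\<in>I. \<exists>e. internal \<xi> T x0 C1 e \<and> (\<forall>j\<in>I. e j = of_bool (j = i)) \<and> Phi \<xi> T e \<in> {0}"
        unfolding frame_def by (elim exE conjE)
      have "finite I" using f(1) T(1) finite_subset by blast
      then obtain i j where ij: "i \<in> I" "j \<in> I" "i \<noteq> j" using two[OF T(2) f(5) f(2-4)] by blast
      then obtain e where e: "internal \<xi> T x0 C1 e" "\<forall>j\<in>I. e j = of_bool (j = i)" "Phi \<xi> T e = 0"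
        using f(6) by blast
      have "\<bar>\<Sum>x\<in>T. e x * \<xi> x (p x)\<bar> \<le> C2" if p: "fld 1 p" for p
        unfolding split[OF p] using e(1,3) p C2(1) by (force simp: internal_def)
      moreover have "\<forall>x\<in>T. \<bar>e x\<bar> \<le> C2" using e(1) C2(1) by (force simp: internal_def)
      moreover have "e i - e j \<ge> 1" using e(2) ij by simp
      ultimately show ?thesis using ij f(1) unfolding oscillating_def by blast
    qed
  qed
  moreover have "C2 \<ge> 1" using C21 C by linarith
  ultimately show ?thesis by blast
qed

text \<open>\<open>h x\<close> stands for the infimum of \<open>\<xi> x\<close> over
  \<open>G x\<close>. As a free lower bound it can be multiplied by a nonnegative weight together
  with \<open>\<xi> x\<close>, while \<open>G x\<close> stays the same.\<close>

definition lower_bound :: "'a set \<Rightarrow> ('a \<Rightarrow> 'v \<Rightarrow> real) \<Rightarrow> ('a \<Rightarrow> 'v set) \<Rightarrow> ('a \<Rightarrow> real) \<Rightarrow> bool" where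
  "lower_bound T \<xi> G h \<longleftrightarrow> (\<forall>T'\<subseteq>T. card T' \<le> 2 ^ dim V \<longrightarrow> (\<exists>p. fld 1 p \<and> (\<forall>x\<in>T'. p x \<in> G x))) \<and>
     (\<forall>x\<in>T. \<forall>P\<in>G x. h x \<le> \<xi> x P)"

text \<open>The dual form of the principle. On a small support one field of norm 1 has its jets in
  all \<open>G x\<close> and yields the bound; on a larger one the two pieces obtained from an
  oscillating weight are bounded by induction and added.\<close>

lemma sum_lower_bound_le:
  "\<exists>C\<ge>1. \<forall>T \<xi> h M G. admissible T \<xi> M \<longrightarrow> card T \<le> k \<longrightarrow> M > 0 \<longrightarrow> lower_bound T \<xi> G h \<longrightarrow>
     (\<Sum>x\<in>T. h x) \<le> C * M"
proof (induction k)
  case 0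
  have "sum h T = 0" if "admissible T \<xi> M" "card T \<le> 0" for T \<xi> M and h :: "'a \<Rightarrow> real"
    using that by (simp add: admissible_def)
  then show ?case by (intro exI[of _ 1]) auto
next
  case (Suc k)
  then obtain C where C: "C \<ge> 1" and IH: "\<And>T \<xi> h M G. admissible T \<xi> M \<Longrightarrow> card T \<le> k \<Longrightarrow> M > 0 \<Longrightarrow>
     lower_bound T \<xi> G h \<Longrightarrow> (\<Sum>x\<in>T. h x) \<le> C * M" by blast
  obtain C' where C': "C' \<ge> 1" and rel: "\<And>T \<xi>. admissible T \<xi> 1 \<Longrightarrow> 2 ^ dim V < card T \<Longrightarrow> oscillating T \<xi> C'"
    using ex_oscillating by blast
  have CC: "1 * 1 \<le> C * C'" using C C' by (intro mult_mono) auto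
  have "(\<Sum>x\<in>T. h x) \<le> (4 * (C * C')) * M"
    if adm: "admissible T \<xi> M" and cT: "card T \<le> Suc k" and M: "M > 0" and lb: "lower_bound T \<xi> G h" for T \<xi> h M G
  proof (cases "card T \<le> 2 ^ dim V")
    case True
    have bound: "\<forall>p. fld 1 p \<longrightarrow> \<bar>\<Sum>x\<in>T. \<xi> x (p x)\<bar> \<le> M" using adm unfolding admissible_def by blast
    obtain p where p: "fld 1 p" "\<forall>x\<in>T. p x \<in> G x" using lb True unfolding lower_bound_def by blast
    have h: "\<forall>x\<in>T. \<forall>P\<in>G x. h x \<le> \<xi> x P" using lb unfolding lower_bound_def by blast
    have "(\<Sum>x\<in>T. h x) \<le> (\<Sum>x\<in>T. \<xi> x (p x))" using h p(2) by (intro sum_mono) auto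
    also have "\<dots> \<le> M" using bound p(1) by (meson abs_le_D1)
    also have "\<dots> \<le> (4 * (C * C')) * M" using CC M by simp
    finally show ?thesis .
  next
    case False
    have T: "finite T" "card T \<le> N" and \<xi>: "\<forall>x\<in>T. \<xi> x \<in> dual" and diam: "\<forall>x\<in>T. \<forall>y\<in>T. dist x y \<le> 1"
      and bound: "\<forall>p. fld 1 p \<longrightarrow> \<bar>\<Sum>x\<in>T. \<xi> x (p x)\<bar> \<le> M"
      using adm unfolding admissible_def by blast+
    have sel: "\<forall>T'\<subseteq>T. card T' \<le> 2 ^ dim V \<longrightarrow> (\<exists>p. fld 1 p \<and> (\<forall>x\<in>T'. p x \<in> G x))"
      and h: "\<forall>x\<in>T. \<forall>P\<in>G x. h x \<le> \<xi> x P" using lb unfolding lower_bound_def by blast+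
    define \<xi>' where "\<xi>' x P = (1 / M) * \<xi> x P" for x P
    have "\<xi>' x \<in> dual" if "x \<in> T" for x
      using \<xi> that unfolding \<xi>'_def dual_def by (auto simp: algebra_simps add_divide_distrib)
    moreover have "\<bar>\<Sum>x\<in>T. \<xi>' x (p x)\<bar> \<le> 1" if "fld 1 p" for p
    proof -
      have "(\<Sum>x\<in>T. \<xi>' x (p x)) = (1 / M) * (\<Sum>x\<in>T. \<xi> x (p x))"
        unfolding \<xi>'_def by (rule sum_distrib_left[symmetric])
      then show ?thesis using bound that M by (simp add: abs_mult)
    qed
    ultimately have "admissible T \<xi>' 1" unfolding admissible_def by (intro conjI T diam) blast+
    then have "oscillating T \<xi>' C'" using rel False by simp
    then obtain e i0 j0 where e: "i0 \<in> T" "j0 \<in> T" "e i0 - e j0 \<ge> 1" "\<forall>x\<in>T. \<bar>e x\<bar> \<le> C'"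
        "\<forall>p. fld 1 p \<longrightarrow> \<bar>\<Sum>x\<in>T. e x * \<xi>' x (p x)\<bar> \<le> C'"
      unfolding oscillating_def by blast
    have eb: "\<bar>\<Sum>x\<in>T. e x * \<xi> x (p x)\<bar> \<le> C' * M" if "fld 1 p" for p
    proof -
      have "(\<Sum>x\<in>T. e x * \<xi>' x (p x)) = (1 / M) * (\<Sum>x\<in>T. e x * \<xi> x (p x))"
        unfolding \<xi>'_def by (simp add: sum_distrib_left mult_ac)
      then have "\<bar>\<Sum>x\<in>T. e x * \<xi> x (p x)\<bar> = M * \<bar>\<Sum>x\<in>T. e x * \<xi>' x (p x)\<bar>"
        using M by (simp add: abs_mult)
      also have "\<dots> \<le> M * C'" using e(5) that M by (intro mult_left_mono) auto
      finally show ?thesis by (simp add: mult.commute)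
    qed
    have Tne: "e ` T \<noteq> {}" "finite (e ` T)" using e(1) T(1) by auto
    obtain i where i: "i \<in> T" "e i = Max (e ` T)" using Max_in[OF Tne(2,1)] by auto
    obtain j where j: "j \<in> T" "e j = Min (e ` T)" using Min_in[OF Tne(2,1)] by auto
    have ile: "e x \<le> e i" if "x \<in> T" for x unfolding i(2) using Tne(2) that by (intro Max_ge) auto
    have jle: "e j \<le> e x" if "x \<in> T" for x unfolding j(2) using Tne(2) that by (intro Min_le) auto
    \<comment> \<open>With \<open>i\<close> a maximum and \<open>j\<close> a minimum of
      \<open>e\<close>, the weights \<open>(e i - e x) / w\<close> and
      \<open>(e x - e j) / w\<close> are nonnegative, add up to 1 and vanish at \<open>i\<close> and
      at \<open>j\<close>, respectively. As \<open>w \<ge> 1\<close>, the division costs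
      nothing.\<close>
    define w where "w = e i - e j"
    have w: "w \<ge> 1" using ile[OF e(1)] jle[OF e(2)] e(3) by (simp add: w_def)
    \<comment> \<open>Treats both weights at once: \<open>s\<close> is the sign of \<open>e\<close>,
      \<open>r\<close> the additive constant, \<open>z\<close> the point that drops out. Each of the
      two terms contributes \<open>C' * M\<close> to the new dual norm.\<close>
    have part: "(\<Sum>x\<in>T. c x * h x) \<le> C * (2 * C' * M)"
      if c: "\<And>x. x \<in> T \<Longrightarrow> c x = (s * e x + r) / w" "\<And>x. x \<in> T \<Longrightarrow> c x \<ge> 0" and s: "\<bar>s\<bar> = 1" and r: "\<bar>r\<bar> \<le> C'"
        and z: "z \<in> T" "c z = 0" for c s r z
    proof -
      define T1 where "T1 = T - {z}"
      have sumT1: "(\<Sum>x\<in>T1. c x * g x) = (\<Sum>x\<in>T. c x * g x)" for g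
        unfolding T1_def using z T(1) by (simp add: sum.remove[of T z])
      have "(\<Sum>x\<in>T1. c x * h x) \<le> C * (2 * C' * M)"
      proof (rule IH[where \<xi> = "\<lambda>x P. c x * \<xi> x P" and G = G])
        have "card T1 < card T" using z(1) T(1) unfolding T1_def by (intro card_Diff1_less)
        then show "card T1 \<le> k" using cT by simp
        show "2 * C' * M > 0" using C' M by simp
        show "admissible T1 (\<lambda>x P. c x * \<xi> x P) (2 * C' * M)"
          unfolding admissible_def
        proof (intro conjI allI impI)
          show "finite T1" using T(1) by (simp add: T1_def)
          show "card T1 \<le> N" using \<open>card T1 < card T\<close> T(2) by simp
          show "\<forall>x\<in>T1. (\<lambda>P. c x * \<xi> x P) \<in> dual"
            using \<xi> by (auto simp: T1_def dual_def algebra_simps)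
          show "\<forall>x\<in>T1. \<forall>y\<in>T1. dist x y \<le> 1" using diam by (auto simp: T1_def)
          fix p assume p: "fld 1 p"
          have "(\<Sum>x\<in>T. c x * \<xi> x (p x)) = (s * (\<Sum>x\<in>T. e x * \<xi> x (p x)) + r * (\<Sum>x\<in>T. \<xi> x (p x))) / w"
            by (simp add: c(1) sum_distrib_left sum.distrib[symmetric] sum_divide_distrib algebra_simps)
          also have "\<bar>\<dots>\<bar> \<le> \<bar>s * (\<Sum>x\<in>T. e x * \<xi> x (p x)) + r * (\<Sum>x\<in>T. \<xi> x (p x))\<bar>"
            using w by (simp add: divide_le_eq mult_le_cancel_left1)
          also have "\<dots> \<le> \<bar>s * (\<Sum>x\<in>T. e x * \<xi> x (p x))\<bar> + \<bar>r * (\<Sum>x\<in>T. \<xi> x (p x))\<bar>" by (rule abs_triangle_ineq)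
          also have "\<dots> \<le> C' * M + C' * M"
          proof (rule add_mono)
            show "\<bar>s * (\<Sum>x\<in>T. e x * \<xi> x (p x))\<bar> \<le> C' * M" using eb[OF p] s by (simp add: abs_mult)
            show "\<bar>r * (\<Sum>x\<in>T. \<xi> x (p x))\<bar> \<le> C' * M"
              unfolding abs_mult using bound p r C' by (intro mult_mono) auto
          qed
          finally show "\<bar>\<Sum>x\<in>T1. c x * \<xi> x (p x)\<bar> \<le> 2 * C' * M" by (simp add: sumT1)
        qed
        show "lower_bound T1 (\<lambda>x P. c x * \<xi> x P) G (\<lambda>x. c x * h x)"
          unfolding lower_bound_def
        proof
          show "\<forall>T'\<subseteq>T1. card T' \<le> 2 ^ dim V \<longrightarrow> (\<exists>p. fld 1 p \<and> (\<forall>x\<in>T'. p x \<in> G x))"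
            using sel by (auto simp: T1_def)
          show "\<forall>x\<in>T1. \<forall>P\<in>G x. c x * h x \<le> c x * \<xi> x P"
            using h c(2) by (auto simp: T1_def intro!: mult_left_mono)
        qed
      qed
      then show ?thesis by (simp add: sumT1)
    qed
    have "(\<Sum>x\<in>T. ((- 1) * e x + e i) / w * h x) \<le> C * (2 * C' * M)"
      by (rule part[of _ "-1" "e i" i]) (use ile w e(4) i in auto)
    moreover have "(\<Sum>x\<in>T. (1 * e x + (- e j)) / w * h x) \<le> C * (2 * C' * M)"
      by (rule part[of _ 1 "- e j" j]) (use jle w e(4) j in auto)
    moreover have "(\<Sum>x\<in>T. h x) = (\<Sum>x\<in>T. ((- 1) * e x + e i) / w * h x) + (\<Sum>x\<in>T. (1 * e x + (- e j)) / w * h x)"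
    proof -
      have "((- 1) * e x + e i) / w * h x + (1 * e x + (- e j)) / w * h x = h x" for x
      proof -
        have "((- 1) * e x + e i) / w + (1 * e x + (- e j)) / w = 1"
          using w unfolding add_divide_distrib[symmetric] by (simp add: w_def)
        then show ?thesis by (simp only: distrib_right[symmetric] mult_1)
      qed
      then show ?thesis by (simp only: sum.distrib[symmetric])
    qed
    ultimately show ?thesis by (simp add: algebra_simps)
  qed
  moreover have "4 * (C * C') \<ge> 1" using CC by simp
  ultimately show ?case by blast
qed


section \<open>Interpolation and separation\<close>

lemma fld_sum:
  assumes "finite I" "I \<noteq> {}" "\<And>i. i \<in> I \<Longrightarrow> \<exists>M. fld M (f i)"
  shows "\<exists>M. fld M (\<lambda>x. \<Sum>i\<in>I. f i x)"
  using assms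
proof (induction I rule: finite_ne_induct)
  case (insert i I)
  then obtain M M' where "fld M (f i)" "fld M' (\<lambda>x. \<Sum>i\<in>I. f i x)" by (meson insertCI)
  from fld_add[OF this] show ?case using insert by auto
qed auto

text \<open>Combines bumps at the single point \<open>x0\<close>, at a scale not exceeding the
  distances to the other points. The norm is finite but not controlled.\<close>

lemma point_field:
  assumes S: "finite S" "x0 \<in> S" and P: "P \<in> V" and ne: "fld M0 p0"
  shows "\<exists>M p. fld M p \<and> p x0 = P \<and> (\<forall>y\<in>S - {x0}. p y = 0)"
proof -
  \<comment> \<open>Inserting 1 covers \<open>S = {x0}\<close> and ensures
    \<open>d \<le> 1\<close>.\<close>
  define d where "d = Min (insert 1 ((\<lambda>y. dist x0 y) ` (S - {x0})))"
  have "d \<in> insert 1 ((\<lambda>y. dist x0 y) ` (S - {x0}))" unfolding d_def using S by (intro Min_in) auto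
  then have d0: "d > 0" by auto
  have d1: "d \<le> 1" unfolding d_def using S by (intro Min_le) auto
  have dd: "d / real N \<le> dist x0 y" if "y \<in> S - {x0}" for y
  proof -
    have "d \<le> dist x0 y" unfolding d_def using S that by (intro Min_le) auto
    moreover have "d / real N \<le> d" using N d0 by (simp add: field_simps)
    ultimately show ?thesis by linarith
  qed
  have "\<exists>M p. fld M p \<and> p x0 = gen x0 d k \<and> (\<forall>y\<in>S - {x0}. p y = 0)" if "k \<in> Idx" for k
    using bump[of S "{x0}" x0 d k] S d0 d1 dd N that by auto
  then obtain Mk pk where pk: "\<And>k. k \<in> Idx \<Longrightarrow> fld (Mk k) (pk k)" "\<And>k. k \<in> Idx \<Longrightarrow> pk k x0 = gen x0 d k"
    "\<And>k y. k \<in> Idx \<Longrightarrow> y \<in> S - {x0} \<Longrightarrow> pk k y = 0" by metis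
  have "P \<in> span (gen x0 d ` Idx)" using gen_span[OF d0] P by blast
  then show ?thesis
  proof (induction rule: span_induct_alt)
    case base
    have "fld 0 (\<lambda>_. 0)" using fld_scale[OF ne, of 0] by simp
    then show ?case by blast
  next
    case (step c u P)
    then obtain k M p where k: "k \<in> Idx" "u = gen x0 d k" and p: "fld M p" "p x0 = P" "\<forall>y\<in>S - {x0}. p y = 0"
      by blast
    have "fld (\<bar>c\<bar> * Mk k + M) (\<lambda>x. c *\<^sub>R pk k x + p x)" using pk(1)[OF k(1)] p(1) by (intro fld_add fld_scale)
    then show ?case using pk(2,3)[OF k(1)] k(2) p(2,3)
      by (intro exI[of _ "\<bar>c\<bar> * Mk k + M"] exI[of _ "\<lambda>x. c *\<^sub>R pk k x + p x"]) auto
  qed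
qed

text \<open>Guarantees that the sublinear functional of the separation argument is finite on every
  family of polynomials.\<close>

lemma interpolation:
  assumes S: "finite S" and z: "\<forall>x\<in>S. z x \<in> V" and ne: "fld M0 p0"
  shows "\<exists>M p. 0 \<le> M \<and> fld M p \<and> (\<forall>x\<in>S. p x = z x)"
proof (cases "S = {}")
  case True
  then show ?thesis using fld_mono[OF ne, of "max M0 0"] by (intro exI[of _ "max M0 0"] exI[of _ p0]) auto
next
  case False
  have "\<exists>p. (\<exists>M. fld M p) \<and> p x = z x \<and> (\<forall>y\<in>S - {x}. p y = 0)" if "x \<in> S" for x
    using point_field[OF S that _ ne, of "z x"] z that by blast
  then obtain q where q: "\<And>x. x \<in> S \<Longrightarrow> \<exists>M. fld M (q x)" "\<And>x. x \<in> S \<Longrightarrow> q x x = z x"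
    "\<And>x y. x \<in> S \<Longrightarrow> y \<in> S - {x} \<Longrightarrow> q x y = 0" by metis
  obtain M where M: "fld M (\<lambda>y. \<Sum>x\<in>S. q x y)" using fld_sum[OF S False] q(1) by blast
  have "(\<Sum>x\<in>S. q x y) = z y" if "y \<in> S" for y
  proof -
    have "(\<Sum>x\<in>S. q x y) = q y y + (\<Sum>x\<in>S - {y}. q x y)" using S that by (rule sum.remove)
    also have "(\<Sum>x\<in>S - {y}. q x y) = 0" using q(3) that by (intro sum.neutral) auto
    finally show ?thesis using q(2)[OF that] by simp
  qed
  then show ?thesis using fld_mono[OF M, of "max M 0"]
    by (intro exI[of _ "max M 0"] exI[of _ "\<lambda>y. \<Sum>x\<in>S. q x y"]) auto
qed

text \<open>
  Hahn--Banach separation of the set of jet fields of norm at most \<open>\<gamma>\<close> from the product of the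
  target sets: the sublinear functional below is at most \<open>1\<close> on unit fields and at most
  \<open>- \<gamma>\<close> on the negatives of selections.
\<close>

lemma separating_functionals:
  assumes S: "finite S" and G: "\<And>x. x \<in> S \<Longrightarrow> G x \<subseteq> V" "\<And>x. x \<in> S \<Longrightarrow> convex (G x)" "\<And>x. x \<in> S \<Longrightarrow> G x \<noteq> {}"
    and \<gamma>: "\<gamma> \<ge> 0" and no: "\<not> (\<exists>p. fld \<gamma> p \<and> (\<forall>x\<in>S. p x \<in> G x))" and ne: "fld 1 p0"
  shows "\<exists>\<xi>. (\<forall>x\<in>S. \<xi> x \<in> dual) \<and> (\<forall>p. fld 1 p \<longrightarrow> \<bar>\<Sum>x\<in>S. \<xi> x (p x)\<bar> \<le> 1) \<and>
     (\<forall>k. (\<forall>x\<in>S. k x \<in> G x) \<longrightarrow> \<gamma> \<le> (\<Sum>x\<in>S. \<xi> x (k x)))"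
proof -
  define Z where "Z = {z :: 'a \<Rightarrow> 'v. (\<forall>x\<in>S. z x \<in> V) \<and> (\<forall>x. x \<notin> S \<longrightarrow> z x = 0)}"
  define sel where "sel k \<longleftrightarrow> (\<forall>x\<in>S. k x \<in> G x)" for k
  \<comment> \<open>A family \<open>z\<close> is written as a field of norm at most \<open>s\<close>
    minus \<open>t\<close> times a selection, at cost \<open>s - \<gamma> * t\<close>;
    \<open>p\<close> is the least cost.\<close>
  define R where "R z s t \<longleftrightarrow> s \<ge> 0 \<and> t \<ge> 0 \<and> (\<exists>q k. fld s q \<and> sel k \<and> (\<forall>x\<in>S. z x = q x - t *\<^sub>R k x))" for z s t
  define p where "p z = Inf {s - \<gamma> * t | s t. R z s t}" for z
  have "\<forall>x\<in>S. \<exists>P. P \<in> G x" using G(3) by blast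
  from bchoice[OF this] obtain k0 where k0: "sel k0" unfolding sel_def ..
  have fld0: "fld 0 (\<lambda>_. 0)" using fld_scale[OF ne, of 0] by simp
  have Z: "subspace Z"
    using V_subspace unfolding Z_def subspace_def by (auto simp: plus_fun_def scaleR_fun_def)
  have ex: "\<exists>s. R z s 0" if "z \<in> Z" for z
  proof -
    have "\<forall>x\<in>S. z x \<in> V" using that by (simp add: Z_def)
    from interpolation[OF S this ne] obtain M q where "0 \<le> M" "fld M q" "\<forall>x\<in>S. q x = z x" by blast
    then have "R z M 0" unfolding R_def using k0 by (intro conjI exI[of _ q] exI[of _ k0]) auto
    then show ?thesis by blast
  qed
  \<comment> \<open>If 0 had a negative cost, \<open>q\<close> would be \<open>t\<close> times a
    selection, and dividing by \<open>t\<close> would give a field of norm at most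
    \<open>\<gamma>\<close> with values in all \<open>G x\<close>, against
    \<open>no\<close>.\<close>
  have nonneg: "s - \<gamma> * t \<ge> 0" if Rz: "R z s t" and z0: "\<forall>x\<in>S. z x = 0" for z s t
  proof (rule ccontr)
    assume "\<not> ?thesis"
    obtain q k where *: "s \<ge> 0" "t \<ge> 0" "fld s q" "sel k" "\<forall>x\<in>S. z x = q x - t *\<^sub>R k x"
      using Rz unfolding R_def by blast
    have t: "t > 0" using \<open>\<not> 0 \<le> s - \<gamma> * t\<close> * by (cases "t = 0") auto
    have "fld (\<bar>1 / t\<bar> * s) (\<lambda>x. (1 / t) *\<^sub>R q x)" by (rule fld_scale[OF *(3)])
    moreover have "\<bar>1 / t\<bar> * s \<le> \<gamma>" using t \<open>\<not> 0 \<le> s - \<gamma> * t\<close> by (simp add: field_simps)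
    ultimately have "fld \<gamma> (\<lambda>x. (1 / t) *\<^sub>R q x)" by (rule fld_mono)
    moreover have "(1 / t) *\<^sub>R q x = k x" if "x \<in> S" for x
    proof -
      have "q x = t *\<^sub>R k x" using *(5) z0 that by simp
      then show ?thesis using t by simp
    qed
    ultimately show False using no *(4) by (auto simp: sel_def)
  qed
  have R_add: "R (z + z') (s + s') (t + t')" if R1: "R z s t" and R2: "R z' s' t'" for z z' s s' t t'
  proof -
    obtain q k where 1: "s \<ge> 0" "t \<ge> 0" "fld s q" "sel k" "\<forall>x\<in>S. z x = q x - t *\<^sub>R k x"
      using R1 unfolding R_def by blast
    obtain q' k' where 2: "s' \<ge> 0" "t' \<ge> 0" "fld s' q'" "sel k'" "\<forall>x\<in>S. z' x = q' x - t' *\<^sub>R k' x"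
      using R2 unfolding R_def by blast
    \<comment> \<open>Convexity of the \<open>G x\<close> enters here: the average of two selections
      with weights proportional to \<open>t\<close> and \<open>t'\<close> is a selection. If both
      are 0, any selection serves.\<close>
    obtain k'' where k'': "sel k''" "\<forall>x\<in>S. (t + t') *\<^sub>R k'' x = t *\<^sub>R k x + t' *\<^sub>R k' x"
    proof (cases "t + t' = 0")
      case True
      then have "t = 0" "t' = 0" using 1(2) 2(2) by auto
      then show ?thesis using that[of k] 1(4) by simp
    next
      case False
      define u where "u = t / (t + t')"
      have u: "u \<ge> 0" "t' / (t + t') \<ge> 0" "u + t' / (t + t') = 1"
        using False 1(2) 2(2) by (auto simp: u_def add_divide_distrib[symmetric])
      have "sel (\<lambda>x. u *\<^sub>R k x + (t' / (t + t')) *\<^sub>R k' x)"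
        unfolding sel_def
      proof
        fix x assume x: "x \<in> S"
        show "u *\<^sub>R k x + (t' / (t + t')) *\<^sub>R k' x \<in> G x"
          using G(2)[OF x] 1(4) 2(4) x u by (intro convexD) (auto simp: sel_def)
      qed
      moreover have "(t + t') *\<^sub>R (u *\<^sub>R k x + (t' / (t + t')) *\<^sub>R k' x) = t *\<^sub>R k x + t' *\<^sub>R k' x" for x
        using False by (simp add: u_def scaleR_add_right)
      ultimately show ?thesis by (intro that) auto
    qed
    have "fld (s + s') (\<lambda>x. q x + q' x)" using 1(3) 2(3) by (rule fld_add)
    moreover have "\<forall>x\<in>S. (z + z') x = (q x + q' x) - (t + t') *\<^sub>R k'' x"
      using k''(2) 1(5) 2(5) by (simp add: plus_fun_def)
    ultimately show ?thesis
      unfolding R_def using 1(1,2) 2(1,2) k''(1) by (intro conjI exI[of _ "\<lambda>x. q x + q' x"] exI[of _ k'']) auto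
  qed
  have R_scale: "R (c *\<^sub>R z) (c * s) (c * t)" if Rz: "R z s t" and c: "c \<ge> 0" for z s t c
  proof -
    obtain q k where 1: "s \<ge> 0" "t \<ge> 0" "fld s q" "sel k" "\<forall>x\<in>S. z x = q x - t *\<^sub>R k x"
      using Rz unfolding R_def by blast
    have "fld (c * s) (\<lambda>x. c *\<^sub>R q x)" using fld_scale[OF 1(3), of c] c by simp
    moreover have "\<forall>x\<in>S. (c *\<^sub>R z) x = c *\<^sub>R q x - (c * t) *\<^sub>R k x"
      using 1(5) by (simp add: scaleR_fun_def scaleR_diff_right)
    ultimately show ?thesis
      unfolding R_def using 1(1,2,4) c by (intro conjI exI[of _ "\<lambda>x. c *\<^sub>R q x"] exI[of _ k]) auto
  qed
  have bdd: "\<exists>b. \<forall>s t. R z s t \<longrightarrow> b \<le> s - \<gamma> * t" if z: "z \<in> Z" for z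
  proof -
    \<comment> \<open>By interpolation \<open>- z\<close> has a representation with
      \<open>t = 0\<close>; adding it to any representation of \<open>z\<close> represents 0, which
      bounds the cost below.\<close>
    obtain s' where s': "R ((-1) *\<^sub>R z) s' 0" using ex subspace_scale[OF Z z] by blast
    have "- s' \<le> s - \<gamma> * t" if "R z s t" for s t
      using nonneg[OF R_add[OF that s']] by (simp add: plus_fun_def scaleR_fun_def)
    then show ?thesis by blast
  qed
  have p_le: "p z \<le> s - \<gamma> * t" if "z \<in> Z" "R z s t" for z s t
    unfolding p_def using bdd[OF that(1)] that(2) by (intro cInf_lower) (auto simp: bdd_below_def)
  have p_ge: "b \<le> p z" if "z \<in> Z" "\<And>s t. R z s t \<Longrightarrow> b \<le> s - \<gamma> * t" for z b
    unfolding p_def using ex[OF that(1)] that(2) by (intro cInf_greatest) auto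
  have p_add: "p (z + z') \<le> p z + p z'" if z: "z \<in> Z" "z' \<in> Z" for z z'
  proof -
    have zz: "z + z' \<in> Z" using Z z by (rule subspace_add)
    have "p (z + z') - (s - \<gamma> * t) \<le> p z'" if "R z s t" for s t
    proof (rule p_ge[OF z(2)])
      fix s' t' assume "R z' s' t'"
      from p_le[OF zz R_add[OF that this]]
      show "p (z + z') - (s - \<gamma> * t) \<le> s' - \<gamma> * t'" by (simp add: algebra_simps)
    qed
    then have "p (z + z') - p z' \<le> p z" by (intro p_ge[OF z(1)]) (simp add: algebra_simps)
    then show ?thesis by simp
  qed
  have p0: "p 0 = 0"
  proof (rule antisym)
    have Z0: "0 \<in> Z" using Z by (rule subspace_0)
    have "R 0 0 0" using fld0 k0 unfolding R_def by auto
    then show "p 0 \<le> 0" using p_le[OF Z0] by force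
    show "0 \<le> p 0" by (rule p_ge[OF Z0]) (rule nonneg, auto)
  qed
  have p_scale': "p (c *\<^sub>R z) \<le> c * p z" if z: "z \<in> Z" and c: "c > 0" for z c
  proof -
    have "p (c *\<^sub>R z) / c \<le> p z"
    proof (rule p_ge[OF z])
      fix s t assume "R z s t"
      from p_le[OF subspace_scale[OF Z z] R_scale[OF this]] c
      have "p (c *\<^sub>R z) \<le> c * s - \<gamma> * (c * t)" by simp
      also have "\<dots> = c * (s - \<gamma> * t)" by (simp add: algebra_simps)
      finally show "p (c *\<^sub>R z) / c \<le> s - \<gamma> * t" using c by (simp add: field_simps)
    qed
    then show ?thesis using c by (simp add: field_simps)
  qed
  have p_scale: "p (c *\<^sub>R z) = c * p z" if z: "z \<in> Z" and c: "c \<ge> 0" for z c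
  proof (cases "c = 0")
    case False
    then have c0: "c > 0" using c by simp
    have "p z \<le> (1 / c) * p (c *\<^sub>R z)"
      using p_scale'[of "c *\<^sub>R z" "1 / c"] c0 subspace_scale[OF Z z] by simp
    then have "c * p z \<le> p (c *\<^sub>R z)" using c0 by (simp add: field_simps)
    then show ?thesis using p_scale'[OF z c0] by linarith
  qed (use p0 in simp)
  have sub: "sublinear_on Z p" unfolding sublinear_on_def using p_add p_scale by blast
  \<comment> \<open>Families supported at one point; the values of the dominated linear functional
    on them give the functionals \<open>\<xi> x\<close>.\<close>
  define \<delta> where "\<delta> x P = (\<lambda>y. if y = x then P else 0)" for x :: 'a and P :: 'v
  obtain Bv where Bv: "finite Bv" "V = span Bv" using V_fin by blast
  define B where "B = (\<lambda>(x, b). \<delta> x b) ` (S \<times> Bv)"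
  have BvV: "Bv \<subseteq> V" unfolding Bv(2) by (rule span_superset)
  have \<delta>Z: "\<delta> x P \<in> Z" if "x \<in> S" "P \<in> V" for x P
    using that V_subspace by (auto simp: \<delta>_def Z_def subspace_0)
  have \<delta>lin: "linear (\<delta> x)" for x
    by (rule linearI) (auto simp: \<delta>_def fun_eq_iff plus_fun_def scaleR_fun_def)
  have expand: "z = (\<Sum>x\<in>S. \<delta> x (z x))" if "z \<in> Z" for z
  proof
    fix y
    show "z y = (\<Sum>x\<in>S. \<delta> x (z x)) y"
      using that S by (cases "y \<in> S") (auto simp: sum_fun_apply \<delta>_def Z_def sum.delta')
  qed
  have "Z \<subseteq> span B"
  proof
    fix z assume z: "z \<in> Z"
    have "\<delta> x (z x) \<in> span B" if x: "x \<in> S" for x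
    proof -
      have "z x \<in> span Bv" using z x by (auto simp: Z_def Bv(2))
      then have "\<delta> x (z x) \<in> span (\<delta> x ` Bv)" using linear_span_image[OF \<delta>lin, of x Bv] by blast
      also have "\<dots> \<subseteq> span B" using x by (intro span_mono) (auto simp: B_def)
      finally show ?thesis .
    qed
    then have "(\<Sum>x\<in>S. \<delta> x (z x)) \<in> span B" by (rule span_sum)
    then show "z \<in> span B" using expand[OF z] by simp
  qed
  moreover have "finite B" "B \<subseteq> Z" using S Bv(1) BvV \<delta>Z by (auto simp: B_def)
  ultimately obtain f where f: "\<And>x y. x \<in> Z \<Longrightarrow> y \<in> Z \<Longrightarrow> f (x + y) = f x + f y"
    "\<And>c x. x \<in> Z \<Longrightarrow> f (c *\<^sub>R x) = c * f x" "\<And>x. x \<in> Z \<Longrightarrow> f x \<le> p x"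
    using sublinear_on_dominates_linear[OF Z sub] by blast
  define \<xi> where "\<xi> x P = (if P \<in> V then f (\<delta> x P) else 0)" for x P
  have \<xi>dual: "\<xi> x \<in> dual" if x: "x \<in> S" for x
    unfolding dual_def
    using V_subspace f(1,2) \<delta>Z[OF x] by (auto simp: \<xi>_def linear_add[OF \<delta>lin] linear_scale[OF \<delta>lin] subspace_add subspace_scale)
  have f0: "f 0 = 0" using f(2)[of 0 0] Z by (simp add: subspace_0)
  have fsum: "f (\<Sum>x\<in>T. \<delta> x (z x)) = (\<Sum>x\<in>T. \<xi> x (z x))" if "T \<subseteq> S" "\<forall>x\<in>S. z x \<in> V" for T z
    using finite_subset[OF that(1) S] that(1)
  proof (induction T)
    case empty
    then show ?case by (simp only: sum.empty f0)
  next
    case (insert x T)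
    have "(\<Sum>x\<in>T. \<delta> x (z x)) \<in> Z" using \<delta>Z that(2) insert.prems by (intro subspace_sum[OF Z]) auto
    moreover have "\<delta> x (z x) \<in> Z" using \<delta>Z that(2) insert.prems by auto
    ultimately have "f (\<delta> x (z x) + (\<Sum>x\<in>T. \<delta> x (z x))) = f (\<delta> x (z x)) + f (\<Sum>x\<in>T. \<delta> x (z x))" by (intro f)
    moreover have "f (\<delta> x (z x)) = \<xi> x (z x)" using insert.prems that(2) by (auto simp: \<xi>_def)
    moreover have "f (\<Sum>x\<in>T. \<delta> x (z x)) = (\<Sum>x\<in>T. \<xi> x (z x))" using insert by blast
    ultimately show ?case unfolding sum.insert[OF insert.hyps] by (simp only:)
  qed
  have fle: "(\<Sum>x\<in>S. \<xi> x (z x)) \<le> s - \<gamma> * t" if z: "\<forall>x\<in>S. z x \<in> V" and R: "R z s t" for z s t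
  proof -
    define z' where "z' x = (if x \<in> S then z x else 0)" for x
    have z': "z' \<in> Z" using z by (auto simp: Z_def z'_def)
    have "R z' s t" using R by (auto simp: R_def z'_def)
    have "(\<Sum>x\<in>S. \<xi> x (z x)) = (\<Sum>x\<in>S. \<xi> x (z' x))" by (rule sum.cong) (auto simp: z'_def)
    also have "\<dots> = f z'" using fsum[of S z'] expand[OF z'] z' by (simp add: Z_def)
    also have "\<dots> \<le> s - \<gamma> * t" using f(3)[OF z'] p_le[OF z' \<open>R z' s t\<close>] by linarith
    finally show ?thesis .
  qed
  have up: "(\<Sum>x\<in>S. \<xi> x (q x)) \<le> 1" if q: "fld 1 q" for q
    using fle[of q 1 0] fld_in[OF q] q k0 by (auto simp: R_def)
  show ?thesis
  proof (intro exI[of _ \<xi>] conjI ballI allI impI)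
    show "\<bar>\<Sum>x\<in>S. \<xi> x (q x)\<bar> \<le> 1" if q: "fld 1 q" for q
    proof -
      have "fld 1 (\<lambda>x. (-1) *\<^sub>R q x)" using fld_scale[OF q, of "-1"] by simp
      from up[OF this] have "(\<Sum>x\<in>S. \<xi> x ((-1) *\<^sub>R q x)) \<le> 1" .
      also have "(\<Sum>x\<in>S. \<xi> x ((-1) *\<^sub>R q x)) = (\<Sum>x\<in>S. (-1) * \<xi> x (q x))"
        by (rule sum.cong[OF refl]) (rule dual_scale[OF \<xi>dual fld_in[OF q]])
      also have "\<dots> = - (\<Sum>x\<in>S. \<xi> x (q x))" by (simp add: sum_negf)
      finally show ?thesis using up[OF q] by linarith
    qed
    show "\<gamma> \<le> (\<Sum>x\<in>S. \<xi> x (k x))" if k: "\<forall>x\<in>S. k x \<in> G x" for k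
    proof -
      have kV: "k x \<in> V" if "x \<in> S" for x using k G(1)[OF that] that by blast
      \<comment> \<open>The negative of a selection has a representation with \<open>s = 0\<close>
        and \<open>t = 1\<close>, at cost \<open>- \<gamma>\<close>.\<close>
      have "R (\<lambda>x. (-1) *\<^sub>R k x) 0 1"
        unfolding R_def using fld0 k by (intro conjI exI[of _ "\<lambda>_. 0"] exI[of _ k]) (auto simp: sel_def)
      then have "(\<Sum>x\<in>S. \<xi> x ((-1) *\<^sub>R k x)) \<le> 0 - \<gamma> * 1"
        using kV subspace_neg[OF V_subspace] by (intro fle) auto
      also have "(\<Sum>x\<in>S. \<xi> x ((-1) *\<^sub>R k x)) = (\<Sum>x\<in>S. (-1) * \<xi> x (k x))"
        by (rule sum.cong[OF refl]) (rule dual_scale[OF \<xi>dual kV])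
      also have "\<dots> = - (\<Sum>x\<in>S. \<xi> x (k x))" by (simp add: sum_negf)
      finally show ?thesis by simp
    qed
  qed (use \<xi>dual in auto)
qed

theorem finiteness_principle:
  "\<exists>\<gamma>\<ge>0. \<forall>S G. finite S \<longrightarrow> card S \<le> N \<longrightarrow> (\<forall>x\<in>S. \<forall>y\<in>S. dist x y \<le> 1) \<longrightarrow>
     (\<forall>x\<in>S. G x \<subseteq> V \<and> convex (G x)) \<longrightarrow>
     (\<forall>S'\<subseteq>S. card S' \<le> 2 ^ dim V \<longrightarrow> (\<exists>p. fld 1 p \<and> (\<forall>x\<in>S'. p x \<in> G x))) \<longrightarrow>
     (\<exists>p. fld \<gamma> p \<and> (\<forall>x\<in>S. p x \<in> G x))"
proof -
  obtain C where C: "C \<ge> 1" and lb: "\<And>T \<xi> h M G. admissible T \<xi> M \<Longrightarrow> card T \<le> N \<Longrightarrow> M > 0 \<Longrightarrow>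
     lower_bound T \<xi> G h \<Longrightarrow> (\<Sum>x\<in>T. h x) \<le> C * M" using sum_lower_bound_le[of N] by blast
  \<comment> \<open>The margin 1 over the bound for sums of infima absorbs the error 1/2 made when
    infima are replaced by values.\<close>
  define \<gamma> where "\<gamma> = C + 1"
  have "\<exists>p. fld \<gamma> p \<and> (\<forall>x\<in>S. p x \<in> G x)"
    if S: "finite S" "card S \<le> N" "\<forall>x\<in>S. \<forall>y\<in>S. dist x y \<le> 1" and G: "\<forall>x\<in>S. G x \<subseteq> V \<and> convex (G x)"
      and sel: "\<forall>S'\<subseteq>S. card S' \<le> 2 ^ dim V \<longrightarrow> (\<exists>p. fld 1 p \<and> (\<forall>x\<in>S'. p x \<in> G x))" for S G
  proof (rule ccontr)
    assume no: "\<not> ?thesis"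
    have Gne: "G x \<noteq> {}" if "x \<in> S" for x
      using sel[rule_format, of "{x}"] that by auto
    obtain p0 where p0: "fld 1 p0" using sel[rule_format, of "{}"] by auto
    obtain \<xi> where \<xi>: "\<forall>x\<in>S. \<xi> x \<in> dual" "\<forall>p. fld 1 p \<longrightarrow> \<bar>\<Sum>x\<in>S. \<xi> x (p x)\<bar> \<le> 1"
      "\<And>k. \<forall>x\<in>S. k x \<in> G x \<Longrightarrow> \<gamma> \<le> (\<Sum>x\<in>S. \<xi> x (k x))"
      using separating_functionals[OF S(1) _ _ Gne _ no p0] G C unfolding \<gamma>_def by force
    define h where "h x = Inf (\<xi> x ` G x)" for x
    have "\<forall>x\<in>S. \<exists>P. P \<in> G x" using Gne by blast
    from bchoice[OF this] obtain k0 where k0: "\<forall>x\<in>S. k0 x \<in> G x" ..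
    \<comment> \<open>Changing a fixed selection at \<open>x\<close> alone and applying the
      separation bounds \<open>\<xi> x\<close> from below on \<open>G x\<close>, so the infimum is
      genuine.\<close>
    have bdd: "bdd_below (\<xi> x ` G x)" if x: "x \<in> S" for x
    proof (rule bdd_belowI2)
      fix P assume P: "P \<in> G x"
      have "\<gamma> \<le> (\<Sum>y\<in>S. \<xi> y ((k0(x := P)) y))" using k0 P by (intro \<xi>(3)) auto
      also have "\<dots> = \<xi> x P + (\<Sum>y\<in>S - {x}. \<xi> y (k0 y))"
        using S(1) x by (subst sum.remove[of S x]) (auto intro!: sum.cong)
      finally show "\<gamma> - (\<Sum>y\<in>S - {x}. \<xi> y (k0 y)) \<le> \<xi> x P" by simp
    qed
    have "h x \<le> \<xi> x P" if "x \<in> S" "P \<in> G x" for x P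
      unfolding h_def using that bdd by (intro cInf_lower) auto
    then have "lower_bound S \<xi> G h" unfolding lower_bound_def using sel by blast
    moreover have "admissible S \<xi> 1" unfolding admissible_def using S \<xi>(1,2) by blast
    ultimately have "(\<Sum>x\<in>S. h x) \<le> C * 1" by (intro lb S) auto
    moreover have "\<gamma> \<le> (\<Sum>x\<in>S. h x) + \<epsilon>" if "\<epsilon> > 0" for \<epsilon>
    proof -
      define \<eta> where "\<eta> = \<epsilon> / (real (card S) + 1)"
      have \<eta>: "\<eta> > 0" using that by (simp add: \<eta>_def)
      have "\<exists>P\<in>G x. \<xi> x P < h x + \<eta>" if x: "x \<in> S" for x
      proof -
        have "Inf (\<xi> x ` G x) < h x + \<eta>" using \<eta> by (simp add: h_def)
        then show ?thesis using cInf_lessD[of "\<xi> x ` G x"] Gne[OF x] by blast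
      qed
      then obtain k where k: "\<And>x. x \<in> S \<Longrightarrow> k x \<in> G x \<and> \<xi> x (k x) < h x + \<eta>" by metis
      then have "\<gamma> \<le> (\<Sum>x\<in>S. \<xi> x (k x))" by (intro \<xi>(3)) auto
      also have "\<dots> \<le> (\<Sum>x\<in>S. h x + \<eta>)" using k by (intro sum_mono) (meson less_imp_le)
      also have "\<dots> = (\<Sum>x\<in>S. h x) + real (card S) * \<eta>" by (simp add: sum.distrib)
      also have "real (card S) * \<eta> \<le> \<epsilon>" using that by (simp add: \<eta>_def field_simps)
      finally show ?thesis by simp
    qed
    from this[of "1/2"] have "\<gamma> \<le> (\<Sum>x\<in>S. h x) + 1/2" by simp
    ultimately show False by (simp add: \<gamma>_def)
  qed
  moreover have "\<gamma> \<ge> 0" using C by (simp add: \<gamma>_def)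
  ultimately show ?thesis by blast
qed

end

subsection \<open>Partial derivatives\<close>

lemma has_field_derivative_partial:
  assumes "f differentiable (at (c + t *\<^sub>R axis i 1))"
  shows "((\<lambda>t. f (c + t *\<^sub>R axis i 1)) has_field_derivative partial_deriv i f (c + t *\<^sub>R axis i 1)) (at t)"
proof -
  obtain D where D: "(f has_derivative D) (at (c + t *\<^sub>R axis i 1))"
    using assms by (auto simp: differentiable_def)
  then interpret D: bounded_linear D by (rule has_derivative_bounded_linear)
  have *: "((\<lambda>s. f (y + s *\<^sub>R axis i 1)) has_field_derivative D (axis i 1)) (at r)"
    if "c + t *\<^sub>R axis i 1 = y + r *\<^sub>R axis i 1" for y r
  proof -
    have "((\<lambda>s. f (y + s *\<^sub>R axis i 1)) has_derivative (\<lambda>s. D (s *\<^sub>R axis i 1))) (at r)"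
      using D that by (auto intro!: derivative_eq_intros has_derivative_compose[of "\<lambda>s. y + s *\<^sub>R axis i 1" _ _ _ f])
    then show ?thesis by (simp add: has_field_derivative_def D.scaleR mult_commute_abs)
  qed
  have "partial_deriv i f (c + t *\<^sub>R axis i 1) = D (axis i 1)"
    unfolding partial_deriv_def by (rule DERIV_imp_deriv) (rule *, simp)
  with * show ?thesis by simp
qed

lemma partial_deriv_eq:
  assumes "(f has_derivative D) (at x)"
  shows "partial_deriv i f x = D (axis i 1)"
proof -
  interpret D: bounded_linear D using assms by (rule has_derivative_bounded_linear)
  have "((\<lambda>s. f (x + s *\<^sub>R axis i 1)) has_derivative (\<lambda>s. D (s *\<^sub>R axis i 1))) (at 0)"
    using assms by (auto intro!: derivative_eq_intros has_derivative_compose[of "\<lambda>s. x + s *\<^sub>R axis i 1" _ _ _ f])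
  then have "((\<lambda>s. f (x + s *\<^sub>R axis i 1)) has_field_derivative D (axis i 1)) (at 0)"
    by (simp add: has_field_derivative_def D.scaleR mult_commute_abs)
  then show ?thesis unfolding partial_deriv_def by (rule DERIV_imp_deriv)
qed

lemma has_derivative_partials:
  fixes f :: "real^'n \<Rightarrow> real"
  assumes "f differentiable (at x)"
  shows "(f has_derivative (\<lambda>h. \<Sum>i\<in>UNIV. h $ i * partial_deriv i f x)) (at x)"
proof -
  obtain D where D: "(f has_derivative D) (at x)"
    using assms by (auto simp: differentiable_def)
  then interpret D: bounded_linear D by (rule has_derivative_bounded_linear)
  have "D = (\<lambda>h. \<Sum>i\<in>UNIV. h $ i * partial_deriv i f x)"
  proof
    fix h :: "real^'n"
    have "(\<Sum>i\<in>UNIV. (h $ i) *\<^sub>R axis i 1) = h"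
      using basis_expansion[of h] by (simp add: scalar_mult_eq_scaleR)
    then have "D h = D (\<Sum>i\<in>UNIV. (h $ i) *\<^sub>R axis i 1)" by simp
    then show "D h = (\<Sum>i\<in>UNIV. h $ i * partial_deriv i f x)"
      by (simp add: D.sum D.scaleR partial_deriv_eq[OF D])
  qed
  with D show ?thesis by simp
qed

lemma sum_axis_mult: "(\<Sum>k\<in>UNIV. axis i (1::real) $ k * g k) = g i"
  by (simp add: axis_def if_distrib[of "\<lambda>z. z * _"] cong: if_cong)

lemma partial_deriv_add:
  assumes "\<And>x. f differentiable (at x)" "\<And>x. g differentiable (at x)"
  shows "partial_deriv i (\<lambda>x. f x + g x) = (\<lambda>x. partial_deriv i f x + partial_deriv i g x)"
proof
  fix x
  obtain D E where "(f has_derivative D) (at x)" "(g has_derivative E) (at x)"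
    using assms by (meson differentiable_def)
  note * = this has_derivative_add[OF this]
  show "partial_deriv i (\<lambda>x. f x + g x) x = partial_deriv i f x + partial_deriv i g x"
    by (simp add: *[THEN partial_deriv_eq])
qed

lemma partial_deriv_mult:
  assumes "\<And>x. f differentiable (at x)" "\<And>x. g differentiable (at x)"
  shows "partial_deriv i (\<lambda>x. f x * g x) = (\<lambda>x. partial_deriv i f x * g x + f x * partial_deriv i g x)"
proof
  fix x
  obtain D E where "(f has_derivative D) (at x)" "(g has_derivative E) (at x)"
    using assms by (meson differentiable_def)
  note * = this has_derivative_mult[OF this]
  show "partial_deriv i (\<lambda>x. f x * g x) x = partial_deriv i f x * g x + f x * partial_deriv i g x"
    by (simp add: *[THEN partial_deriv_eq])
qed

lemma partial_deriv_const [simp]: "partial_deriv i (\<lambda>_. c) = (\<lambda>_. 0)"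
  by (simp add: partial_deriv_def fun_eq_iff)

lemma partial_deriv_coord: "partial_deriv i (\<lambda>x::real^'n. x $ j) = (\<lambda>_. of_bool (i = j))"
proof
  fix x :: "real^'n"
  have "((\<lambda>x. x $ j) has_derivative (\<lambda>h. h $ j)) (at x)"
    by (rule bounded_linear_imp_has_derivative) (rule bounded_linear_vec_nth)
  then show "partial_deriv i (\<lambda>x. x $ j) x = of_bool (i = j)"
    by (simp add: partial_deriv_eq axis_def)
qed

lemma partial_deriv_scale:
  assumes "\<And>x. f differentiable (at x)"
  shows "partial_deriv i (\<lambda>y. f (s *\<^sub>R (y - z))) = (\<lambda>y. s * partial_deriv i f (s *\<^sub>R (y - z)))"
proof
  fix y
  obtain D where D: "(f has_derivative D) (at (s *\<^sub>R (y - z)))"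
    using assms by (meson differentiable_def)
  then interpret D: bounded_linear D by (rule has_derivative_bounded_linear)
  have "((\<lambda>y. f (s *\<^sub>R (y - z))) has_derivative (\<lambda>h. D (s *\<^sub>R h))) (at y)"
    using D by (auto intro!: derivative_eq_intros has_derivative_compose[of "\<lambda>y. s *\<^sub>R (y - z)" _ _ _ f])
  then show "partial_deriv i (\<lambda>y. f (s *\<^sub>R (y - z))) y = s * partial_deriv i f (s *\<^sub>R (y - z))"
    by (simp add: partial_deriv_eq[OF D] partial_deriv_eq D.scaleR)
qed

section \<open>Closure properties of the class C^k\<close>

lemma cont_diff_Suc_imp: "cont_diff (Suc k) f \<Longrightarrow> cont_diff k f"
proof (induction k arbitrary: f)
  case 0
  then show ?case
    by (auto intro!: continuous_at_imp_continuous_on differentiable_imp_continuous_within)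
qed auto

lemma cont_diff_mono: "cont_diff k f \<Longrightarrow> j \<le> k \<Longrightarrow> cont_diff j f"
  by (induction k) (auto simp del: cont_diff.simps(2) simp: le_Suc_eq dest: cont_diff_Suc_imp)

lemma cont_diff_const [simp]: "cont_diff k (\<lambda>_. c)"
  by (induction k arbitrary: c) auto

lemma cont_diff_coord: "cont_diff k (\<lambda>x. x $ j)"
proof (cases k)
  case 0
  then show ?thesis by (auto intro!: continuous_intros)
next
  case (Suc l)
  then show ?thesis
    by (auto simp: partial_deriv_coord intro!: bounded_linear_imp_differentiable bounded_linear_vec_nth)
qed

lemma cont_diff_add: "cont_diff k f \<Longrightarrow> cont_diff k g \<Longrightarrow> cont_diff k (\<lambda>x. f x + g x)"
proof (induction k arbitrary: f g)
  case 0
  then show ?case by (auto intro!: continuous_intros)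
next
  case (Suc k)
  then show ?case by (simp add: partial_deriv_add)
qed

lemma cont_diff_mult: "cont_diff k f \<Longrightarrow> cont_diff k g \<Longrightarrow> cont_diff k (\<lambda>x. f x * g x)"
proof (induction k arbitrary: f g)
  case 0
  then show ?case by (auto intro!: continuous_intros)
next
  case (Suc k)
  then have "cont_diff k f" "cont_diff k g" using cont_diff_Suc_imp by blast+
  with Suc show ?case by (auto simp: partial_deriv_mult intro!: cont_diff_add)
qed

lemma cont_diff_cmult: "cont_diff k f \<Longrightarrow> cont_diff k (\<lambda>x. c * f x)"
  by (intro cont_diff_mult) auto

lemma cont_diff_diff: "cont_diff k f \<Longrightarrow> cont_diff k g \<Longrightarrow> cont_diff k (\<lambda>x. f x - g x)"
  using cont_diff_add[of k f "\<lambda>x. (-1) * g x"] cont_diff_cmult[of k g "-1"] by simp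

lemma cont_diff_sum: "(\<And>i. i \<in> I \<Longrightarrow> cont_diff k (f i)) \<Longrightarrow> cont_diff k (\<lambda>x. \<Sum>i\<in>I. f i x)"
  by (induction I rule: infinite_finite_induct) (auto intro: cont_diff_add)

lemma cont_diff_prod: "(\<And>i. i \<in> I \<Longrightarrow> cont_diff k (f i)) \<Longrightarrow> cont_diff k (\<lambda>x. \<Prod>i\<in>I. f i x)"
  by (induction I rule: infinite_finite_induct) (auto intro: cont_diff_mult)

lemma cont_diff_power: "cont_diff k f \<Longrightarrow> cont_diff k (\<lambda>x. f x ^ n)"
  by (induction n) (auto intro: cont_diff_mult)

lemma cont_diff_scale: "cont_diff k f \<Longrightarrow> cont_diff k (\<lambda>y. f (s *\<^sub>R (y - z)))"
proof (induction k arbitrary: f)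
  case 0
  then show ?case by (auto intro!: continuous_intros continuous_on_compose2[of UNIV f])
next
  case (Suc k)
  have "(\<lambda>y. f (s *\<^sub>R (y - z))) differentiable (at x)" for x
    by (rule differentiable_compose[of f "\<lambda>y. s *\<^sub>R (y - z)"]) (use Suc.prems in auto)
  with Suc show ?case by (simp add: partial_deriv_scale cont_diff_cmult)
qed

lemma has_field_derivative_pos_part_power:
  "((\<lambda>t::real. max 0 t ^ Suc (Suc k)) has_field_derivative (real (Suc (Suc k)) * max 0 t ^ Suc k)) (at t)"
proof -
  consider "t < 0" | "t > 0" | "t = 0" by linarith
  then show ?thesis
  proof cases
    case 1
    have "((\<lambda>t::real. 0) has_field_derivative 0) (at t)" by simp
    then have "((\<lambda>t::real. max 0 t ^ Suc (Suc k)) has_field_derivative 0) (at t)"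
      by (rule has_field_derivative_transform_within_open[of _ _ _ "{..<0}"]) (use 1 in auto)
    then show ?thesis using 1 by simp
  next
    case 2
    have "((\<lambda>t::real. t ^ Suc (Suc k)) has_field_derivative (real (Suc (Suc k)) * t ^ Suc k)) (at t)"
      using DERIV_pow[of "Suc (Suc k)" t] by simp
    then have "((\<lambda>t::real. max 0 t ^ Suc (Suc k)) has_field_derivative (real (Suc (Suc k)) * t ^ Suc k)) (at t)"
      by (rule has_field_derivative_transform_within_open[of _ _ _ "{0<..}"]) (use 2 in auto)
    then show ?thesis using 2 by simp
  next
    case 3
    \<comment> \<open>At the kink the difference quotient is \<open>max 0 h ^ Suc k\<close>, which
      tends to 0.\<close>
    have "((\<lambda>h::real. max 0 h ^ Suc k) \<longlongrightarrow> max 0 0 ^ Suc k) (at 0)"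
      by (intro tendsto_intros)
    then have "((\<lambda>h::real. max 0 h ^ Suc k) \<longlongrightarrow> 0) (at 0)" by simp
    moreover have "eventually (\<lambda>h::real. max 0 h ^ Suc k = max 0 h ^ Suc (Suc k) / h) (at 0)"
      by (auto simp: eventually_at_filter max_def)
    ultimately have "((\<lambda>h::real. max 0 h ^ Suc (Suc k) / h) \<longlongrightarrow> 0) (at 0)"
      by (rule Lim_transform_eventually)
    then show ?thesis using 3 by (simp add: DERIV_def)
  qed
qed

text \<open>Source of the cutoff functions: class C^k suffices for them, and the exponent
  \<open>Suc k\<close> provides it, since each differentiation lowers the exponent by one.\<close>

lemma cont_diff_pos_part_power: "cont_diff k f \<Longrightarrow> cont_diff k (\<lambda>x. max 0 (f x) ^ Suc k)"
proof (induction k)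
  case 0
  then show ?case by (auto intro!: continuous_intros)
next
  case (Suc k)
  have *: "((\<lambda>x. max 0 (f x) ^ Suc (Suc k)) has_derivative
     (\<lambda>h. (real (Suc (Suc k)) * max 0 (f x) ^ Suc k) * (\<Sum>i\<in>UNIV. h $ i * partial_deriv i f x))) (at x)" for x
    by (rule has_derivative_compose[of f _ _ _ "\<lambda>t. max 0 t ^ Suc (Suc k)", OF has_derivative_partials
        has_field_derivative_pos_part_power[unfolded has_field_derivative_def]])
      (use Suc.prems in auto)
  have "partial_deriv i (\<lambda>x. max 0 (f x) ^ Suc (Suc k)) =
      (\<lambda>x. real (Suc (Suc k)) * max 0 (f x) ^ Suc k * partial_deriv i f x)" for i
    by (rule ext, subst partial_deriv_eq[OF *]) (simp add: sum_axis_mult)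
  moreover have "cont_diff k (\<lambda>x. real (Suc (Suc k)) * max 0 (f x) ^ Suc k * partial_deriv i f x)" for i
    using Suc cont_diff_Suc_imp[OF Suc.prems] by (intro cont_diff_mult) auto
  ultimately show ?case using * by (auto simp: differentiable_def simp del: power_Suc)
qed

section \<open>Iterated derivatives and their symmetry\<close>

text \<open>Explicit lists permit induction, unlike the arbitrary enumeration in
  \<open>mi_deriv\<close>. The last entry acts first, so inductions that differentiate the function
  itself run from the end of the list.\<close>

abbreviation list_deriv :: "'n::finite list \<Rightarrow> (real^'n \<Rightarrow> real) \<Rightarrow> real^'n \<Rightarrow> real" where
  "list_deriv L f \<equiv> foldr partial_deriv L f"

lemma cont_diff_list_deriv: "cont_diff (k + length L) f \<Longrightarrow> cont_diff k (list_deriv L f)"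
  by (induction L arbitrary: f rule: rev_induct) auto

text \<open>The mean value theorem is applied to the difference in direction \<open>j\<close> as a
  function of the step in direction \<open>i\<close>, and then to the resulting derivative in
  direction \<open>j\<close>.\<close>

lemma mixed_difference:
  assumes "cont_diff 2 f" "h > 0"
  shows "\<exists>\<sigma> \<tau>. 0 < \<sigma> \<and> \<sigma> < h \<and> 0 < \<tau> \<and> \<tau> < h \<and>
    f (x + h *\<^sub>R axis i 1 + h *\<^sub>R axis j 1) - f (x + h *\<^sub>R axis i 1) - f (x + h *\<^sub>R axis j 1) + f x =
      h\<^sup>2 * partial_deriv j (partial_deriv i f) (x + \<sigma> *\<^sub>R axis i 1 + \<tau> *\<^sub>R axis j 1)"
proof -
  have f: "f differentiable (at y)" "partial_deriv i f differentiable (at y)" for y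
    using assms(1) by (auto simp: numeral_2_eq_2)
  define g where "g t = f ((x + h *\<^sub>R axis j 1) + t *\<^sub>R axis i 1) - f (x + t *\<^sub>R axis i 1)" for t
  have "(g has_field_derivative (partial_deriv i f ((x + h *\<^sub>R axis j 1) + t *\<^sub>R axis i 1) -
      partial_deriv i f (x + t *\<^sub>R axis i 1))) (at t)" for t
    unfolding g_def by (intro DERIV_diff has_field_derivative_partial f)
  from MVT2[OF assms(2) this] obtain \<sigma> where \<sigma>: "0 < \<sigma>" "\<sigma> < h" "g h - g 0 = (h - 0) *
     (partial_deriv i f ((x + h *\<^sub>R axis j 1) + \<sigma> *\<^sub>R axis i 1) - partial_deriv i f (x + \<sigma> *\<^sub>R axis i 1))"
    by blast
  define k where "k t = partial_deriv i f ((x + \<sigma> *\<^sub>R axis i 1) + t *\<^sub>R axis j 1)" for t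
  have "(k has_field_derivative
      partial_deriv j (partial_deriv i f) ((x + \<sigma> *\<^sub>R axis i 1) + t *\<^sub>R axis j 1)) (at t)" for t
    unfolding k_def by (intro has_field_derivative_partial f)
  from MVT2[OF assms(2) this] obtain \<tau> where \<tau>: "0 < \<tau>" "\<tau> < h"
    "k h - k 0 = (h - 0) * partial_deriv j (partial_deriv i f) ((x + \<sigma> *\<^sub>R axis i 1) + \<tau> *\<^sub>R axis j 1)"
    by blast
  have eq: "f (x + h *\<^sub>R axis i 1 + h *\<^sub>R axis j 1) - f (x + h *\<^sub>R axis i 1) - f (x + h *\<^sub>R axis j 1) + f x = g h - g 0"
    by (simp add: g_def add_ac)
  have "g h - g 0 = h * (k h - k 0)" using \<sigma>(3) by (simp add: k_def add_ac)
  also have "\<dots> = h\<^sup>2 * partial_deriv j (partial_deriv i f) (x + \<sigma> *\<^sub>R axis i 1 + \<tau> *\<^sub>R axis j 1)"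
    unfolding \<tau>(3) by (simp add: power2_eq_square)
  finally show ?thesis using \<sigma>(1,2) \<tau>(1,2) eq by metis
qed

text \<open>The second difference is symmetric in \<open>i\<close> and \<open>j\<close>, so the two
  mixed derivatives agree at two points arbitrarily close to \<open>x\<close>; continuity does the
  rest.\<close>

lemma partial_deriv_commute:
  assumes "cont_diff 2 f"
  shows "partial_deriv i (partial_deriv j f) = partial_deriv j (partial_deriv i f)"
proof
  fix x
  let ?p = "partial_deriv j (partial_deriv i f)" and ?q = "partial_deriv i (partial_deriv j f)"
  have cont: "continuous_on UNIV ?p" "continuous_on UNIV ?q"
    using assms by (auto simp: numeral_2_eq_2)
  show "?q x = ?p x"
  proof (rule ccontr)
    assume "?q x \<noteq> ?p x"
    define \<epsilon> where "\<epsilon> = dist (?q x) (?p x) / 2"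
    have "\<epsilon> > 0" using \<open>?q x \<noteq> ?p x\<close> by (simp add: \<epsilon>_def)
    obtain d1 where d1: "d1 > 0" "\<And>y. dist y x < d1 \<Longrightarrow> dist (?p y) (?p x) < \<epsilon>"
      using cont(1) \<open>\<epsilon> > 0\<close> unfolding continuous_on_iff by blast
    obtain d2 where d2: "d2 > 0" "\<And>y. dist y x < d2 \<Longrightarrow> dist (?q y) (?q x) < \<epsilon>"
      using cont(2) \<open>\<epsilon> > 0\<close> unfolding continuous_on_iff by blast
    define h where "h = min d1 d2 / 2"
    have h: "h > 0" "2 * h \<le> d1" "2 * h \<le> d2" using d1(1) d2(1) by (auto simp: h_def)
    have near: "dist (x + \<sigma> *\<^sub>R axis a 1 + \<tau> *\<^sub>R axis b 1) x < 2 * h"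
      if "0 < \<sigma>" "\<sigma> < h" "0 < \<tau>" "\<tau> < h" for \<sigma> \<tau> :: real and a b :: 'a
    proof -
      have "dist (x + \<sigma> *\<^sub>R axis a 1 + \<tau> *\<^sub>R axis b 1) x \<le> norm (\<sigma> *\<^sub>R axis a (1::real)) + norm (\<tau> *\<^sub>R axis b (1::real))"
        unfolding dist_norm by (simp only: add.assoc add_diff_cancel_left') (rule norm_triangle_ineq)
      then show ?thesis using that by simp
    qed
    obtain \<sigma> \<tau> where 1: "0 < \<sigma>" "\<sigma> < h" "0 < \<tau>" "\<tau> < h"
      "f (x + h *\<^sub>R axis i 1 + h *\<^sub>R axis j 1) - f (x + h *\<^sub>R axis i 1) - f (x + h *\<^sub>R axis j 1) + f x =
      h\<^sup>2 * ?p (x + \<sigma> *\<^sub>R axis i 1 + \<tau> *\<^sub>R axis j 1)"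
      using mixed_difference[OF assms h(1)] by blast
    obtain \<sigma>' \<tau>' where 2: "0 < \<sigma>'" "\<sigma>' < h" "0 < \<tau>'" "\<tau>' < h"
      "f (x + h *\<^sub>R axis j 1 + h *\<^sub>R axis i 1) - f (x + h *\<^sub>R axis j 1) - f (x + h *\<^sub>R axis i 1) + f x =
      h\<^sup>2 * ?q (x + \<sigma>' *\<^sub>R axis j 1 + \<tau>' *\<^sub>R axis i 1)"
      using mixed_difference[OF assms h(1)] by blast
    have "h\<^sup>2 * ?p (x + \<sigma> *\<^sub>R axis i 1 + \<tau> *\<^sub>R axis j 1) = h\<^sup>2 * ?q (x + \<sigma>' *\<^sub>R axis j 1 + \<tau>' *\<^sub>R axis i 1)"
      using 1(5) 2(5) by (simp add: algebra_simps)
    then have eq: "?p (x + \<sigma> *\<^sub>R axis i 1 + \<tau> *\<^sub>R axis j 1) = ?q (x + \<sigma>' *\<^sub>R axis j 1 + \<tau>' *\<^sub>R axis i 1)"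
      using h(1) by simp
    have "dist (?p (x + \<sigma> *\<^sub>R axis i 1 + \<tau> *\<^sub>R axis j 1)) (?p x) < \<epsilon>"
      using near[OF 1(1-4)] h by (intro d1) (meson less_le_trans)
    moreover have "dist (?q (x + \<sigma>' *\<^sub>R axis j 1 + \<tau>' *\<^sub>R axis i 1)) (?q x) < \<epsilon>"
      using near[OF 2(1-4)] h by (intro d2) (meson less_le_trans)
    moreover have "dist (?q x) (?p x) = 2 * \<epsilon>" by (simp add: \<epsilon>_def)
    ultimately show False
      unfolding eq using dist_triangle3[of "?q x" "?p x" "?q (x + \<sigma>' *\<^sub>R axis j 1 + \<tau>' *\<^sub>R axis i 1)"]
      by linarith
  qed
qed

lemma list_deriv_partial_deriv:
  "cont_diff (Suc (length L)) f \<Longrightarrow> list_deriv L (partial_deriv i f) = partial_deriv i (list_deriv L f)"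
proof (induction L)
  case (Cons j L)
  have "cont_diff 2 (list_deriv L f)"
    using cont_diff_list_deriv[of 2 L f] Cons.prems by (simp add: numeral_2_eq_2)
  with Cons cont_diff_Suc_imp[OF Cons.prems] show ?case by (simp add: partial_deriv_commute del: cont_diff.simps(2))
qed simp

lemma list_deriv_permute:
  "mset L = mset L' \<Longrightarrow> cont_diff (length L) f \<Longrightarrow> list_deriv L f = list_deriv L' f"
proof (induction L arbitrary: L')
  case (Cons i L)
  have "i \<in> set L'" using Cons.prems(1) by (metis list.set_intros(1) set_mset_mset)
  then obtain A B where L': "L' = A @ i # B" by (meson split_list)
  have m: "mset L = mset (A @ B)" using Cons.prems(1) L' by simp
  then have len: "length L = length A + length B" by (metis mset_eq_length length_append)
  have cd: "cont_diff (Suc (length A)) (list_deriv B f)"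
    using cont_diff_list_deriv[of "Suc (length A)" B f] Cons.prems(2) len by simp
  have "list_deriv L' f = partial_deriv i (list_deriv A (list_deriv B f))"
    using list_deriv_partial_deriv[OF cd] by (simp add: L')
  also have "\<dots> = partial_deriv i (list_deriv L f)"
    using Cons.IH[OF m cont_diff_Suc_imp] Cons.prems(2) by simp
  finally show ?case by simp
qed simp

lemma mi_order_count_list: "mi_order (count_list L) = length L"
  unfolding mi_order_def by (rule sum_count_set) auto

lemma ex_count_list: "\<exists>L. count_list L = (\<alpha> :: 'n::finite mindex)"
proof (induction "mi_order \<alpha>" arbitrary: \<alpha>)
  case 0
  then show ?case by (intro exI[of _ "[]"]) (auto simp: mi_order_def)
next
  case (Suc n)
  then obtain i where i: "\<alpha> i > 0" by (fastforce simp: mi_order_def)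
  have "mi_order \<alpha> = Suc (mi_order (\<alpha>(i := \<alpha> i - 1)))"
    using i unfolding mi_order_def by (subst (1 2) sum.remove[of _ i]) auto
  then obtain L where "count_list L = \<alpha>(i := \<alpha> i - 1)" using Suc by (metis Suc_inject)
  then show ?case using i by (intro exI[of _ "i # L"]) (auto simp: fun_eq_iff)
qed

lemma mi_deriv_eq_list_deriv:
  assumes "cont_diff (length L) f" "count_list L = \<alpha>"
  shows "mi_deriv \<alpha> f = list_deriv L f"
proof -
  define L' where "L' = (SOME is. count_list is = \<alpha>)"
  have "count_list L' = \<alpha>" unfolding L'_def using ex_count_list by (rule someI_ex)
  then have "mset L = mset L'" using assms(2) by (simp add: multiset_eq_iff count_mset)
  then show ?thesis using list_deriv_permute[of L L'] assms(1) by (simp add: mi_deriv_def L'_def)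
qed

lemma mi_deriv_Suc:
  assumes "cont_diff (Suc (mi_order \<alpha>)) f"
  shows "mi_deriv (\<alpha>(i := Suc (\<alpha> i))) f = mi_deriv \<alpha> (partial_deriv i f)"
proof -
  obtain L where L: "count_list L = \<alpha>" using ex_count_list by blast
  then have len: "mi_order \<alpha> = length L" using mi_order_count_list by blast
  have "mi_deriv (\<alpha>(i := Suc (\<alpha> i))) f = list_deriv (L @ [i]) f"
    using assms L by (intro mi_deriv_eq_list_deriv) (auto simp: len fun_eq_iff)
  moreover have "mi_deriv \<alpha> (partial_deriv i f) = list_deriv L (partial_deriv i f)"
    using assms L by (intro mi_deriv_eq_list_deriv) (auto simp: len)
  ultimately show ?thesis by simp
qed

lemma mi_deriv_0 [simp]: "mi_deriv (\<lambda>_. 0) f = f"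
proof -
  have "\<exists>L. count_list L = (\<lambda>_::'a. 0)" by (rule ex_count_list)
  then have "count_list (SOME is. count_list is = (\<lambda>_::'a. 0)) = (\<lambda>_::'a. 0)" by (rule someI_ex)
  then have "(SOME is. count_list is = (\<lambda>_::'a. 0)) = []"
    by (metis count_list_0_iff list.set_intros(1) neq_Nil_conv)
  then show ?thesis by (simp add: mi_deriv_def)
qed

subsection \<open>Taylor polynomials and cutoff functions\<close>

text \<open>With the factorial included, differentiation maps these functions to each other or to 0
  without numerical factors.\<close>

definition taylor_monomial :: "'n::finite mindex \<Rightarrow> real^'n \<Rightarrow> real^'n \<Rightarrow> real" where
  "taylor_monomial \<alpha> x y = monomial \<alpha> (y - x) / mi_fact \<alpha>"

lemma mi_order_inc [simp]: "mi_order (\<alpha>(i := Suc (\<alpha> i))) = Suc (mi_order \<alpha>)"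
  unfolding mi_order_def by (subst (1 2) sum.remove[of _ i]) auto

lemma monomial_inc: "monomial (\<alpha>(i := Suc (\<alpha> i))) y = y $ i * monomial \<alpha> y"
  unfolding monomial_def by (subst (1 2) prod.remove[of _ i]) auto

lemma mi_fact_inc: "mi_fact (\<alpha>(i := Suc (\<alpha> i))) = real (Suc (\<alpha> i)) * mi_fact \<alpha>"
  unfolding mi_fact_def by (subst (1 2) prod.remove[of _ i]) auto

lemma mi_fact_ge_1: "mi_fact \<alpha> \<ge> 1"
  unfolding mi_fact_def by (rule prod_ge_1) (simp add: fact_ge_1)

lemma mi_fact_pos [simp]: "mi_fact \<alpha> > 0" "mi_fact \<alpha> \<noteq> 0"
  using mi_fact_ge_1[of \<alpha>] by auto

lemma mindex_cases:
  obtains "\<alpha> = (\<lambda>_. 0)" | i \<beta> where "\<alpha> = \<beta>(i := Suc (\<beta> i))"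
proof (cases "\<alpha> = (\<lambda>_. 0)")
  case False
  then obtain i where "\<alpha> i \<noteq> 0" by auto
  then have "\<alpha> = (\<alpha>(i := \<alpha> i - 1))(i := Suc ((\<alpha>(i := \<alpha> i - 1)) i))" by auto
  then show ?thesis using that by metis
qed (use that in auto)

lemma mindex_induct [case_names zero inc]:
  fixes \<alpha> :: "'n::finite mindex"
  assumes "P (\<lambda>_. 0)" "\<And>\<alpha> i. P \<alpha> \<Longrightarrow> P (\<alpha>(i := Suc (\<alpha> i)))"
  shows "P \<alpha>"
proof (induction "mi_order \<alpha>" arbitrary: \<alpha>)
  case 0
  then show ?case using assms(1) by (cases \<alpha> rule: mindex_cases) (auto simp del: fun_upd_apply)
next
  case (Suc k)
  show ?case
  proof (cases \<alpha> rule: mindex_cases)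
    case 1
    then show ?thesis using assms(1) by simp
  next
    case (2 i \<beta>)
    then show ?thesis using Suc assms(2) by (metis Suc_inject mi_order_inc)
  qed
qed

lemma finite_mi_order: "finite {\<alpha> :: 'n::finite mindex. mi_order \<alpha> \<le> m}" "finite {\<alpha> :: 'n::finite mindex. mi_order \<alpha> < m}"
proof -
  have "finite (PiE (UNIV :: 'n set) (\<lambda>_. {..m}))" by (intro finite_PiE) auto
  moreover have "\<alpha> i \<le> m" if "mi_order \<alpha> \<le> m" for \<alpha> :: "'n mindex" and i
    using that member_le_sum[of i UNIV \<alpha>] by (simp add: mi_order_def)
  then have "{\<alpha> :: 'n mindex. mi_order \<alpha> \<le> m} \<subseteq> PiE UNIV (\<lambda>_. {..m})" by auto
  ultimately show "finite {\<alpha> :: 'n mindex. mi_order \<alpha> \<le> m}" by (rule finite_subset[rotated])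
  then show "finite {\<alpha> :: 'n mindex. mi_order \<alpha> < m}" by (rule finite_subset[rotated]) auto
qed

lemma abs_taylor_monomial_le: "\<bar>taylor_monomial \<alpha> x y\<bar> \<le> norm (y - x) ^ mi_order \<alpha>"
proof -
  have "\<bar>monomial \<alpha> (y - x)\<bar> \<le> (\<Prod>i\<in>UNIV. norm (y - x) ^ \<alpha> i)"
    unfolding monomial_def abs_prod
    by (intro prod_mono) (auto simp: power_abs intro!: power_mono component_le_norm_cart[of "y - x", simplified])
  also have "\<dots> = norm (y - x) ^ mi_order \<alpha>" by (simp add: mi_order_def power_sum)
  finally have "\<bar>monomial \<alpha> (y - x)\<bar> / mi_fact \<alpha> \<le> norm (y - x) ^ mi_order \<alpha> / 1"
    by (intro frac_le mi_fact_ge_1) auto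
  then show ?thesis using mi_fact_pos(1)[of \<alpha>] by (simp add: taylor_monomial_def abs_of_pos)
qed

lemma taylor_monomial_0 [simp]: "taylor_monomial (\<lambda>_. 0) x y = 1"
  by (simp add: taylor_monomial_def monomial_def mi_fact_def)

lemma taylor_monomial_inc:
  "taylor_monomial (\<alpha>(i := Suc (\<alpha> i))) x y = (y $ i - x $ i) * taylor_monomial \<alpha> x y / real (Suc (\<alpha> i))"
  by (simp add: taylor_monomial_def monomial_inc mi_fact_inc)

lemma taylor_monomial_center: "taylor_monomial \<alpha> x x = of_bool (\<alpha> = (\<lambda>_. 0))"
proof (cases \<alpha> rule: mindex_cases)
  case (2 i \<beta>)
  then have "\<alpha> i \<noteq> 0" by simp
  then have "\<alpha> \<noteq> (\<lambda>_. 0)" by auto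
  then show ?thesis using 2 by (simp add: taylor_monomial_inc del: fun_upd_apply)
qed simp

lemma cont_diff_taylor_monomial: "cont_diff k (taylor_monomial \<alpha> x)"
proof (induction \<alpha> rule: mindex_induct)
  case zero
  then show ?case by simp
next
  case (inc \<alpha> i)
  have "cont_diff k (\<lambda>y. (1 / real (Suc (\<alpha> i))) * ((y $ i - x $ i) * taylor_monomial \<alpha> x y))"
    by (intro cont_diff_cmult cont_diff_mult cont_diff_diff cont_diff_coord cont_diff_const inc)
  also have "(\<lambda>y. (1 / real (Suc (\<alpha> i))) * ((y $ i - x $ i) * taylor_monomial \<alpha> x y)) =
      taylor_monomial (\<alpha>(i := Suc (\<alpha> i))) x"
    by (simp add: fun_eq_iff taylor_monomial_inc del: fun_upd_apply)
  finally show ?case .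
qed

lemma partial_deriv_taylor_monomial:
  "partial_deriv i (taylor_monomial \<alpha> x) =
    (if \<alpha> i = 0 then (\<lambda>_. 0) else taylor_monomial (\<alpha>(i := \<alpha> i - 1)) x)"
proof
  fix y
  define c where "c = (\<Prod>j\<in>UNIV - {i}. (y $ j - x $ j) ^ \<alpha> j) / mi_fact \<alpha>"
  have eq: "taylor_monomial \<alpha> x (y + t *\<^sub>R axis i 1) = (y $ i - x $ i + t) ^ \<alpha> i * c" for t
  proof -
    have "(\<Prod>j\<in>UNIV - {i}. ((y + t *\<^sub>R axis i 1 - x) $ j) ^ \<alpha> j) = (\<Prod>j\<in>UNIV - {i}. (y $ j - x $ j) ^ \<alpha> j)"
      by (rule prod.cong) (auto simp: axis_def)
    then show ?thesis
      unfolding taylor_monomial_def monomial_def c_def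
      by (subst prod.remove[of _ i]) (auto simp: axis_def algebra_simps)
  qed
  have "((\<lambda>t. (y $ i - x $ i + t) ^ \<alpha> i * c) has_field_derivative
     (real (\<alpha> i) * (y $ i - x $ i) ^ (\<alpha> i - 1)) * c) (at 0)"
    by (auto intro!: derivative_eq_intros)
  then have "partial_deriv i (taylor_monomial \<alpha> x) y = real (\<alpha> i) * (y $ i - x $ i) ^ (\<alpha> i - 1) * c"
    unfolding partial_deriv_def eq by (rule DERIV_imp_deriv)
  also have "\<dots> = (if \<alpha> i = 0 then (\<lambda>_. 0) else taylor_monomial (\<alpha>(i := \<alpha> i - 1)) x) y"
  proof (cases "\<alpha> i = 0")
    case False
    have f: "mi_fact \<alpha> = real (\<alpha> i) * mi_fact (\<alpha>(i := \<alpha> i - 1))"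
      using mi_fact_inc[of "\<alpha>(i := \<alpha> i - 1)" i] False by simp
    have "(\<Prod>j\<in>UNIV - {i}. ((y - x) $ j) ^ (\<alpha>(i := \<alpha> i - 1)) j) = (\<Prod>j\<in>UNIV - {i}. (y $ j - x $ j) ^ \<alpha> j)"
      by (rule prod.cong) auto
    then show ?thesis using False
      unfolding c_def f taylor_monomial_def monomial_def
      by (subst prod.remove[of _ i]) auto
  qed simp
  finally show "partial_deriv i (taylor_monomial \<alpha> x) y =
    (if \<alpha> i = 0 then (\<lambda>_. 0) else taylor_monomial (\<alpha>(i := \<alpha> i - 1)) x) y" .
qed

lemma list_deriv_taylor_monomial:
  "list_deriv L (taylor_monomial \<alpha> x) = (\<lambda>_. 0) \<or>
   (\<exists>\<beta>. mi_order \<beta> + length L = mi_order \<alpha> \<and> list_deriv L (taylor_monomial \<alpha> x) = taylor_monomial \<beta> x)"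
proof (induction L)
  case (Cons i L)
  then show ?case
  proof (elim disjE exE conjE)
    fix \<beta> assume \<beta>: "mi_order \<beta> + length L = mi_order \<alpha>" "list_deriv L (taylor_monomial \<alpha> x) = taylor_monomial \<beta> x"
    show ?thesis
    proof (cases "\<beta> i = 0")
      case False
      then have "mi_order \<beta> = Suc (mi_order (\<beta>(i := \<beta> i - 1)))"
        using mi_order_inc[of "\<beta>(i := \<beta> i - 1)" i] by simp
      with False \<beta> show ?thesis
        by (intro disjI2 exI[of _ "\<beta>(i := \<beta> i - 1)"]) (simp add: partial_deriv_taylor_monomial del: fun_upd_apply)
    qed (simp add: \<beta> partial_deriv_taylor_monomial)
  qed simp
qed auto

section \<open>Jets and Taylor's formula\<close>

lemma jet_eq: "jet m x f y = (\<Sum>\<alpha> | mi_order \<alpha> < m. mi_deriv \<alpha> f x * taylor_monomial \<alpha> x y)"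
  by (simp add: jet_def taylor_monomial_def)

lemma jet_0 [simp]: "jet 0 x f = (\<lambda>_. 0)"
  by (simp add: jet_def)

lemma jet_center:
  fixes x :: "real^'n"
  assumes "m > 0"
  shows "jet m x f x = f x"
proof -
  have m: "mi_order (\<lambda>_::'n. 0) < m" using assms by (simp add: mi_order_def)
  have "jet m x f x = (\<Sum>\<alpha> | mi_order \<alpha> < m. if \<alpha> = (\<lambda>_::'n. 0) then f x else 0)"
    unfolding jet_eq
  proof (rule sum.cong[OF refl])
    fix \<alpha> :: "'n mindex"
    show "mi_deriv \<alpha> f x * taylor_monomial \<alpha> x x = (if \<alpha> = (\<lambda>_. 0) then f x else 0)"
      by (cases "\<alpha> = (\<lambda>_. 0)") (simp_all add: taylor_monomial_center)
  qed
  then show ?thesis using m finite_mi_order(2)[of m, where ?'n = 'n] by simp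
qed

lemma cont_diff_jet: "cont_diff k (jet m x f)"
  unfolding jet_eq[abs_def] by (intro cont_diff_sum cont_diff_cmult cont_diff_taylor_monomial)

lemma partial_deriv_sum:
  assumes "\<And>a x. a \<in> I \<Longrightarrow> f a differentiable (at x)"
  shows "partial_deriv i (\<lambda>x. \<Sum>a\<in>I. f a x) = (\<lambda>x. \<Sum>a\<in>I. partial_deriv i (f a) x)"
  using assms
proof (induction I rule: infinite_finite_induct)
  case (insert a I)
  have "(\<lambda>x. \<Sum>a\<in>I. f a x) differentiable (at y)" for y
    using insert by (intro differentiable_sum) auto
  then show ?case using insert by (simp add: partial_deriv_add)
qed auto

lemma partial_deriv_cmult:
  assumes "\<And>x. f differentiable (at x)"
  shows "partial_deriv i (\<lambda>x. c * f x) = (\<lambda>x. c * partial_deriv i f x)"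
  using partial_deriv_mult[of "\<lambda>_. c" f i] assms by simp

lemma partial_deriv_diff:
  assumes "\<And>x. f differentiable (at x)" "\<And>x. g differentiable (at x)"
  shows "partial_deriv i (\<lambda>x. f x - g x) = (\<lambda>x. partial_deriv i f x - partial_deriv i g x)"
  using partial_deriv_add[of f "\<lambda>x. (-1) * g x" i] partial_deriv_cmult[of g i "-1"] assms
  by (simp add: differentiable_minus)

text \<open>Lowering the exponent at \<open>i\<close> is a bijection from the multi-indices of order
  at most \<open>m\<close> with a positive entry at \<open>i\<close> onto those of order below
  \<open>m\<close>.\<close>

lemma partial_deriv_jet:
  assumes "cont_diff m f"
  shows "partial_deriv i (jet (Suc m) x f) = jet m x (partial_deriv i f)"
proof
  fix y
  have d: "taylor_monomial \<alpha> x differentiable (at y)" for \<alpha> y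
    using cont_diff_taylor_monomial[of 1 \<alpha> x] by simp
  have "partial_deriv i (jet (Suc m) x f) y =
      (\<Sum>\<alpha> | mi_order \<alpha> < Suc m. mi_deriv \<alpha> f x * partial_deriv i (taylor_monomial \<alpha> x) y)"
    unfolding jet_eq[abs_def] by (simp add: partial_deriv_sum partial_deriv_cmult d)
  also have "\<dots> = (\<Sum>\<alpha> | mi_order \<alpha> < Suc m \<and> \<alpha> i > 0. mi_deriv \<alpha> f x * taylor_monomial (\<alpha>(i := \<alpha> i - 1)) x y)"
    by (rule sum.mono_neutral_cong_right) (use finite_mi_order(2)[of "Suc m"] in \<open>auto simp: partial_deriv_taylor_monomial\<close>)
  also have "\<dots> = (\<Sum>\<beta> | mi_order \<beta> < m. mi_deriv \<beta> (partial_deriv i f) x * taylor_monomial \<beta> x y)"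
  proof (rule sum.reindex_bij_witness[of _ "\<lambda>\<beta>. \<beta>(i := Suc (\<beta> i))" "\<lambda>\<alpha>. \<alpha>(i := \<alpha> i - 1)"])
    fix \<alpha> :: "'a mindex" assume a: "\<alpha> \<in> {\<alpha>. mi_order \<alpha> < Suc m \<and> \<alpha> i > 0}"
    then show eq: "(\<alpha>(i := \<alpha> i - 1))(i := Suc ((\<alpha>(i := \<alpha> i - 1)) i)) = \<alpha>" by auto
    have "mi_order \<alpha> = Suc (mi_order (\<alpha>(i := \<alpha> i - 1)))"
      using mi_order_inc[of "\<alpha>(i := \<alpha> i - 1)" i] unfolding eq .
    have "cont_diff (Suc (mi_order (\<alpha>(i := \<alpha> i - 1)))) f"
      by (rule cont_diff_mono[OF assms]) (use \<open>mi_order \<alpha> = _\<close> a in auto)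
    from mi_deriv_Suc[OF this, of i] have "mi_deriv \<alpha> f = mi_deriv (\<alpha>(i := \<alpha> i - 1)) (partial_deriv i f)"
      unfolding eq .
    with \<open>mi_order \<alpha> = _\<close> show "\<alpha>(i := \<alpha> i - 1) \<in> {\<beta>. mi_order \<beta> < m}"
      and "mi_deriv (\<alpha>(i := \<alpha> i - 1)) (partial_deriv i f) x * taylor_monomial (\<alpha>(i := \<alpha> i - 1)) x y =
        mi_deriv \<alpha> f x * taylor_monomial (\<alpha>(i := \<alpha> i - 1)) x y"
      using a by auto
  qed auto
  finally show "partial_deriv i (jet (Suc m) x f) y = jet m x (partial_deriv i f) y" by (simp add: jet_eq)
qed

lemma list_deriv_jet:
  "length L \<le> m \<Longrightarrow> cont_diff m f \<Longrightarrow> list_deriv L (jet m x f) = jet (m - length L) x (list_deriv L f)"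
proof (induction L)
  case (Cons i L)
  define k where "k = m - length (i # L)"
  have k: "m - length L = Suc k" "k + length L \<le> m" using Cons.prems(1) by (auto simp: k_def)
  have "cont_diff k (list_deriv L f)"
    using cont_diff_list_deriv cont_diff_mono Cons.prems(2) k(2) by blast
  then show ?case using Cons k by (simp add: partial_deriv_jet k_def)
qed simp

lemma partial_deriv_bound:
  fixes g :: "real^'n \<Rightarrow> real"
  assumes "\<And>z. g differentiable (at z)"
    and "\<And>z i. z \<in> closed_segment x y \<Longrightarrow> \<bar>partial_deriv i g z\<bar> \<le> B"
  shows "\<bar>g y - g x\<bar> \<le> real CARD('n) * B * norm (y - x)"
proof -
  have "norm (g y - g x) \<le> real CARD('n) * B * norm (y - x)"
  proof (rule differentiable_bound[of "closed_segment x y"])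
    fix z assume z: "z \<in> closed_segment x y"
    show "(g has_derivative (\<lambda>h. \<Sum>i\<in>UNIV. h $ i * partial_deriv i g z)) (at z within closed_segment x y)"
      by (rule has_derivative_at_withinI[OF has_derivative_partials]) (rule assms)
    have B: "B \<ge> 0" using assms(2)[OF z, of undefined] by linarith
    show "onorm (\<lambda>h. \<Sum>i\<in>UNIV. h $ i * partial_deriv i g z) \<le> real CARD('n) * B"
    proof (rule onorm_le)
      fix h :: "real^'n"
      have "norm (\<Sum>i\<in>UNIV. h $ i * partial_deriv i g z) \<le> (\<Sum>i\<in>(UNIV :: 'n set). norm h * B)"
        using assms(2)[OF z] component_le_norm_cart[of h] B
        by (intro sum_norm_le) (auto simp: abs_mult intro!: mult_mono)
      then show "norm (\<Sum>i\<in>UNIV. h $ i * partial_deriv i g z) \<le> real CARD('n) * B * norm h"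
        by (simp add: mult_ac)
    qed
  qed auto
  then show ?thesis by simp
qed

text \<open>The remainder vanishes at \<open>x\<close> and its partial derivatives are remainders of
  one order less. The mean value inequality on the segment adds one factor
  \<open>norm (y - x)\<close> and one factor \<open>CARD('n)\<close>, the latter from bounding a
  gradient by its components.\<close>

lemma taylor_bound:
  fixes f :: "real^'n \<Rightarrow> real"
  assumes "cont_diff k f" and "\<And>L z. length L = k \<Longrightarrow> \<bar>list_deriv L f z\<bar> \<le> M"
  shows "\<bar>f y - jet k x f y\<bar> \<le> real CARD('n) ^ k * M * norm (y - x) ^ k"
  using assms
proof (induction k arbitrary: f y)
  case 0
  then show ?case using "0.prems"(2)[of "[]"] by simp
next
  case (Suc k)
  define g where "g = (\<lambda>y. f y - jet (Suc k) x f y)"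
  have d: "f differentiable (at z)" "jet (Suc k) x f differentiable (at z)" for z
    using Suc.prems(1) cont_diff_jet[of 1 "Suc k" x f] by simp_all
  have M: "M \<ge> 0" using Suc.prems(2)[of "replicate (Suc k) undefined"] by force
  have g': "partial_deriv i g = (\<lambda>z. partial_deriv i f z - jet k x (partial_deriv i f) z)" for i
    unfolding g_def using d cont_diff_Suc_imp[OF Suc.prems(1)] by (simp add: partial_deriv_diff partial_deriv_jet)
  have "\<bar>g y - g x\<bar> \<le> real CARD('n) * (real CARD('n) ^ k * M * norm (y - x) ^ k) * norm (y - x)"
  proof (rule partial_deriv_bound)
    fix z i assume z: "z \<in> closed_segment x y"
    have "\<bar>partial_deriv i g z\<bar> \<le> real CARD('n) ^ k * M * norm (z - x) ^ k"
      unfolding g' by (rule Suc.IH) (use Suc.prems(1) Suc.prems(2)[of "_ @ [i]"] in auto)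
    also have "\<dots> \<le> real CARD('n) ^ k * M * norm (y - x) ^ k"
      using segment_bound(1)[OF z] M by (intro mult_left_mono power_mono) auto
    finally show "\<bar>partial_deriv i g z\<bar> \<le> real CARD('n) ^ k * M * norm (y - x) ^ k" .
  qed (use d in \<open>simp add: g_def\<close>)
  moreover have "g x = 0" by (simp add: g_def jet_center)
  ultimately show ?case by (simp add: g_def mult_ac)
qed

lemma list_deriv_add:
  "cont_diff (length L) f \<Longrightarrow> cont_diff (length L) g \<Longrightarrow>
    list_deriv L (\<lambda>x. f x + g x) = (\<lambda>x. list_deriv L f x + list_deriv L g x)"
  by (induction L arbitrary: f g rule: rev_induct) (auto simp: partial_deriv_add)

lemma list_deriv_cmult:
  "cont_diff (length L) f \<Longrightarrow> list_deriv L (\<lambda>x. c * f x) = (\<lambda>x. c * list_deriv L f x)"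
  by (induction L arbitrary: f rule: rev_induct) (auto simp: partial_deriv_cmult)

lemma list_deriv_diff:
  "cont_diff (length L) f \<Longrightarrow> cont_diff (length L) g \<Longrightarrow>
    list_deriv L (\<lambda>x. f x - g x) = (\<lambda>x. list_deriv L f x - list_deriv L g x)"
  by (induction L arbitrary: f g rule: rev_induct) (auto simp: partial_deriv_diff)

lemma list_deriv_const: "list_deriv L (\<lambda>_. c) = (\<lambda>_. if L = [] then c else 0)"
  by (induction L arbitrary: c rule: rev_induct) auto

lemma list_deriv_scale:
  "cont_diff (length L) f \<Longrightarrow>
    list_deriv L (\<lambda>y. f (s *\<^sub>R (y - z))) = (\<lambda>y. s ^ length L * list_deriv L f (s *\<^sub>R (y - z)))"
proof (induction L arbitrary: f rule: rev_induct)
  case (snoc i L)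
  then have "cont_diff (length L) (partial_deriv i f)" "\<And>x. f differentiable (at x)" by auto
  with snoc.IH show ?case
    by (simp add: partial_deriv_scale list_deriv_cmult cont_diff_scale mult.assoc[symmetric])
qed simp

section \<open>Locality and polynomials\<close>

lemma partial_deriv_local:
  assumes "open U" "x \<in> U" "\<And>y. y \<in> U \<Longrightarrow> f y = g y"
  shows "partial_deriv i f x = partial_deriv i g x"
proof -
  have "((\<lambda>t. x + t *\<^sub>R axis i 1) \<longlongrightarrow> x + 0 *\<^sub>R axis i (1::real)) (nhds 0)"
    by (intro tendsto_intros filterlim_ident)
  then have "eventually (\<lambda>t. x + t *\<^sub>R axis i 1 \<in> U) (nhds 0)"
    using assms(1,2) by (simp add: tendsto_def)
  then have "eventually (\<lambda>t. f (x + t *\<^sub>R axis i 1) = g (x + t *\<^sub>R axis i 1)) (nhds 0)"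
    by (rule eventually_mono) (rule assms(3))
  then show ?thesis unfolding partial_deriv_def by (rule deriv_cong_ev) simp
qed

lemma list_deriv_local:
  assumes "open U" "x \<in> U" "\<And>y. y \<in> U \<Longrightarrow> f y = g y"
  shows "list_deriv L f x = list_deriv L g x"
  using assms(2)
proof (induction L arbitrary: x)
  case (Cons i L)
  then show ?case using partial_deriv_local[OF assms(1), of x "list_deriv L f" "list_deriv L g" i] by simp
qed (use assms in simp)

lemma jet_local:
  assumes "open U" "x \<in> U" "\<And>y. y \<in> U \<Longrightarrow> f y = g y"
  shows "jet m x f = jet m x g"
  unfolding jet_def mi_deriv_def using list_deriv_local[OF assms] by simp

text \<open>The factor \<open>r ^ length L\<close> avoids a difference of exponents and covers
  derivatives that vanish identically.\<close>

lemma list_deriv_taylor_monomial_bound: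
  assumes "norm (y - x) \<le> r"
  shows "\<bar>list_deriv L (taylor_monomial \<alpha> x) y\<bar> * r ^ length L \<le> r ^ mi_order \<alpha>"
  using list_deriv_taylor_monomial[of L \<alpha> x]
proof (elim disjE exE conjE)
  have r: "r \<ge> 0" using assms norm_ge_zero order_trans by blast
  {
    assume "list_deriv L (taylor_monomial \<alpha> x) = (\<lambda>_. 0)"
    then show ?thesis using r by simp
  next
    fix \<beta> assume \<beta>: "mi_order \<beta> + length L = mi_order \<alpha>" "list_deriv L (taylor_monomial \<alpha> x) = taylor_monomial \<beta> x"
    have "\<bar>taylor_monomial \<beta> x y\<bar> \<le> r ^ mi_order \<beta>"
      using abs_taylor_monomial_le[of \<beta> x y] power_mono[OF assms, of "mi_order \<beta>"] by simp
    then have "\<bar>taylor_monomial \<beta> x y\<bar> * r ^ length L \<le> r ^ mi_order \<beta> * r ^ length L"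
      using r by (intro mult_right_mono) auto
    then show ?thesis by (simp add: \<beta>(2) \<beta>(1)[symmetric] power_add)
  }
qed

lemma polys_mono: "m \<le> k \<Longrightarrow> polys m \<subseteq> polys k"
  unfolding polys_def by (rule span_mono) auto

lemma polys_smooth:
  assumes "p \<in> polys m"
  shows "cont_diff k p" "length L = m \<Longrightarrow> list_deriv L p = (\<lambda>_. 0)"
proof -
  have "(\<forall>k. cont_diff k p) \<and> (\<forall>L. length L = m \<longrightarrow> list_deriv L p = (\<lambda>_. 0))"
    using assms unfolding polys_def
  proof (induction rule: span_induct_alt)
    case base
    show ?case by (auto simp: zero_fun_def list_deriv_const)
  next
    case (step c q p)
    then obtain \<alpha> where \<alpha>: "q = monomial \<alpha>" "mi_order \<alpha> < m" by blast
    have q: "q = (\<lambda>y. mi_fact \<alpha> * taylor_monomial \<alpha> 0 y)"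
      by (simp add: \<alpha>(1) taylor_monomial_def fun_eq_iff)
    have q1: "cont_diff k q" for k unfolding q by (intro cont_diff_cmult cont_diff_taylor_monomial)
    have q2: "list_deriv L q = (\<lambda>_. 0)" if "length L = m" for L
      using list_deriv_taylor_monomial[of L \<alpha> 0] that \<alpha>(2)
      by (auto simp: q list_deriv_cmult cont_diff_taylor_monomial)
    have "c *\<^sub>R q + p = (\<lambda>x. c * q x + p x)" by (simp add: plus_fun_def scaleR_fun_def)
    then show ?case
      using step q1 q2 by (auto simp: list_deriv_add list_deriv_cmult cont_diff_cmult intro!: cont_diff_add)
  qed
  then show "cont_diff k p" "length L = m \<Longrightarrow> list_deriv L p = (\<lambda>_. 0)" by auto
qed

text \<open>Taylor's formula with the bound 0 for the derivatives of order \<open>m\<close>.\<close>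

lemma jet_poly:
  assumes "p \<in> polys m"
  shows "jet m x p = p"
proof
  fix y
  have "\<bar>p y - jet m x p y\<bar> \<le> real CARD('a) ^ m * 0 * norm (y - x) ^ m"
    by (rule taylor_bound) (use polys_smooth[OF assms] in auto)
  then show "jet m x p y = p y" by simp
qed

lemma polys_coord_mult:
  assumes "p \<in> polys m"
  shows "(\<lambda>y. y $ i * p y) \<in> polys (Suc m)"
  using assms unfolding polys_def[of m]
proof (induction rule: span_induct_alt)
  case base
  show ?case by (simp add: polys_def zero_fun_def[symmetric] span_zero)
next
  case (step c q p)
  then obtain \<alpha> where \<alpha>: "q = monomial \<alpha>" "mi_order \<alpha> < m" by blast
  have "(\<lambda>y. y $ i * q y) = monomial (\<alpha>(i := Suc (\<alpha> i)))"
    by (simp add: \<alpha>(1) monomial_inc fun_eq_iff del: fun_upd_apply)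
  also have "\<dots> \<in> polys (Suc m)"
    unfolding polys_def by (rule span_base) (use \<alpha>(2) in \<open>auto simp del: fun_upd_apply intro!: exI[of _ "\<alpha>(i := Suc (\<alpha> i))"]\<close>)
  finally have "c *\<^sub>R (\<lambda>y. y $ i * q y) + (\<lambda>y. y $ i * p y) \<in> polys (Suc m)"
    using step.IH unfolding polys_def by (intro span_add span_scale)
  then show ?case by (simp add: plus_fun_def scaleR_fun_def algebra_simps)
qed

lemma taylor_monomial_in_polys:
  assumes "mi_order \<alpha> < m"
  shows "taylor_monomial \<alpha> x \<in> polys m"
proof -
  have "(\<lambda>y. monomial \<alpha> (y - x)) \<in> polys (Suc (mi_order \<alpha>))"
  proof (induction \<alpha> rule: mindex_induct)
    case zero
    have "(\<lambda>y. monomial (\<lambda>_. 0) (y - x)) = monomial (\<lambda>_. 0)" by (simp add: monomial_def[abs_def])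
    then show ?case unfolding polys_def by (auto intro!: span_base)
  next
    case (inc \<alpha> i)
    let ?q = "\<lambda>y. monomial \<alpha> (y - x)"
    have "(\<lambda>y. y $ i * ?q y) + (- x $ i) *\<^sub>R ?q \<in> polys (Suc (Suc (mi_order \<alpha>)))"
      using polys_coord_mult[OF inc, of i] polys_mono[of "Suc (mi_order \<alpha>)" "Suc (Suc (mi_order \<alpha>))"] inc
      unfolding polys_def by (intro span_add span_scale) auto
    also have "(\<lambda>y. y $ i * ?q y) + (- x $ i) *\<^sub>R ?q = (\<lambda>y. monomial (\<alpha>(i := Suc (\<alpha> i))) (y - x))"
      by (simp add: plus_fun_def scaleR_fun_def monomial_inc algebra_simps del: fun_upd_apply)
    finally show ?case by (simp del: fun_upd_apply)
  qed
  then have "(1 / mi_fact \<alpha>) *\<^sub>R (\<lambda>y. monomial \<alpha> (y - x)) \<in> polys m"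
    using polys_mono[of "Suc (mi_order \<alpha>)" m] assms unfolding polys_def by (intro span_scale) auto
  also have "(1 / mi_fact \<alpha>) *\<^sub>R (\<lambda>y. monomial \<alpha> (y - x)) = taylor_monomial \<alpha> x"
    by (simp add: scaleR_fun_def taylor_monomial_def fun_eq_iff)
  finally show ?thesis .
qed

lemma jet_in_polys: "jet m x f \<in> polys m"
proof -
  have "jet m x f = (\<Sum>\<alpha> | mi_order \<alpha> < m. mi_deriv \<alpha> f x *\<^sub>R taylor_monomial \<alpha> x)"
    by (simp add: fun_eq_iff sum_fun_apply jet_eq scaleR_fun_def)
  also have "\<dots> \<in> polys m"
    using taylor_monomial_in_polys unfolding polys_def by (intro span_sum span_scale) auto
  finally show ?thesis .
qed

lemma ex_mi_deriv_eq_list_deriv: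
  "\<exists>L. length L = mi_order \<alpha> \<and> (\<forall>f. cont_diff (mi_order \<alpha>) f \<longrightarrow> mi_deriv \<alpha> f = list_deriv L f)"
proof -
  obtain L where L: "count_list L = \<alpha>" using ex_count_list by blast
  then have "length L = mi_order \<alpha>" using mi_order_count_list by metis
  with L show ?thesis using mi_deriv_eq_list_deriv by metis
qed

lemma mi_deriv_add:
  "cont_diff (mi_order \<alpha>) f \<Longrightarrow> cont_diff (mi_order \<alpha>) g \<Longrightarrow>
    mi_deriv \<alpha> (\<lambda>x. f x + g x) = (\<lambda>x. mi_deriv \<alpha> f x + mi_deriv \<alpha> g x)"
  using ex_mi_deriv_eq_list_deriv[of \<alpha>] by (auto simp: cont_diff_add list_deriv_add)

lemma mi_deriv_cmult:
  "cont_diff (mi_order \<alpha>) f \<Longrightarrow> mi_deriv \<alpha> (\<lambda>x. c * f x) = (\<lambda>x. c * mi_deriv \<alpha> f x)"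
  using ex_mi_deriv_eq_list_deriv[of \<alpha>] by (auto simp: cont_diff_cmult list_deriv_cmult)

lemma jet_add: "cont_diff m f \<Longrightarrow> cont_diff m g \<Longrightarrow> jet m x (\<lambda>x. f x + g x) = jet m x f + jet m x g"
  by (auto simp: fun_eq_iff jet_eq mi_deriv_add cont_diff_mono algebra_simps sum.distrib[symmetric] intro!: sum.cong)

lemma jet_cmult: "cont_diff m f \<Longrightarrow> jet m x (\<lambda>x. c * f x) = c *\<^sub>R jet m x f"
  by (auto simp: fun_eq_iff jet_eq mi_deriv_cmult cont_diff_mono scaleR_fun_def sum_distrib_left intro!: sum.cong)

text \<open>At its base point a jet reproduces the derivatives of \<open>f\<close>, so the
  derivative of the difference at \<open>x\<close> is the Taylor remainder of
  \<open>mi_deriv \<alpha> f\<close> expanded at \<open>y\<close>. The power of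
  \<open>CARD('n)\<close> is enlarged to be independent of \<open>\<alpha>\<close>.\<close>

lemma jet_difference_bound:
  fixes f :: "real^'n \<Rightarrow> real"
  assumes "cont_diff m f" and M: "\<And>\<alpha> z. mi_order \<alpha> = m \<Longrightarrow> \<bar>mi_deriv \<alpha> f z\<bar> \<le> M" and "mi_order \<alpha> < m"
  shows "\<bar>mi_deriv \<alpha> (\<lambda>z. jet m x f z - jet m y f z) x\<bar> \<le> real CARD('n) ^ m * M * norm (x - y) ^ (m - mi_order \<alpha>)"
proof -
  obtain L where L: "length L = mi_order \<alpha>" "\<And>f. cont_diff (mi_order \<alpha>) f \<Longrightarrow> mi_deriv \<alpha> f = list_deriv L f"
    using ex_mi_deriv_eq_list_deriv[of \<alpha>] by blast
  have len: "length L \<le> m" "m - length L > 0" "m - length L + length L = m" using assms(3) L(1) by auto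
  have M0: "M \<ge> 0"
    using M[of "count_list (replicate m undefined)" 0] by (simp add: mi_order_count_list)
  have bound: "\<bar>list_deriv L' f z\<bar> \<le> M" if "length L' = m" for L' z
    using M[of "count_list L'" z] mi_deriv_eq_list_deriv[of L' f] that assms(1)
    by (simp add: mi_order_count_list)
  have "mi_deriv \<alpha> (\<lambda>z. jet m x f z - jet m y f z) x = list_deriv L (jet m x f) x - list_deriv L (jet m y f) x"
    by (simp add: L cont_diff_diff cont_diff_jet list_deriv_diff)
  also have "\<dots> = list_deriv L f x - jet (m - length L) y (list_deriv L f) x"
    using assms(1) len by (simp add: list_deriv_jet jet_center)
  also have "\<bar>\<dots>\<bar> \<le> real CARD('n) ^ (m - length L) * M * norm (x - y) ^ (m - length L)"
  proof (rule taylor_bound)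
    show "cont_diff (m - length L) (list_deriv L f)"
      by (rule cont_diff_list_deriv) (use assms(1) len in simp)
    show "\<bar>list_deriv L' (list_deriv L f) z\<bar> \<le> M" if "length L' = m - length L" for L' z
      using bound[of "L' @ L" z] that len by simp
  qed
  also have "\<dots> \<le> real CARD('n) ^ m * M * norm (x - y) ^ (m - length L)"
    using M0 by (intro mult_right_mono power_increasing) auto
  finally show ?thesis by (simp add: L(1))
qed

section \<open>Cutoff functions\<close>

text \<open>The Leibniz rule with a common scale: differentiating a factor turns its constant
  \<open>a\<close> into \<open>a * s\<close>, and the two terms of the rule give one factor 2 per
  derivative.\<close>

lemma list_deriv_mult_bound:
  assumes "cont_diff k f" "cont_diff k g" "length L \<le> k" "a \<ge> 0" "b \<ge> 0" "s \<ge> 0"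
    and "\<And>L'. length L' \<le> k \<Longrightarrow> \<bar>list_deriv L' f y\<bar> \<le> a * s ^ length L'"
    and "\<And>L'. length L' \<le> k \<Longrightarrow> \<bar>list_deriv L' g y\<bar> \<le> b * s ^ length L'"
  shows "\<bar>list_deriv L (\<lambda>x. f x * g x) y\<bar> \<le> 2 ^ length L * a * b * s ^ length L"
  using assms
proof (induction L arbitrary: f g a b k rule: rev_induct)
  case Nil
  have "\<bar>f y\<bar> \<le> a" "\<bar>g y\<bar> \<le> b" using Nil(7)[of "[]"] Nil(8)[of "[]"] by simp_all
  then show ?case using Nil.prems(4) by (simp add: abs_mult mult_mono)
next
  case (snoc i L)
  then obtain k' where k: "k = Suc k'" "length L \<le> k'" by (cases k) auto
  have cd: "cont_diff k' f" "cont_diff k' g" "cont_diff k' (partial_deriv i f)" "cont_diff k' (partial_deriv i g)"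
    using snoc.prems(1,2) cont_diff_Suc_imp unfolding k by blast (use snoc.prems(1,2) cont_diff_Suc_imp k in auto)
  have diff: "f differentiable (at x)" "g differentiable (at x)" for x
    using snoc.prems(1,2) by (auto simp: k)
  have 1: "\<bar>list_deriv L (\<lambda>x. partial_deriv i f x * g x) y\<bar> \<le> 2 ^ length L * (a * s) * b * s ^ length L"
  proof (rule snoc.IH[where k = k'])
    show "\<bar>list_deriv L' (partial_deriv i f) y\<bar> \<le> (a * s) * s ^ length L'" if "length L' \<le> k'" for L'
      using snoc.prems(7)[of "L' @ [i]"] that by (simp add: k mult_ac)
    show "\<bar>list_deriv L' g y\<bar> \<le> b * s ^ length L'" if "length L' \<le> k'" for L'
      using snoc.prems(8)[of L'] that by (simp add: k)
  qed (use cd k snoc.prems in auto)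
  have 2: "\<bar>list_deriv L (\<lambda>x. f x * partial_deriv i g x) y\<bar> \<le> 2 ^ length L * a * (b * s) * s ^ length L"
  proof (rule snoc.IH[where k = k'])
    show "\<bar>list_deriv L' (partial_deriv i g) y\<bar> \<le> (b * s) * s ^ length L'" if "length L' \<le> k'" for L'
      using snoc.prems(8)[of "L' @ [i]"] that by (simp add: k mult_ac)
    show "\<bar>list_deriv L' f y\<bar> \<le> a * s ^ length L'" if "length L' \<le> k'" for L'
      using snoc.prems(7)[of L'] that by (simp add: k)
  qed (use cd k snoc.prems in auto)
  have cdL: "cont_diff (length L) (\<lambda>x. partial_deriv i f x * g x)" "cont_diff (length L) (\<lambda>x. f x * partial_deriv i g x)"
    using cd k(2) by (auto intro!: cont_diff_mult elim: cont_diff_mono)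
  have "list_deriv (L @ [i]) (\<lambda>x. f x * g x) y =
      list_deriv L (\<lambda>x. partial_deriv i f x * g x) y + list_deriv L (\<lambda>x. f x * partial_deriv i g x) y"
    by (simp add: partial_deriv_mult diff list_deriv_add[OF cdL])
  also have "\<bar>\<dots>\<bar> \<le> 2 ^ length L * (a * s) * b * s ^ length L + 2 ^ length L * a * (b * s) * s ^ length L"
    using 1 2 by linarith
  finally show ?case by (simp add: mult_ac)
qed

lemma ex_cutoff:
  "\<exists>\<eta> :: real^'n \<Rightarrow> real. \<exists>M. M \<ge> 1 \<and> cont_diff m \<eta> \<and> (\<forall>z. norm z < 1/4 \<longrightarrow> \<eta> z = 1) \<and>
     (\<forall>z. norm z \<ge> 1/2 \<longrightarrow> \<eta> z = 0) \<and> (\<forall>L z. length L \<le> m \<longrightarrow> \<bar>list_deriv L \<eta> z\<bar> \<le> M)"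
proof -
  define r where "r t = max 0 t ^ Suc m" for t :: real
  \<comment> \<open>\<open>u\<close> is at least 1 for \<open>norm z \<le> 1/4\<close> and at most 0
    for \<open>norm z \<ge> 1/2\<close>; the coordinates make its smoothness evident.\<close>
  define u where "u z = 2 - 16 * (\<Sum>i\<in>UNIV. (z $ i)\<^sup>2)" for z :: "real^'n"
  \<comment> \<open>\<open>r\<close> is 0 on negative arguments and at least 1 from 1 on. Nesting it
    turns \<open>u z \<ge> 1\<close> into the exact value 1, and \<open>u z \<le> 0\<close> into the
    exact value 0.\<close>
  define \<eta> where "\<eta> z = 1 - r (1 - r (u z))" for z :: "real^'n"
  have u: "u z = 2 - 16 * (norm z)\<^sup>2" for z
    unfolding u_def power2_norm_eq_inner inner_vec_def by (simp add: power2_eq_square)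
  have cd: "cont_diff m \<eta>"
    unfolding \<eta>_def[abs_def] r_def u_def
    by (intro cont_diff_diff cont_diff_const cont_diff_pos_part_power cont_diff_cmult cont_diff_sum
        cont_diff_power cont_diff_coord)
  have one: "\<eta> z = 1" if "norm z < 1/4" for z
  proof -
    have "(norm z)\<^sup>2 \<le> (1/4)\<^sup>2" using that by (intro power_mono) auto
    then have "u z \<ge> 1" unfolding u by (simp add: power2_eq_square)
    then have "r (u z) \<ge> 1" by (simp add: r_def max_def one_le_power del: power_Suc)
    then show ?thesis by (simp add: \<eta>_def r_def)
  qed
  have zero: "\<eta> z = 0" if "norm z \<ge> 1/2" for z
  proof -
    have "(norm z)\<^sup>2 \<ge> (1/2)\<^sup>2" using that by (intro power_mono) auto
    then have "u z \<le> 0" unfolding u by (simp add: power2_eq_square)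
    then show ?thesis by (simp add: \<eta>_def r_def)
  qed
  \<comment> \<open>Compactness bounds the derivative on the unit ball; outside it the function is
    locally 0.\<close>
  have "\<exists>B. \<forall>z. \<bar>list_deriv L \<eta> z\<bar> \<le> B" if "length L \<le> m" for L
  proof -
    have "cont_diff 0 (list_deriv L \<eta>)"
      by (rule cont_diff_list_deriv) (use cont_diff_mono[OF cd] that in auto)
    then have "continuous_on (cball 0 1) (list_deriv L \<eta>)" by (auto intro: continuous_on_subset)
    then have "bounded (list_deriv L \<eta> ` cball 0 1)" by (intro compact_imp_bounded compact_continuous_image) auto
    then obtain B where "\<forall>t\<in>list_deriv L \<eta> ` cball 0 1. norm t \<le> B" unfolding bounded_iff by blast
    then have B: "\<bar>list_deriv L \<eta> z\<bar> \<le> B" if "z \<in> cball 0 1" for z using that by simp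
    have "list_deriv L \<eta> z = 0" if "z \<notin> cball 0 1" for z
    proof -
      have "list_deriv L \<eta> z = list_deriv L (\<lambda>_. 0) z"
        by (rule list_deriv_local[of "- cball 0 1"]) (use that in \<open>auto intro: zero\<close>)
      then show ?thesis by (simp add: list_deriv_const)
    qed
    then have "\<bar>list_deriv L \<eta> z\<bar> \<le> max B 0" for z using B[of z] by (cases "z \<in> cball 0 1") auto
    then show ?thesis by blast
  qed
  then obtain B where B: "\<And>L z. length L \<le> m \<Longrightarrow> \<bar>list_deriv L \<eta> z\<bar> \<le> B L" by metis
  have fin: "finite {L :: 'n list. length L \<le> m}"
    using finite_lists_length_le[of "UNIV :: 'n set" m] by simp
  define M where "M = 1 + (\<Sum>L | length L \<le> m. \<bar>B L\<bar>)"
  have "\<bar>list_deriv L \<eta> z\<bar> \<le> M" if "length L \<le> m" for L z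
  proof -
    have "\<bar>B L\<bar> \<le> (\<Sum>L | length L \<le> m. \<bar>B L\<bar>)" using fin that by (intro member_le_sum) auto
    then show ?thesis using B[OF that, of z] by (simp add: M_def)
  qed
  moreover have "M \<ge> 1" by (simp add: M_def sum_nonneg)
  ultimately show ?thesis using cd one zero by blast
qed

text \<open>\<open>1 - \<theta>\<close> is the product of the complements of scaled cutoffs at the
  points of \<open>A\<close>: one factor 0 gives \<open>\<theta> = 1\<close>, all factors 1 give
  \<open>\<theta> = 0\<close>. Each factor costs at most \<open>2 ^ m\<close> by the Leibniz rule
  and \<open>M + 1\<close> for its derivatives, together \<open>q\<close>.\<close>

lemma ex_cluster_cutoff:
  "\<exists>b \<ge> 1. \<forall>(A :: (real^'n) set) s. finite A \<and> card A \<le> N \<and> s > 0 \<longrightarrow>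
    (\<exists>\<theta>. cont_diff m \<theta> \<and> (\<forall>y. \<forall>z\<in>A. dist y z < s/4 \<longrightarrow> \<theta> y = 1) \<and>
       (\<forall>y. (\<forall>z\<in>A. dist y z \<ge> s/2) \<longrightarrow> \<theta> y = 0) \<and>
       (\<forall>L y. length L \<le> m \<longrightarrow> \<bar>list_deriv L \<theta> y\<bar> \<le> b * (1/s) ^ length L))"
proof -
  obtain \<eta> :: "real^'n \<Rightarrow> real" and M where \<eta>: "M \<ge> 1" "cont_diff m \<eta>" "\<And>z. norm z < 1/4 \<Longrightarrow> \<eta> z = 1"
    "\<And>z. norm z \<ge> 1/2 \<Longrightarrow> \<eta> z = 0" "\<And>L z. length L \<le> m \<Longrightarrow> \<bar>list_deriv L \<eta> z\<bar> \<le> M"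
    using ex_cutoff by blast
  define q where "q = 2 ^ m * (M + 1)"
  have "(1::real) * 1 \<le> 2 ^ m * (M + 1)" using \<eta>(1) by (intro mult_mono) auto
  then have q: "q \<ge> 1" by (simp add: q_def)
  have main: "\<exists>\<theta>. cont_diff m \<theta> \<and> (\<forall>y. \<forall>z\<in>A. dist y z < s/4 \<longrightarrow> \<theta> y = 1) \<and>
       (\<forall>y. (\<forall>z\<in>A. dist y z \<ge> s/2) \<longrightarrow> \<theta> y = 0) \<and>
       (\<forall>L y. length L \<le> m \<longrightarrow> \<bar>list_deriv L \<theta> y\<bar> \<le> (1 + q ^ N) * (1/s) ^ length L)"
    if A: "finite A" "card A \<le> N" and s: "s > 0" for A :: "(real^'n) set" and s
  proof -
    define g where "g z y = 1 - \<eta> ((1/s) *\<^sub>R (y - z))" for y z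
    have gcd: "cont_diff m (g z)" for z
      unfolding g_def[abs_def] by (intro cont_diff_diff cont_diff_const cont_diff_scale \<eta>(2))
    have gb: "\<bar>list_deriv L (g z) y\<bar> \<le> (M + 1) * (1/s) ^ length L" if "length L \<le> m" for L z y
    proof -
      have cdL: "cont_diff (length L) \<eta>" using \<eta>(2) that cont_diff_mono by blast
      have "list_deriv L (g z) y = (if L = [] then 1 else 0) - (1/s) ^ length L * list_deriv L \<eta> ((1/s) *\<^sub>R (y - z))"
        unfolding g_def[abs_def]
        by (simp add: list_deriv_diff cont_diff_scale cdL list_deriv_const list_deriv_scale)
      also have "\<bar>\<dots>\<bar> \<le> (1/s) ^ length L * 1 + (1/s) ^ length L * \<bar>list_deriv L \<eta> ((1/s) *\<^sub>R (y - z))\<bar>"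
        using s by (intro order_trans[OF abs_triangle_ineq4] add_mono) (auto simp: abs_mult)
      also have "\<dots> \<le> (1/s) ^ length L * 1 + (1/s) ^ length L * M"
        using s \<eta>(5)[OF that] by (intro add_mono mult_left_mono) auto
      finally show ?thesis by (simp add: algebra_simps)
    qed
    have pb: "\<bar>list_deriv L (\<lambda>y. \<Prod>z\<in>A. g z y) y\<bar> \<le> q ^ card A * (1/s) ^ length L" if "length L \<le> m" for L y
      using A(1) that
    proof (induction A arbitrary: L rule: finite_induct)
      case empty
      then show ?case using s by (auto simp: list_deriv_const)
    next
      case (insert z A)
      have "\<bar>list_deriv L (\<lambda>y. g z y * (\<Prod>z\<in>A. g z y)) y\<bar> \<le> 2 ^ length L * (M + 1) * q ^ card A * (1/s) ^ length L"
      proof (rule list_deriv_mult_bound[where k = m])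
        show "cont_diff m (\<lambda>y. \<Prod>z\<in>A. g z y)" by (intro cont_diff_prod gcd)
      qed (use insert gcd gb s \<eta>(1) q in auto)
      also have "\<dots> \<le> 2 ^ m * (M + 1) * q ^ card A * (1/s) ^ length L"
        using insert.prems s \<eta>(1) q by (intro mult_right_mono power_increasing) auto
      finally show ?case using insert.hyps by (simp add: q_def mult_ac)
    qed
    define \<theta> where "\<theta> y = 1 - (\<Prod>z\<in>A. g z y)" for y
    have pcd: "cont_diff k (\<lambda>y. \<Prod>z\<in>A. g z y)" if "k \<le> m" for k
      by (intro cont_diff_prod cont_diff_mono[OF gcd that])
    have "\<bar>list_deriv L \<theta> y\<bar> \<le> (1 + q ^ N) * (1/s) ^ length L" if "length L \<le> m" for L y
    proof -
      have "list_deriv L \<theta> y = (if L = [] then 1 else 0) - list_deriv L (\<lambda>y. \<Prod>z\<in>A. g z y) y"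
        unfolding \<theta>_def[abs_def] using that by (simp add: list_deriv_diff pcd list_deriv_const)
      also have "\<bar>\<dots>\<bar> \<le> (1/s) ^ length L * 1 + q ^ card A * (1/s) ^ length L"
        using s pb[OF that, of y]
        by (intro order_trans[OF abs_triangle_ineq4] add_mono) auto
      also have "\<dots> \<le> (1/s) ^ length L * 1 + q ^ N * (1/s) ^ length L"
        using power_increasing[OF A(2) q] s by (intro add_mono mult_right_mono) auto
      finally show ?thesis by (simp add: algebra_simps)
    qed
    moreover have "cont_diff m \<theta>" unfolding \<theta>_def[abs_def] by (intro cont_diff_diff cont_diff_const pcd) auto
    moreover have "\<theta> y = 1" if "z \<in> A" "dist y z < s/4" for y z
    proof -
      have "norm ((1/s) *\<^sub>R (y - z)) = dist y z / s" using s by (simp add: dist_norm)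
      also have "dist y z / s < 1/4" using that(2) s by (simp add: field_simps)
      finally have "norm ((1/s) *\<^sub>R (y - z)) < 1/4" .
      then have "g z y = 0" by (simp add: g_def \<eta>(3))
      then show ?thesis using that(1) A(1) by (auto simp: \<theta>_def)
    qed
    moreover have "\<theta> y = 0" if "\<forall>z\<in>A. dist y z \<ge> s/2" for y
    proof -
      have "g z y = 1" if z: "z \<in> A" for z
      proof -
        have "norm ((1/s) *\<^sub>R (y - z)) = dist y z / s" using s by (simp add: dist_norm)
        moreover have "dist y z / s \<ge> 1/2"
          using \<open>\<forall>z\<in>A. _\<close>[rule_format, OF z] s by (simp add: field_simps)
        ultimately have "norm ((1/s) *\<^sub>R (y - z)) \<ge> 1/2" by metis
        then show ?thesis by (simp add: g_def \<eta>(4))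
      qed
      then show ?thesis by (simp add: \<theta>_def)
    qed
    ultimately show ?thesis by blast
  qed
  show ?thesis
    by (rule exI[of _ "1 + q ^ N"]) (use main q in auto)
qed

subsection \<open>Jets of vector-valued functions\<close>

text \<open>The exponent \<open>m - mi_order \<alpha>\<close> is that of the Taylor remainder, so
  jets at distance \<open>\<delta>\<close> of a function with \<open>m\<close>-th derivatives at
  most 1 differ by bounded coefficients.\<close>

definition poly_gen :: "nat \<Rightarrow> real^'n::finite \<Rightarrow> real \<Rightarrow> 'd::finite \<times> 'n mindex \<Rightarrow> (real^'n \<Rightarrow> real)^'d" where
  "poly_gen m x \<delta> = (\<lambda>(j, \<alpha>). \<chi> k. if k = j then \<delta> ^ (m - mi_order \<alpha>) *\<^sub>R taylor_monomial \<alpha> x else 0)"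

text \<open>\<open>J\<close> collects the orders of the derivatives that are bounded by
  \<open>M\<close>: \<open>{..m}\<close> for the inhomogeneous and \<open>{m}\<close> for the
  homogeneous space, so that one argument serves both.\<close>

definition Cm_ball :: "nat set \<Rightarrow> nat \<Rightarrow> real \<Rightarrow> (real^'n::finite \<Rightarrow> real^'d::finite) \<Rightarrow> bool" where
  "Cm_ball J m M F \<longleftrightarrow> (\<forall>j. cont_diff m (\<lambda>x. F x $ j) \<and>
     (\<forall>\<alpha> x. mi_order \<alpha> \<in> J \<longrightarrow> \<bar>mi_deriv \<alpha> (\<lambda>x. F x $ j) x\<bar> \<le> M))"

text \<open>Boundedness belongs to the conjunction because the supremum of an unbounded set of reals
  says nothing about its elements.\<close>

lemma Max_SUP_le_iff:
  fixes g :: "'i \<Rightarrow> 'j::finite \<Rightarrow> 'x \<Rightarrow> real"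
  assumes "finite Q" "Q \<noteq> {}"
  shows "(\<forall>j. \<forall>a\<in>Q. bounded (range (g a j))) \<and> (MAX (a, j)\<in>Q \<times> UNIV. SUP x. \<bar>g a j x\<bar>) \<le> M \<longleftrightarrow>
    (\<forall>j. \<forall>a\<in>Q. \<forall>x. \<bar>g a j x\<bar> \<le> M)"
proof -
  have bdd: "bdd_above (range (\<lambda>x. \<bar>g a j x\<bar>))" if "bounded (range (g a j))" for a j
    using that by (auto simp: bounded_iff bdd_above_def)
  have Max: "(MAX (a, j)\<in>Q \<times> UNIV. SUP x. \<bar>g a j x\<bar>) \<le> M \<longleftrightarrow> (\<forall>a\<in>Q. \<forall>j. (SUP x. \<bar>g a j x\<bar>) \<le> M)"
    using assms by (subst Max_le_iff) auto
  show ?thesis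
  proof
    assume *: "(\<forall>j. \<forall>a\<in>Q. bounded (range (g a j))) \<and> (MAX (a, j)\<in>Q \<times> UNIV. SUP x. \<bar>g a j x\<bar>) \<le> M"
    show "\<forall>j. \<forall>a\<in>Q. \<forall>x. \<bar>g a j x\<bar> \<le> M"
    proof (intro allI ballI)
      fix j a x assume a: "a \<in> Q"
      have "\<bar>g a j x\<bar> \<le> (SUP x. \<bar>g a j x\<bar>)" using * a by (intro cSUP_upper bdd) auto
      also have "\<dots> \<le> M" using * a unfolding Max by blast
      finally show "\<bar>g a j x\<bar> \<le> M" .
    qed
  next
    assume *: "\<forall>j. \<forall>a\<in>Q. \<forall>x. \<bar>g a j x\<bar> \<le> M"
    then have "bounded (range (g a j))" if "a \<in> Q" for a j
      using that by (auto simp: bounded_iff)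
    moreover have "(SUP x. \<bar>g a j x\<bar>) \<le> M" if "a \<in> Q" for a j
      using * that by (intro cSUP_least) auto
    ultimately show "(\<forall>j. \<forall>a\<in>Q. bounded (range (g a j))) \<and> (MAX (a, j)\<in>Q \<times> UNIV. SUP x. \<bar>g a j x\<bar>) \<le> M"
      unfolding Max by blast
  qed
qed

lemma ex_mi_order: "\<exists>\<alpha> :: 'n::finite mindex. mi_order \<alpha> = m"
  using mi_order_count_list[of "replicate m (undefined :: 'n)"] by auto

lemma Cm_ball_iff:
  fixes F :: "real^'n::finite \<Rightarrow> real^'d::finite"
  shows "F \<in> Cm m \<and> Cm_norm m F \<le> M \<longleftrightarrow> Cm_ball {..m} m M F"
proof -
  have "{\<alpha> :: 'n mindex. mi_order \<alpha> \<le> m} \<noteq> {}" using ex_mi_order[of m] by auto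
  note * = Max_SUP_le_iff[OF finite_mi_order(1) this, of "\<lambda>\<alpha> j. mi_deriv \<alpha> (\<lambda>x. F x $ j)" M]
  show ?thesis using * unfolding Cm_def Cm_norm_def Cm_ball_def by auto
qed

lemma Cm_dot_ball_iff:
  fixes F :: "real^'n::finite \<Rightarrow> real^'d::finite"
  shows "F \<in> Cm_dot m \<and> Cm_dot_norm m F \<le> M \<longleftrightarrow> Cm_ball {m} m M F"
proof -
  have "{\<alpha> :: 'n mindex. mi_order \<alpha> = m} \<noteq> {}" using ex_mi_order[of m] by auto
  moreover have "finite {\<alpha> :: 'n mindex. mi_order \<alpha> = m}"
    by (rule finite_subset[OF _ finite_mi_order(1)[of m]]) auto
  ultimately have "(\<forall>j. \<forall>\<alpha>\<in>{\<alpha>. mi_order \<alpha> = m}. bounded (range (mi_deriv \<alpha> (\<lambda>x. F x $ j)))) \<and> Cm_dot_norm m F \<le> M \<longleftrightarrow>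
      (\<forall>j. \<forall>\<alpha>\<in>{\<alpha>. mi_order \<alpha> = m}. \<forall>x. \<bar>mi_deriv \<alpha> (\<lambda>x. F x $ j) x\<bar> \<le> M)"
    unfolding Cm_dot_norm_def by (intro Max_SUP_le_iff)
  then show ?thesis unfolding Cm_dot_def Cm_ball_def by auto
qed

lemma taylor_monomial_scaled_deriv:
  assumes "norm (x - y) \<le> \<delta>"
  shows "\<bar>mi_deriv \<beta> (\<lambda>z. c * taylor_monomial \<alpha> y z) x\<bar> * \<delta> ^ mi_order \<beta> \<le> \<bar>c\<bar> * \<delta> ^ mi_order \<alpha>"
proof -
  obtain L where L: "length L = mi_order \<beta>" "\<And>f. cont_diff (mi_order \<beta>) f \<Longrightarrow> mi_deriv \<beta> f = list_deriv L f"
    using ex_mi_deriv_eq_list_deriv[of \<beta>] by blast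
  have "\<bar>mi_deriv \<beta> (\<lambda>z. c * taylor_monomial \<alpha> y z) x\<bar> * \<delta> ^ mi_order \<beta> =
      \<bar>c\<bar> * (\<bar>list_deriv L (taylor_monomial \<alpha> y) x\<bar> * \<delta> ^ length L)"
    by (simp add: L cont_diff_cmult cont_diff_taylor_monomial list_deriv_cmult abs_mult)
  also have "\<dots> \<le> \<bar>c\<bar> * \<delta> ^ mi_order \<alpha>"
    using list_deriv_taylor_monomial_bound[OF assms, of L \<alpha>] by (intro mult_left_mono) auto
  finally show ?thesis .
qed

lemma poly_gen_in: "mi_order \<alpha> < m \<Longrightarrow> poly_gen m x \<delta> (j, \<alpha>) \<in> vec_polys m"
  using taylor_monomial_in_polys[of \<alpha> m x]
  by (auto simp: vec_polys_def poly_gen_def polys_def span_scale span_zero)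

lemma subspace_vec_polys: "subspace (vec_polys m)"
  unfolding subspace_def vec_polys_def polys_def by (auto simp: span_add span_scale span_zero)

lemma vec_poly_expand:
  fixes P :: "(real^'n::finite \<Rightarrow> real)^'d::finite"
  assumes P: "P \<in> vec_polys m" and \<delta>: "\<delta> > 0"
  shows "P = (\<Sum>(j, \<alpha>)\<in>UNIV \<times> {\<alpha>. mi_order \<alpha> < m}.
    (mi_deriv \<alpha> (P $ j) x / \<delta> ^ (m - mi_order \<alpha>)) *\<^sub>R poly_gen m x \<delta> (j, \<alpha>))"
proof (subst vec_eq_iff, rule allI)
  fix i
  have "(\<Sum>(j, \<alpha>)\<in>UNIV \<times> {\<alpha>. mi_order \<alpha> < m}.
      (mi_deriv \<alpha> (P $ j) x / \<delta> ^ (m - mi_order \<alpha>)) *\<^sub>R poly_gen m x \<delta> (j, \<alpha>)) $ i =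
    (\<Sum>j\<in>UNIV. \<Sum>\<alpha> | mi_order \<alpha> < m. if i = j then mi_deriv \<alpha> (P $ j) x *\<^sub>R taylor_monomial \<alpha> x else 0)"
    unfolding sum.cartesian_product sum_component
    by (rule sum.cong) (use \<delta> in \<open>auto simp: poly_gen_def\<close>)
  also have "\<dots> = (\<Sum>j\<in>UNIV. if i = j then (\<Sum>\<alpha> | mi_order \<alpha> < m. mi_deriv \<alpha> (P $ j) x *\<^sub>R taylor_monomial \<alpha> x) else 0)"
    by (rule sum.cong) auto
  also have "\<dots> = (\<Sum>\<alpha> | mi_order \<alpha> < m. mi_deriv \<alpha> (P $ i) x *\<^sub>R taylor_monomial \<alpha> x)"
    by simp
  also have "\<dots> = jet m x (P $ i)"
    by (simp add: fun_eq_iff sum_fun_apply jet_eq scaleR_fun_def)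
  also have "\<dots> = P $ i" using P by (intro jet_poly) (auto simp: vec_polys_def)
  finally show "P $ i = (\<Sum>(j, \<alpha>)\<in>UNIV \<times> {\<alpha>. mi_order \<alpha> < m}.
      (mi_deriv \<alpha> (P $ j) x / \<delta> ^ (m - mi_order \<alpha>)) *\<^sub>R poly_gen m x \<delta> (j, \<alpha>)) $ i" by simp
qed

text \<open>Common source of \<open>increment\<close>, \<open>rebase\<close> and the first
  alternative of \<open>root\<close>: the coefficients of a polynomial in the generators are its
  rescaled derivatives at \<open>x\<close>.\<close>

lemma vec_poly_coefficients:
  fixes P :: "(real^'n::finite \<Rightarrow> real)^'d::finite"
  assumes P: "P \<in> vec_polys m" and \<delta>: "\<delta> > 0"
    and bound: "\<And>j \<alpha>. mi_order \<alpha> < m \<Longrightarrow> \<bar>mi_deriv \<alpha> (P $ j) x\<bar> \<le> C * \<delta> ^ (m - mi_order \<alpha>)"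
  shows "\<exists>t. (\<forall>k\<in>UNIV \<times> {\<alpha>. mi_order \<alpha> < m}. \<bar>t k\<bar> \<le> C) \<and>
    P = (\<Sum>k\<in>UNIV \<times> {\<alpha>. mi_order \<alpha> < m}. t k *\<^sub>R poly_gen m x \<delta> k)"
proof (intro exI conjI ballI)
  let ?t = "\<lambda>(j, \<alpha>). mi_deriv \<alpha> (P $ j) x / \<delta> ^ (m - mi_order \<alpha>)"
  show "P = (\<Sum>k\<in>UNIV \<times> {\<alpha>. mi_order \<alpha> < m}. ?t k *\<^sub>R poly_gen m x \<delta> k)"
    using vec_poly_expand[OF P \<delta>, of x] by (simp add: case_prod_unfold)
  show "\<bar>?t k\<bar> \<le> C" if "k \<in> UNIV \<times> {\<alpha>. mi_order \<alpha> < m}" for k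
    using that bound \<delta> by (auto simp: abs_mult field_simps)
qed

lemma jet_zero: "jet m x (\<lambda>_. 0) = 0"
proof -
  have "0 \<in> polys m" unfolding polys_def by (rule span_zero)
  from jet_poly[OF this, of x] show ?thesis unfolding zero_fun_def .
qed

lemma vec_jet_in: "vec_jet m x F \<in> vec_polys m"
  by (simp add: vec_polys_def vec_jet_def jet_in_polys)

lemma Cm_ball_add:
  fixes F :: "real^'n::finite \<Rightarrow> real^'d::finite"
  assumes "Cm_ball J m M F" "Cm_ball J m M' F'" "J \<subseteq> {..m}"
  shows "Cm_ball J m (M + M') (\<lambda>x. F x + F' x)"
  unfolding Cm_ball_def
proof (intro allI conjI impI)
  fix j
  have cd: "cont_diff m (\<lambda>x. F x $ j)" "cont_diff m (\<lambda>x. F' x $ j)" using assms by (auto simp: Cm_ball_def)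
  then show "cont_diff m (\<lambda>x. (F x + F' x) $ j)" by (simp add: cont_diff_add)
  fix \<alpha> :: "'n mindex" and x assume \<alpha>: "mi_order \<alpha> \<in> J"
  then have "cont_diff (mi_order \<alpha>) (\<lambda>x. F x $ j)" "cont_diff (mi_order \<alpha>) (\<lambda>x. F' x $ j)"
    using cd assms(3) by (auto elim: cont_diff_mono)
  moreover have "\<bar>mi_deriv \<alpha> (\<lambda>x. F x $ j) x\<bar> \<le> M" "\<bar>mi_deriv \<alpha> (\<lambda>x. F' x $ j) x\<bar> \<le> M'"
    using assms \<alpha> by (auto simp: Cm_ball_def)
  ultimately show "\<bar>mi_deriv \<alpha> (\<lambda>x. (F x + F' x) $ j) x\<bar> \<le> M + M'" by (simp add: mi_deriv_add)
qed

lemma Cm_ball_scale: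
  fixes F :: "real^'n::finite \<Rightarrow> real^'d::finite"
  assumes "Cm_ball J m M F" "J \<subseteq> {..m}"
  shows "Cm_ball J m (\<bar>t\<bar> * M) (\<lambda>x. t *\<^sub>R F x)"
  unfolding Cm_ball_def
proof (intro allI conjI impI)
  fix j
  have cd: "cont_diff m (\<lambda>x. F x $ j)" using assms by (auto simp: Cm_ball_def)
  then show "cont_diff m (\<lambda>x. (t *\<^sub>R F x) $ j)" by (simp add: cont_diff_cmult)
  fix \<alpha> :: "'n mindex" and x assume \<alpha>: "mi_order \<alpha> \<in> J"
  then have "cont_diff (mi_order \<alpha>) (\<lambda>x. F x $ j)" using cd assms(2) by (auto elim: cont_diff_mono)
  moreover have "\<bar>mi_deriv \<alpha> (\<lambda>x. F x $ j) x\<bar> \<le> M" using assms \<alpha> by (auto simp: Cm_ball_def)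
  ultimately show "\<bar>mi_deriv \<alpha> (\<lambda>x. (t *\<^sub>R F x) $ j) x\<bar> \<le> \<bar>t\<bar> * M"
    by (simp add: mi_deriv_cmult abs_mult mult_left_mono)
qed

lemma Cm_ball_mono: "Cm_ball J m M F \<Longrightarrow> M \<le> M' \<Longrightarrow> Cm_ball J m M' F"
  unfolding Cm_ball_def by (meson order_trans)

lemma vec_jet_add:
  assumes "Cm_ball J m M F" "Cm_ball J m M' F'"
  shows "vec_jet m x (\<lambda>x. F x + F' x) = vec_jet m x F + vec_jet m x F'"
  using assms by (simp add: vec_jet_def vec_eq_iff Cm_ball_def jet_add)

lemma vec_jet_scale:
  assumes "Cm_ball J m M F"
  shows "vec_jet m x (\<lambda>x. t *\<^sub>R F x) = t *\<^sub>R vec_jet m x F"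
  using assms by (simp add: vec_jet_def vec_eq_iff Cm_ball_def jet_cmult)

text \<open>A cutoff at scale \<open>\<delta> / N\<close> times a generator. Each derivative costs a
  factor of order \<open>1 / \<delta>\<close>, while the generator has size of order
  \<open>\<delta> ^ m\<close> near the cluster; so the derivatives up to order \<open>m\<close> stay
  bounded for \<open>\<delta> \<le> 1\<close>.\<close>

lemma ex_bump:
  fixes N :: nat
  assumes N: "N \<ge> 1" and J: "J \<subseteq> {..m}"
  shows "\<exists>C\<ge>1. \<forall>T A (x0 :: real^'n) \<delta> (k :: 'd::finite \<times> 'n mindex).
    finite T \<longrightarrow> A \<subseteq> T \<longrightarrow> card A \<le> N \<longrightarrow> x0 \<in> A \<longrightarrow> 0 < \<delta> \<longrightarrow> \<delta> \<le> 1 \<longrightarrow> (\<forall>x\<in>A. dist x x0 \<le> \<delta>) \<longrightarrow>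
    (\<forall>x\<in>A. \<forall>y\<in>T - A. \<delta> / real N \<le> dist x y) \<longrightarrow> mi_order (snd k) < m \<longrightarrow>
    (\<exists>F. Cm_ball J m C F \<and> (\<forall>y\<in>A. vec_jet m y F = poly_gen m x0 \<delta> k) \<and> (\<forall>y\<in>T - A. vec_jet m y F = 0))"
proof -
  obtain b where b: "b \<ge> 1" and cut: "\<forall>(A :: (real^'n) set) s. finite A \<and> card A \<le> N \<and> s > 0 \<longrightarrow>
    (\<exists>\<theta>. cont_diff m \<theta> \<and> (\<forall>y. \<forall>z\<in>A. dist y z < s/4 \<longrightarrow> \<theta> y = 1) \<and>
       (\<forall>y. (\<forall>z\<in>A. dist y z \<ge> s/2) \<longrightarrow> \<theta> y = 0) \<and>
       (\<forall>L y. length L \<le> m \<longrightarrow> \<bar>list_deriv L \<theta> y\<bar> \<le> b * (1/s) ^ length L))"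
    using ex_cluster_cutoff[of N m, where ?'n = 'n] by (elim exE conjE)
  \<comment> \<open>The factors are the Leibniz constant, the cutoff bound with \<open>1 / s\<close>
    rewritten as \<open>N / \<delta>\<close>, and \<open>2 ^ m\<close> for monomials up to distance
    \<open>2 * \<delta>\<close>.\<close>
  define C where "C = 2 ^ m * (b * real N ^ m) * 2 ^ m"
  have "(1 * (1 * 1)) * 1 \<le> C" unfolding C_def using b N by (intro mult_mono one_le_power) auto
  then have C1: "C \<ge> 1" by simp
  have "\<exists>F. Cm_ball J m C F \<and> (\<forall>y\<in>A. vec_jet m y F = poly_gen m x0 \<delta> (j, \<alpha>)) \<and> (\<forall>y\<in>T - A. vec_jet m y F = 0)"
    if T: "finite T" "A \<subseteq> T" "card A \<le> N" "x0 \<in> A" and \<delta>: "0 < \<delta>" "\<delta> \<le> 1" and diam: "\<forall>x\<in>A. dist x x0 \<le> \<delta>"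
      and sep: "\<forall>x\<in>A. \<forall>y\<in>T - A. \<delta> / real N \<le> dist x y" and \<alpha>: "mi_order \<alpha> < m"
    for T A and x0 :: "real^'n" and \<delta> and j :: 'd and \<alpha> :: "'n mindex"
  proof -
    define s where "s = \<delta> / real N"
    have s: "s > 0" "s \<le> \<delta>" using \<delta> N by (auto simp: s_def field_simps)
    have fA: "finite A" using T finite_subset by blast
    have "finite A \<and> card A \<le> N \<and> s > 0" using fA T(3) s(1) by blast
    from cut[THEN spec, THEN spec, THEN mp, OF this]
    obtain \<theta> where \<theta>': "cont_diff m \<theta>" "\<forall>y. \<forall>z\<in>A. dist y z < s/4 \<longrightarrow> \<theta> y = 1"
      "\<forall>y. (\<forall>z\<in>A. dist y z \<ge> s/2) \<longrightarrow> \<theta> y = 0"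
      "\<forall>L y. length L \<le> m \<longrightarrow> \<bar>list_deriv L \<theta> y\<bar> \<le> b * (1/s) ^ length L"
      by (elim exE conjE)
    have \<theta>: "cont_diff m \<theta>" "\<And>y z. z \<in> A \<Longrightarrow> dist y z < s/4 \<Longrightarrow> \<theta> y = 1"
      "\<And>y. (\<And>z. z \<in> A \<Longrightarrow> dist y z \<ge> s/2) \<Longrightarrow> \<theta> y = 0"
      "\<And>L y. length L \<le> m \<Longrightarrow> \<bar>list_deriv L \<theta> y\<bar> \<le> b * (1/s) ^ length L"
      using \<theta>' by blast+
    define c where "c = \<delta> ^ (m - mi_order \<alpha>)"
    define g where "g y = c * taylor_monomial \<alpha> x0 y" for y
    define f where "f y = \<theta> y * g y" for y
    define F :: "real^'n \<Rightarrow> real^'d" where "F y = (\<chi> k. if k = j then f y else 0)" for y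
    have gcd: "cont_diff k g" for k unfolding g_def[abs_def] by (intro cont_diff_cmult cont_diff_taylor_monomial)
    have fcd: "cont_diff m f" unfolding f_def[abs_def] by (intro cont_diff_mult \<theta>(1) gcd)
    have fbound: "\<bar>list_deriv L f y\<bar> \<le> C" if L: "length L \<le> m" for L y
    proof (cases "dist y x0 \<le> 2 * \<delta>")
      case True
      have "\<bar>list_deriv L f y\<bar> \<le> 2 ^ length L * (b * real N ^ m) * (2 ^ m * \<delta> ^ m) * (1/\<delta>) ^ length L"
        unfolding f_def[abs_def]
      proof (rule list_deriv_mult_bound[where k = m])
        fix L' :: "'n list" assume L': "length L' \<le> m"
        have "(1/s) ^ length L' = real N ^ length L' * (1/\<delta>) ^ length L'"
          by (simp add: s_def power_mult_distrib[symmetric])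
        also have "\<dots> \<le> real N ^ m * (1/\<delta>) ^ length L'"
          using N L' \<delta> by (intro mult_right_mono power_increasing) auto
        finally have "b * (1/s) ^ length L' \<le> b * (real N ^ m * (1/\<delta>) ^ length L')"
          using b by (intro mult_left_mono) auto
        then show "\<bar>list_deriv L' \<theta> y\<bar> \<le> b * real N ^ m * (1/\<delta>) ^ length L'"
          using \<theta>(4)[OF L', of y] by (simp add: mult.assoc)
        have "\<bar>list_deriv L' (taylor_monomial \<alpha> x0) y\<bar> * (2 * \<delta>) ^ length L' \<le> (2 * \<delta>) ^ mi_order \<alpha>"
          by (rule list_deriv_taylor_monomial_bound) (use True in \<open>simp add: dist_norm\<close>)
        moreover have "\<bar>list_deriv L' (taylor_monomial \<alpha> x0) y\<bar> * \<delta> ^ length L' \<le>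
            \<bar>list_deriv L' (taylor_monomial \<alpha> x0) y\<bar> * (2 * \<delta>) ^ length L'"
          using \<delta> by (intro mult_left_mono power_mono) auto
        moreover have "(2 * \<delta>) ^ mi_order \<alpha> \<le> 2 ^ m * \<delta> ^ mi_order \<alpha>"
          unfolding power_mult_distrib using \<alpha> \<delta> by (intro mult_right_mono power_increasing) auto
        ultimately have "\<bar>list_deriv L' (taylor_monomial \<alpha> x0) y\<bar> * \<delta> ^ length L' \<le> 2 ^ m * \<delta> ^ mi_order \<alpha>"
          by linarith
        then have "c * (\<bar>list_deriv L' (taylor_monomial \<alpha> x0) y\<bar> * \<delta> ^ length L') \<le> c * (2 ^ m * \<delta> ^ mi_order \<alpha>)"
          using \<delta> by (intro mult_left_mono) (auto simp: c_def)
        also have "c * (2 ^ m * \<delta> ^ mi_order \<alpha>) = 2 ^ m * \<delta> ^ m"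
          using \<alpha> by (simp add: c_def mult_ac power_add[symmetric])
        finally have "c * \<bar>list_deriv L' (taylor_monomial \<alpha> x0) y\<bar> * \<delta> ^ length L' \<le> 2 ^ m * \<delta> ^ m"
          by (simp add: mult.assoc)
        moreover have "\<bar>list_deriv L' g y\<bar> = c * \<bar>list_deriv L' (taylor_monomial \<alpha> x0) y\<bar>"
          unfolding g_def[abs_def] using \<delta>
          by (simp add: list_deriv_cmult cont_diff_taylor_monomial abs_mult) (simp add: c_def)
        ultimately show "\<bar>list_deriv L' g y\<bar> \<le> 2 ^ m * \<delta> ^ m * (1/\<delta>) ^ length L'"
          using \<delta> by (simp add: power_one_over pos_le_divide_eq)
      qed (use \<theta>(1) gcd L b N \<delta> in auto)
      also have "\<dots> = (2 ^ length L * (b * real N ^ m) * 2 ^ m) * \<delta> ^ (m - length L)"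
        using L \<delta> by (simp add: power_diff power_one_over)
      also have "\<dots> \<le> (2 ^ m * (b * real N ^ m) * 2 ^ m) * 1"
        using L \<delta> b by (intro mult_mono mult_right_mono power_increasing power_le_one) auto
      finally show ?thesis by (simp add: C_def)
    next
      case False
      \<comment> \<open>The cutoff vanishes at distance \<open>s / 2\<close> from \<open>A\<close>,
        and \<open>A\<close> lies within \<open>\<delta>\<close> of \<open>x0\<close>, so
        \<open>f\<close> is 0 off \<open>cball x0 (2 * \<delta>)\<close>.\<close>
      have "list_deriv L f y = list_deriv L (\<lambda>_. 0) y"
      proof (rule list_deriv_local[of "- cball x0 (2 * \<delta>)"])
        fix z assume z: "z \<in> - cball x0 (2 * \<delta>)"
        have "\<theta> z = 0"
        proof (rule \<theta>(3))
          fix u assume "u \<in> A"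
          then have "dist u x0 \<le> \<delta>" using diam by blast
          moreover have "dist z x0 \<le> dist z u + dist u x0" by (rule dist_triangle)
          ultimately show "dist z u \<ge> s/2" using z s by (simp add: dist_commute)
        qed
        then show "f z = 0" by (simp add: f_def)
      qed (use False in \<open>auto simp: dist_commute\<close>)
      then show ?thesis using C1 by (simp add: list_deriv_const)
    qed
    have comp: "(\<lambda>x. F x $ k) = (if k = j then f else (\<lambda>_. 0))" for k by (auto simp: F_def)
    have "Cm_ball J m C F"
      unfolding Cm_ball_def comp
    proof (intro allI conjI impI)
      show "cont_diff m (if k = j then f else (\<lambda>_. 0))" for k using fcd by simp
      fix k x and \<beta> :: "'n mindex" assume \<beta>: "mi_order \<beta> \<in> J"
      then have \<beta>m: "mi_order \<beta> \<le> m" using J by auto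
      obtain L where L: "length L = mi_order \<beta>" "\<And>f. cont_diff (mi_order \<beta>) f \<Longrightarrow> mi_deriv \<beta> f = list_deriv L f"
        using ex_mi_deriv_eq_list_deriv[of \<beta>] by blast
      show "\<bar>mi_deriv \<beta> (if k = j then f else (\<lambda>_. 0)) x\<bar> \<le> C"
        using fbound[of L x] L \<beta>m cont_diff_mono[OF fcd \<beta>m] C1 by (simp add: list_deriv_const)
    qed
    moreover have "vec_jet m y F = poly_gen m x0 \<delta> (j, \<alpha>)" if y: "y \<in> A" for y
    proof -
      \<comment> \<open>Around \<open>y\<close> the cutoff is 1, and the polynomial \<open>g\<close>
        is its own jet at every point; so all points of \<open>A\<close> carry the same
        polynomial.\<close>
      have "jet m y f = jet m y g"
        by (rule jet_local[of "ball y (s/4)"]) (use y s \<theta>(2) in \<open>auto simp: f_def dist_commute\<close>)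
      also have "g = c *\<^sub>R taylor_monomial \<alpha> x0" by (simp add: g_def[abs_def] scaleR_fun_def)
      also have "jet m y \<dots> = \<dots>"
        using taylor_monomial_in_polys[OF \<alpha>] by (intro jet_poly) (simp add: polys_def span_scale)
      finally have "jet m y f = c *\<^sub>R taylor_monomial \<alpha> x0" .
      moreover have "jet m y (\<lambda>_. 0) = 0"
        by (rule jet_zero)
      ultimately show ?thesis by (simp add: vec_jet_def comp poly_gen_def vec_eq_iff c_def)
    qed
    moreover have "vec_jet m y F = 0" if y: "y \<in> T - A" for y
    proof -
      \<comment> \<open>\<open>y\<close> keeps distance \<open>s\<close> from \<open>A\<close>, so
        the cutoff vanishes on the ball of radius \<open>s / 2\<close> around it.\<close>
      have "jet m y f = jet m y (\<lambda>_. 0)"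
      proof (rule jet_local[of "ball y (s/2)"])
        fix z assume z: "z \<in> ball y (s/2)"
        have "\<theta> z = 0"
        proof (rule \<theta>(3))
          fix u assume "u \<in> A"
          then have "s \<le> dist u y" using sep y by (auto simp: s_def)
          then show "dist z u \<ge> s/2" using z dist_triangle[of u y z] by (simp add: dist_commute)
        qed
        then show "f z = 0" by (simp add: f_def)
      qed (use s in auto)
      moreover have "jet m y (\<lambda>_. 0) = 0"
        by (rule jet_zero)
      ultimately show ?thesis by (simp add: vec_jet_def comp vec_eq_iff)
    qed
    ultimately show ?thesis by blast
  qed
  then show ?thesis using C1 by (intro exI[of _ C]) (auto simp: split_paired_all)
qed

section \<open>Jets as a selection system and the conclusion\<close>

lemma selection_system_jets:
  fixes J :: "nat set"
  assumes N: "N \<ge> 1" and J: "J = {..m} \<or> J = {m}"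
  shows "\<exists>C0. selection_system (vec_polys m :: ((real^'n::finite \<Rightarrow> real)^'d::finite) set)
    (UNIV \<times> {\<alpha>. mi_order \<alpha> < m}) (poly_gen m)
    (\<lambda>M p. \<exists>F. Cm_ball J m M F \<and> p = (\<lambda>x. vec_jet m x F)) N C0"
proof -
  have J': "J \<subseteq> {..m}" "m \<in> J" using J by auto
  obtain C where C: "C \<ge> 1" and bump: "\<forall>T A (x0 :: real^'n) \<delta> (k :: 'd \<times> 'n mindex).
    finite T \<longrightarrow> A \<subseteq> T \<longrightarrow> card A \<le> N \<longrightarrow> x0 \<in> A \<longrightarrow> 0 < \<delta> \<longrightarrow> \<delta> \<le> 1 \<longrightarrow> (\<forall>x\<in>A. dist x x0 \<le> \<delta>) \<longrightarrow>
    (\<forall>x\<in>A. \<forall>y\<in>T - A. \<delta> / real N \<le> dist x y) \<longrightarrow> mi_order (snd k) < m \<longrightarrow>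
    (\<exists>F. Cm_ball J m C F \<and> (\<forall>y\<in>A. vec_jet m y F = poly_gen m x0 \<delta> k) \<and> (\<forall>y\<in>T - A. vec_jet m y F = 0))"
    using ex_bump[OF N J'(1), where ?'n = 'n and ?'d = 'd] by (elim exE conjE)
  \<comment> \<open>One constant for all axioms: \<open>C\<close> for the bumps and
    \<open>CARD('n) ^ m\<close> for the Taylor estimate.\<close>
  define C0 where "C0 = max C (real CARD('n) ^ m)"
  have C0: "C \<le> C0" "real CARD('n) ^ m \<le> C0" "1 \<le> C0" using C by (auto simp: C0_def)
  let ?Idx = "UNIV \<times> {\<alpha>. mi_order \<alpha> < m} :: ('d \<times> 'n mindex) set"
  let ?V = "vec_polys m :: ((real^'n \<Rightarrow> real)^'d) set"
  let ?fld = "\<lambda>M p. \<exists>F :: real^'n \<Rightarrow> real^'d. Cm_ball J m M F \<and> p = (\<lambda>x. vec_jet m x F)"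
  have fin: "finite ?Idx" by (intro finite_cartesian_product finite_mi_order finite)
  have gen_in: "poly_gen m x d k \<in> ?V" if "k \<in> ?Idx" for x d k
    using that poly_gen_in by auto
  have gen_span: "?V \<subseteq> span (poly_gen m x d ` ?Idx)" if "d > 0" for x d
  proof
    fix P assume P: "P \<in> ?V"
    show "P \<in> span (poly_gen m x d ` ?Idx)"
      by (subst vec_poly_expand[OF P that, of x], rule span_sum) (auto intro!: span_scale[OF span_base])
  qed
  have "selection_system ?V ?Idx (poly_gen m) ?fld N C0"
  proof
    have "span (poly_gen m 0 1 ` ?Idx) \<subseteq> ?V"
      using gen_in subspace_vec_polys by (intro span_minimal) auto
    then show "\<exists>Bv. finite Bv \<and> ?V = span Bv"
      using gen_span[of 1 0] finite_imageI[OF fin] by (intro exI[of _ "poly_gen m 0 1 ` ?Idx"]) auto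
    show "finite ?Idx" by (rule fin)
    show "C0 \<ge> 1" "N \<ge> 1" using C0 N by auto
    show "poly_gen m x d k \<in> ?V" if "k \<in> ?Idx" for x d k using that by (rule gen_in)
    show "?V \<subseteq> span (poly_gen m x d ` ?Idx)" if "d > 0" for x d using that by (rule gen_span)
    show "p x \<in> ?V" if "?fld M p" for M p x using that vec_jet_in by auto
    show "?fld (M + M') (\<lambda>x. p x + q x)" if fp: "?fld M p" and fq: "?fld M' q" for M M' p q
    proof -
      obtain F F' where F: "Cm_ball J m M F" "p = (\<lambda>x. vec_jet m x F)" "Cm_ball J m M' F'" "q = (\<lambda>x. vec_jet m x F')"
        using fp fq by blast
      show ?thesis
        using Cm_ball_add[OF F(1,3) J'(1)] vec_jet_add[OF F(1,3)] F(2,4)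
        by (intro exI[of _ "\<lambda>x. F x + F' x"]) auto
    qed
    show "?fld (\<bar>t\<bar> * M) (\<lambda>x. t *\<^sub>R p x)" if fp: "?fld M p" for M p t
    proof -
      obtain F where F: "Cm_ball J m M F" "p = (\<lambda>x. vec_jet m x F)" using fp by blast
      show ?thesis
        using Cm_ball_scale[OF F(1) J'(1)] vec_jet_scale[OF F(1)] F(2)
        by (intro exI[of _ "\<lambda>x. t *\<^sub>R F x"]) auto
    qed
    show "?fld M' p" if "?fld M p" "M \<le> M'" for M M' p using that Cm_ball_mono by blast
    show "\<exists>t. (\<forall>k\<in>?Idx. \<bar>t k\<bar> \<le> C0) \<and> p x - p y = (\<Sum>k\<in>?Idx. t k *\<^sub>R poly_gen m x d k)"
      if fp: "?fld 1 p" and d: "0 < d" "dist x y \<le> d" for p x y d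
    proof -
      obtain F :: "real^'n \<Rightarrow> real^'d" where F: "Cm_ball J m 1 F" "p = (\<lambda>x. vec_jet m x F)" using fp by blast
      show ?thesis
      proof (rule vec_poly_coefficients[OF _ d(1)])
        show "p x - p y \<in> ?V" using F(2) vec_jet_in subspace_diff[OF subspace_vec_polys] by blast
        fix j and \<alpha> :: "'n mindex" assume \<alpha>: "mi_order \<alpha> < m"
        have "\<bar>mi_deriv \<alpha> (\<lambda>z. jet m x (\<lambda>z. F z $ j) z - jet m y (\<lambda>z. F z $ j) z) x\<bar> \<le>
            real CARD('n) ^ m * 1 * norm (x - y) ^ (m - mi_order \<alpha>)"
          by (rule jet_difference_bound) (use F(1) J'(2) \<alpha> in \<open>auto simp: Cm_ball_def\<close>)
        also have "\<dots> \<le> C0 * d ^ (m - mi_order \<alpha>)"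
          using C0 d by (intro mult_mono power_mono) (auto simp: dist_norm)
        finally show "\<bar>mi_deriv \<alpha> ((p x - p y) $ j) x\<bar> \<le> C0 * d ^ (m - mi_order \<alpha>)"
          by (simp add: F(2) vec_jet_def fun_diff_def)
      qed
    qed
    show "\<exists>t. (\<forall>l\<in>?Idx. \<bar>t l\<bar> \<le> C0) \<and> poly_gen m y d k = (\<Sum>l\<in>?Idx. t l *\<^sub>R poly_gen m x d l)"
      if d: "0 < d" "dist x y \<le> d" and k: "k \<in> ?Idx" for x y d k
    proof (rule vec_poly_coefficients[OF gen_in[OF k] d(1)])
      obtain i \<alpha> where k': "k = (i, \<alpha>)" "mi_order \<alpha> < m" using k by auto
      fix j and \<beta> :: "'n mindex" assume \<beta>: "mi_order \<beta> < m"
      define c where "c = (if j = i then d ^ (m - mi_order \<alpha>) else 0)"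
      have "poly_gen m y d k $ j = (\<lambda>z. c * taylor_monomial \<alpha> y z)"
        by (auto simp: k'(1) poly_gen_def c_def scaleR_fun_def)
      then have "\<bar>mi_deriv \<beta> (poly_gen m y d k $ j) x\<bar> * d ^ mi_order \<beta> \<le> \<bar>c\<bar> * d ^ mi_order \<alpha>"
        using taylor_monomial_scaled_deriv[of x y d \<beta> c \<alpha>] d by (simp add: dist_norm)
      also have "\<dots> \<le> d ^ (m - mi_order \<alpha>) * d ^ mi_order \<alpha>"
        using d by (intro mult_right_mono) (auto simp: c_def)
      also have "\<dots> = d ^ (m - mi_order \<beta>) * d ^ mi_order \<beta>"
        using k'(2) \<beta> by (simp add: power_add[symmetric])
      finally have "\<bar>mi_deriv \<beta> (poly_gen m y d k $ j) x\<bar> \<le> 1 * d ^ (m - mi_order \<beta>)"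
        using d by simp
      also have "\<dots> \<le> C0 * d ^ (m - mi_order \<beta>)" using C0(3) d by (intro mult_right_mono) auto
      finally show "\<bar>mi_deriv \<beta> (poly_gen m y d k $ j) x\<bar> \<le> C0 * d ^ (m - mi_order \<beta>)" .
    qed
    show "\<exists>t. \<bar>t\<bar> \<le> 1 \<and> poly_gen m x d k = t *\<^sub>R poly_gen m x d' k"
      if d: "0 < d" "d \<le> d'" and k: "k \<in> ?Idx" for x d d' k
    proof -
      obtain i \<alpha> where k': "k = (i, \<alpha>)" by fastforce
      define r where "r = m - mi_order \<alpha>"
      have "d ^ r \<le> d' ^ r" "d' ^ r > 0" using d by (auto intro: power_mono)
      then show ?thesis using d
        by (intro exI[of _ "d ^ r / d' ^ r"]) (auto simp: k' poly_gen_def vec_eq_iff r_def[symmetric])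
    qed
    show "\<exists>p. ?fld C0 p \<and> (\<forall>y\<in>A. p y = poly_gen m x0 d k) \<and> (\<forall>y\<in>T - A. p y = 0)"
      if T: "finite T" "A \<subseteq> T" "card A \<le> N" "x0 \<in> A" "0 < d" "d \<le> 1" "\<forall>x\<in>A. dist x x0 \<le> d"
        "\<forall>x\<in>A. \<forall>y\<in>T - A. d / real N \<le> dist x y" and k: "k \<in> ?Idx" for T A x0 d k
    proof -
      have "mi_order (snd k) < m" using k by auto
      from bump[THEN spec, THEN spec, THEN spec, THEN spec, THEN spec, THEN mp, THEN mp, THEN mp, THEN mp, THEN mp,
          THEN mp, THEN mp, THEN mp, THEN mp, OF T this]
      obtain F where "Cm_ball J m C F" "\<forall>y\<in>A. vec_jet m y F = poly_gen m x0 d k" "\<forall>y\<in>T - A. vec_jet m y F = 0"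
        by (elim exE conjE)
      then show ?thesis using Cm_ball_mono[OF _ C0(1)]
        by (intro exI[of _ "\<lambda>x. vec_jet m x F"] conjI exI[of _ F]) auto
    qed
    show "(\<forall>p x. ?fld 1 p \<longrightarrow> (\<exists>t. (\<forall>k\<in>?Idx. \<bar>t k\<bar> \<le> C0) \<and> p x = (\<Sum>k\<in>?Idx. t k *\<^sub>R poly_gen m x 1 k)))
      \<or> (\<forall>P\<in>?V. ?fld 1 (\<lambda>_. P))"
      using J
    proof
      \<comment> \<open>At the base point the derivatives of the jet are those of \<open>F\<close>,
        and these are all at most 1.\<close>
      assume Jm: "J = {..m}"
      have "\<exists>t. (\<forall>k\<in>?Idx. \<bar>t k\<bar> \<le> C0) \<and> p x = (\<Sum>k\<in>?Idx. t k *\<^sub>R poly_gen m x 1 k)" if fp: "?fld 1 p" for p x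
      proof -
        obtain F :: "real^'n \<Rightarrow> real^'d" where F: "Cm_ball J m 1 F" "p = (\<lambda>x. vec_jet m x F)" using fp by blast
        show ?thesis
        proof (rule vec_poly_coefficients)
          show "p x \<in> ?V" using F(2) vec_jet_in by blast
          fix j and \<alpha> :: "'n mindex" assume \<alpha>: "mi_order \<alpha> < m"
          obtain L where L: "length L = mi_order \<alpha>" "\<And>f. cont_diff (mi_order \<alpha>) f \<Longrightarrow> mi_deriv \<alpha> f = list_deriv L f"
            using ex_mi_deriv_eq_list_deriv[of \<alpha>] by blast
          have cd: "cont_diff m (\<lambda>z. F z $ j)" using F(1) by (auto simp: Cm_ball_def)
          then have cd': "cont_diff (mi_order \<alpha>) (\<lambda>z. F z $ j)" using \<alpha> by (auto elim: cont_diff_mono)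
          have "mi_deriv \<alpha> (p x $ j) x = mi_deriv \<alpha> (\<lambda>z. F z $ j) x"
            using L \<alpha> cd cd' by (simp add: F(2) vec_jet_def cont_diff_jet list_deriv_jet jet_center)
          moreover have "\<bar>mi_deriv \<alpha> (\<lambda>z. F z $ j) x\<bar> \<le> 1" using F(1) \<alpha> by (simp add: Cm_ball_def Jm)
          ultimately show "\<bar>mi_deriv \<alpha> (p x $ j) x\<bar> \<le> C0 * 1 ^ (m - mi_order \<alpha>)" using C0(3) by simp
        qed simp
      qed
      then show ?thesis by blast
    next
      \<comment> \<open>A polynomial of degree below \<open>m\<close> has vanishing derivatives of
        order \<open>m\<close>, so its constant jet field is free of cost.\<close>
      assume Jm: "J = {m}"
      have "?fld 1 (\<lambda>_. P)" if P: "P \<in> ?V" for P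
      proof (intro exI conjI)
        let ?F = "\<lambda>x. \<chi> j. (P $ j) x"
        have Pj: "P $ j \<in> polys m" for j using P by (simp add: vec_polys_def)
        show "(\<lambda>_. P) = (\<lambda>x. vec_jet m x ?F)"
          by (simp add: vec_jet_def vec_eq_iff fun_eq_iff jet_poly[OF Pj])
        show "Cm_ball J m 1 ?F"
          unfolding Cm_ball_def
        proof (intro allI conjI impI)
          show "cont_diff m (\<lambda>x. ?F x $ j)" for j using polys_smooth(1)[OF Pj] by simp
          fix j x and \<alpha> :: "'n mindex" assume "mi_order \<alpha> \<in> J"
          then have \<alpha>: "mi_order \<alpha> = m" by (simp add: Jm)
          obtain L where L: "length L = mi_order \<alpha>" "\<And>f. cont_diff (mi_order \<alpha>) f \<Longrightarrow> mi_deriv \<alpha> f = list_deriv L f"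
            using ex_mi_deriv_eq_list_deriv[of \<alpha>] by blast
          have "mi_deriv \<alpha> (P $ j) = (\<lambda>_. 0)"
            using L \<alpha> polys_smooth[OF Pj] by simp
          then show "\<bar>mi_deriv \<alpha> (\<lambda>x. ?F x $ j) x\<bar> \<le> 1" by simp
        qed
      qed
      then show ?thesis by blast
    qed
  qed
  then show ?thesis by blast
qed

text \<open>The bound is obtained for each cardinality separately and made a function of it by
  choice; \<open>X\<close> translates the norm of either space into \<open>Cm_ball\<close>.\<close>

lemma finiteness_principle_jets:
  assumes J: "J = {..m} \<or> J = {m}"
    and X: "\<And>F M. F \<in> X \<and> nrm F \<le> M \<longleftrightarrow> Cm_ball J m M F"
  shows "\<exists>\<gamma> :: nat \<Rightarrow> real. \<forall>(S :: (real^'n) set) (G :: real^'n \<Rightarrow> ((real^'n \<Rightarrow> real)^'d) set).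
      finite S \<and> diameter S \<le> 1 \<and>
      (\<forall>x\<in>S. G x \<subseteq> vec_polys m \<and> convex (G x)) \<and>
      (\<forall>S'\<subseteq>S. card S' \<le> 2 ^ dim (vec_polys m :: ((real^'n \<Rightarrow> real)^'d) set) \<longrightarrow>
         (\<exists>F\<in>X. nrm F \<le> 1 \<and> (\<forall>x\<in>S'. vec_jet m x F \<in> G x)))
      \<longrightarrow> (\<exists>F\<in>X. nrm F \<le> \<gamma> (card S) \<and> (\<forall>x\<in>S. vec_jet m x F \<in> G x))"
    (is "\<exists>\<gamma>. \<forall>S G. ?hyp S G \<longrightarrow> ?sel (\<gamma> (card S)) S G")
proof -
  have "\<exists>\<gamma>. \<forall>S G. ?hyp S G \<longrightarrow> card S = N \<longrightarrow> ?sel \<gamma> S G" for N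
  proof -
    \<comment> \<open>The system asks for a positive bound on the cardinalities;
      \<open>Suc N\<close> also covers the empty set.\<close>
    have "Suc N \<ge> 1" by simp
    from selection_system_jets[OF this J] obtain C0 where "selection_system (vec_polys m :: ((real^'n \<Rightarrow> real)^'d) set)
      (UNIV \<times> {\<alpha>. mi_order \<alpha> < m}) (poly_gen m)
      (\<lambda>M p. \<exists>F. Cm_ball J m M F \<and> p = (\<lambda>x. vec_jet m x F)) (Suc N) C0" ..
    then interpret selection_system "vec_polys m :: ((real^'n \<Rightarrow> real)^'d) set"
      "UNIV \<times> {\<alpha>. mi_order \<alpha> < m}" "poly_gen m"
      "\<lambda>M p. \<exists>F. Cm_ball J m M F \<and> p = (\<lambda>x. vec_jet m x F)" "Suc N" C0 .
    obtain \<gamma> where \<gamma>: "\<forall>S G. finite S \<longrightarrow> card S \<le> Suc N \<longrightarrow> (\<forall>x\<in>S. \<forall>y\<in>S. dist x y \<le> 1) \<longrightarrow>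
       (\<forall>x\<in>S. G x \<subseteq> (vec_polys m :: ((real^'n \<Rightarrow> real)^'d) set) \<and> convex (G x)) \<longrightarrow>
       (\<forall>S'\<subseteq>S. card S' \<le> 2 ^ dim (vec_polys m :: ((real^'n \<Rightarrow> real)^'d) set) \<longrightarrow>
          (\<exists>p. (\<exists>F. Cm_ball J m 1 F \<and> p = (\<lambda>x. vec_jet m x F)) \<and> (\<forall>x\<in>S'. p x \<in> G x))) \<longrightarrow>
       (\<exists>p. (\<exists>F. Cm_ball J m \<gamma> F \<and> p = (\<lambda>x. vec_jet m x F)) \<and> (\<forall>x\<in>S. p x \<in> G x))"
      using finiteness_principle by (elim exE conjE)
    show ?thesis
    proof (intro exI[of _ \<gamma>] allI impI)
      fix S G assume hyp: "?hyp S G" and "card S = N"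
      then have S: "finite S" "card S \<le> Suc N" "diameter S \<le> 1" and G: "\<forall>x\<in>S. G x \<subseteq> vec_polys m \<and> convex (G x)"
        by simp_all
      have diam: "\<forall>x\<in>S. \<forall>y\<in>S. dist x y \<le> 1"
        using diameter_bounded_bound[OF finite_imp_bounded[OF S(1)]] S(3) by (meson order_trans)
      have sel: "\<forall>S'\<subseteq>S. card S' \<le> 2 ^ dim (vec_polys m :: ((real^'n \<Rightarrow> real)^'d) set) \<longrightarrow>
          (\<exists>p. (\<exists>F. Cm_ball J m 1 F \<and> p = (\<lambda>x. vec_jet m x F)) \<and> (\<forall>x\<in>S'. p x \<in> G x))"
      proof (intro allI impI)
        fix S' assume "S' \<subseteq> S" "card S' \<le> 2 ^ dim (vec_polys m :: ((real^'n \<Rightarrow> real)^'d) set)"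
        then obtain F where "Cm_ball J m 1 F" "\<forall>x\<in>S'. vec_jet m x F \<in> G x" using hyp X by blast
        then show "\<exists>p. (\<exists>F. Cm_ball J m 1 F \<and> p = (\<lambda>x. vec_jet m x F)) \<and> (\<forall>x\<in>S'. p x \<in> G x)"
          by (intro exI[of _ "\<lambda>x. vec_jet m x F"] conjI exI[of _ F]) auto
      qed
      from \<gamma>[THEN spec, THEN spec, THEN mp, THEN mp, THEN mp, THEN mp, THEN mp, OF S(1,2) diam G sel]
      obtain F where "Cm_ball J m \<gamma> F" "\<forall>x\<in>S. vec_jet m x F \<in> G x" by auto
      then show "?sel \<gamma> S G" using X by blast
    qed
  qed
  then have "\<forall>N. \<exists>\<gamma>. \<forall>S G. ?hyp S G \<longrightarrow> card S = N \<longrightarrow> ?sel \<gamma> S G" by (rule allI)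
  from choice[OF this] obtain \<gamma> where \<gamma>: "\<forall>N. \<forall>S G. ?hyp S G \<longrightarrow> card S = N \<longrightarrow> ?sel (\<gamma> N) S G" ..
  show ?thesis
  proof (intro exI[of _ \<gamma>] allI impI)
    fix S G assume "?hyp S G"
    from \<gamma>[THEN spec, THEN spec, THEN spec, THEN mp, THEN mp, OF this refl] show "?sel (\<gamma> (card S)) S G" .
  qed
qed

theorem theorem1p4:
  fixes m :: nat
  shows "\<exists>\<gamma> :: nat \<Rightarrow> real.
    \<forall>(X :: (real^'n \<Rightarrow> real^'d) set, nrm) \<in> {(Cm m, Cm_norm m), (Cm_dot m, Cm_dot_norm m)}.
    \<forall>(S :: (real^'n) set) (G :: real^'n \<Rightarrow> ((real^'n \<Rightarrow> real)^'d) set).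
      finite S \<and> diameter S \<le> 1 \<and>
      (\<forall>x\<in>S. G x \<subseteq> vec_polys m \<and> convex (G x)) \<and>
      (\<forall>S'\<subseteq>S. card S' \<le> 2 ^ dim (vec_polys m :: ((real^'n \<Rightarrow> real)^'d) set) \<longrightarrow>
         (\<exists>F\<in>X. nrm F \<le> 1 \<and> (\<forall>x\<in>S'. vec_jet m x F \<in> G x)))
      \<longrightarrow> (\<exists>F\<in>X. nrm F \<le> \<gamma> (card S) \<and> (\<forall>x\<in>S. vec_jet m x F \<in> G x))"
proof -
  let ?hyp = "\<lambda>(X :: (real^'n \<Rightarrow> real^'d) set) nrm S G. finite S \<and> diameter S \<le> 1 \<and>
      (\<forall>x\<in>S. G x \<subseteq> vec_polys m \<and> convex (G x)) \<and>
      (\<forall>S'\<subseteq>S. card S' \<le> 2 ^ dim (vec_polys m :: ((real^'n \<Rightarrow> real)^'d) set) \<longrightarrow>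
         (\<exists>F\<in>X. nrm F \<le> (1::real) \<and> (\<forall>x\<in>S'. vec_jet m x F \<in> G x)))"
  let ?sel = "\<lambda>(X :: (real^'n \<Rightarrow> real^'d) set) nrm \<gamma> S G. \<exists>F\<in>X. nrm F \<le> (\<gamma> :: real) \<and> (\<forall>x\<in>S. vec_jet m x F \<in> G x)"
  obtain \<gamma>1 where \<gamma>1: "\<forall>S G. ?hyp (Cm m) (Cm_norm m) S G \<longrightarrow> ?sel (Cm m) (Cm_norm m) (\<gamma>1 (card S)) S G"
    using finiteness_principle_jets[where m = m, OF disjI1[OF refl] Cm_ball_iff] by (elim exE)
  obtain \<gamma>2 where \<gamma>2: "\<forall>S G. ?hyp (Cm_dot m) (Cm_dot_norm m) S G \<longrightarrow>
      ?sel (Cm_dot m) (Cm_dot_norm m) (\<gamma>2 (card S)) S G"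
    using finiteness_principle_jets[where m = m, OF disjI2[OF refl] Cm_dot_ball_iff] by (elim exE)
  \<comment> \<open>One function serves both spaces, as enlarging the bound preserves the
    conclusion.\<close>
  define \<gamma> where "\<gamma> N = max (\<gamma>1 N) (\<gamma>2 N)" for N
  have mono: "?sel X nrm a S G \<Longrightarrow> a \<le> b \<Longrightarrow> ?sel X nrm b S G" for X nrm a b S G
    by (meson order_trans)
  have le: "\<gamma>1 N \<le> \<gamma> N" "\<gamma>2 N \<le> \<gamma> N" for N by (simp_all add: \<gamma>_def)
  show ?thesis
  proof (rule exI[of _ \<gamma>], clarify)
    fix X :: "(real^'n \<Rightarrow> real^'d) set" and nrm S and G :: "real^'n \<Rightarrow> ((real^'n \<Rightarrow> real)^'d) set"
    assume X: "(X, nrm) \<in> {(Cm m, Cm_norm m), (Cm_dot m, Cm_dot_norm m)}"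
      and S: "finite S" "diameter S \<le> 1" "\<forall>x\<in>S. G x \<subseteq> vec_polys m \<and> convex (G x)"
        "\<forall>S'\<subseteq>S. card S' \<le> 2 ^ dim (vec_polys m :: ((real^'n \<Rightarrow> real)^'d) set) \<longrightarrow>
          (\<exists>F\<in>X. nrm F \<le> 1 \<and> (\<forall>x\<in>S'. vec_jet m x F \<in> G x))"
    then have hyp: "?hyp X nrm S G" by blast
    from X consider "X = Cm m" "nrm = Cm_norm m" | "X = Cm_dot m" "nrm = Cm_dot_norm m" by auto
    then show "?sel X nrm (\<gamma> (card S)) S G"
    proof cases
      case 1
      then have "?sel X nrm (\<gamma>1 (card S)) S G" using \<gamma>1[THEN spec, THEN spec, THEN mp, of S G] hyp by simp
      then show ?thesis using le(1) by (rule mono)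
    next
      case 2
      then have "?sel X nrm (\<gamma>2 (card S)) S G" using \<gamma>2[THEN spec, THEN spec, THEN mp, of S G] hyp by simp
      then show ?thesis using le(2) by (rule mono)
    qed
  qed
qed

end
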